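(* Let $X_1,\ldots,X_n$ be i.i.d. with density $s$ on $[0,1]$, let $\{S_m\}_{m\in\mathcal M_n}$ be a collection of models with projection estimators $\widehat s_m$, and assume that (SqI), (Pol), (RegD), (Dmax), (Rich), (LoEx), (Bias) and (OrSp) (all stated in the context) hold. For every $p\in\{1,\ldots,n-1\}$ let $\widehat m=\widehat m(p)$ denote a minimizer of the leave-$p$-out criterion $\widehat R_p(m)$ over $m\in\mathcal M_n$. Then there exist a sequence $(\delta_n)_{n}$ with $\delta_n\to0$ and $n\delta_n\to+\infty$ as $n\to+\infty$, and an event $\widetilde\Omega$ with $\mathbb P(\widetilde\Omega)\ge 1-6/n^2$ on which, for large enough values of $n$ (and every $p\in\{1,\ldots,n-1\}$), $$\|s-\widehat s_{\widehat m(p)}\|^2\le C_n(p)\inf_{m\in\mathcal M_n}\big\{\|s-\widehat s_m\|^2\big\},\qquad C_n(p)=\frac{T_B^+\vee T_V^+}{T_B^-\wedge T_V^-}\ge1,$$ where $$T_B^-=1-\delta_nK(n,p),\qquad T_V^-=\frac{1}{1-p/n}(1-\delta_n)(1-4\delta_n)-2\delta_nK(n,p)(3-4\delta_n),$$ $$T_B^+=1+\delta_nK(n,p),\qquad T_V^+=\frac{1}{1-p/n}(1+\delta_n)(1+4\delta_n)+2\delta_nK(n,p)(3+4\delta_n),$$ and $K(n,p)=1+\frac{2}{n-1}+\frac{p}{n-p}\,\frac1{n-1}$.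
   Context: $\|\cdot\|$ is the norm of $L^2([0,1])$. For each $n$, $\mathcal M_n$ is a (countable) index set; for $m\in\mathcal M_n$, $\{\varphi_\lambda\}_{\lambda\in\Lambda(m)}$ is a finite orthonormal family of real-valued measurable functions in $L^2([0,1])$, $S_m$ its linear span, $D_m=\dim S_m$, $s_m$ the orthogonal projection of $s$ onto $S_m$, and $\phi_m=\sum_{\lambda\in\Lambda(m)}\varphi_\lambda^2$. The projection estimator is $\widehat s_m=\sum_{\lambda\in\Lambda(m)}\big(\frac1n\sum_{i=1}^n\varphi_\lambda(X_i)\big)\varphi_\lambda$, and its quadratic risk is $R_n(\widehat s_m)=\mathbb E[\|s-\widehat s_m\|^2]$. Leave-$p$-out: for $e\subset\{1,\ldots,n\}$ with $\mathrm{Card}(e)=p$, $\widehat s_m(X^{(e)})=\sum_{\lambda\in\Lambda(m)}\big(\frac1{n-p}\sum_{i\notin e}\varphi_\lambda(X_i)\big)\varphi_\lambda$, and with $\gamma(u;x)=\|u\|^2-2u(x)$, $\mathcal E_p=\{e:\mathrm{Card}(e)=p\}$, $\widehat R_p(m)=\binom np^{-1}\sum_{e\in\mathcal E_p}\frac1p\sum_{i\in e}\gamma(\widehat s_m(X^{(e)});X_i)$. Assumptions (constants do not depend on $n$): (SqI) $s\in L^2([0,1])$. (Pol) There is $a_{\mathcal M}\ge0$ with $\mathrm{Card}(\mathcal M_n)\le n^{a_{\mathcal M}}$. (RegD) There is $\Phi>0$ with $\sup_{m\in\mathcal M_n}\|\phi_m\|_\infty/D_m\le\Phi$. (Dmax)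 $\sup_{m\in\mathcal M_n}D_m\le\Gamma\, n/(\log n)^2$, with $\Gamma=1$. (LoEx) There is $\xi>0$ with $\inf_{m\in\mathcal M_n}\sqrt n\,\mathbb E(\|s_m-\widehat s_m\|)/\sqrt{D_m}\ge\sqrt\xi$. (Rich) There exist $m_0\in\mathcal M_n$ and $c_{\mathrm{rich}}\ge1$ with $\sqrt n\le D_{m_0}\le c_{\mathrm{rich}}\sqrt n$. (Bias) There exist $c_\ell,c_u>0$ and $\ell>u>0$ such that $c_\ell D_m^{-\ell}\le\|s-s_m\|^2\le c_uD_m^{-u}$ for every $m\in\mathcal M_n$. (OrSp) $nR_n^*(\log n)^{-2}\to+\infty$ as $n\to\infty$, where $R_n^*=\inf_{m\in\mathcal M_n}R_n(\widehat s_m)$. *)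

theory Defs
  imports "HOL-Probability.Probability" "HOL-Library.Function_Algebras"
begin

section \<open>The space \<open>L\<^sup>2([0,1])\<close>\<close>

definition unit_leb :: "real measure" where
  "unit_leb = restrict_space lborel {0..1}"

definition square_integrable :: "(real \<Rightarrow> real) \<Rightarrow> bool" where
  "square_integrable f \<longleftrightarrow>
     f \<in> borel_measurable unit_leb \<and> integrable unit_leb (\<lambda>t. (f t)\<^sup>2)"

definition L2_inner :: "(real \<Rightarrow> real) \<Rightarrow> (real \<Rightarrow> real) \<Rightarrow> real" where
  "L2_inner f g = (LINT t|unit_leb. f t * g t)"

definition L2_norm :: "(real \<Rightarrow> real) \<Rightarrow> real" where
  "L2_norm f = sqrt (L2_inner f f)"

definition Linf_norm :: "(real \<Rightarrow> real) \<Rightarrow> ereal" where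
  "Linf_norm f = esssup unit_leb (\<lambda>t. ereal \<bar>f t\<bar>)"

definition orthonormal_family :: "('l \<Rightarrow> real \<Rightarrow> real) \<Rightarrow> 'l set \<Rightarrow> bool" where
  "orthonormal_family \<phi> L \<longleftrightarrow>
     (\<forall>l\<in>L. square_integrable (\<phi> l)) \<and>
     (\<forall>k\<in>L. \<forall>l\<in>L. L2_inner (\<phi> k) (\<phi> l) = (if k = l then 1 else 0))"

text \<open>Functions are not identified up to null sets. This affects neither span, dimension
  nor projection below: a linear combination of an orthonormal family that vanishes
  almost everywhere has only zero coefficients.\<close>

interpretation fun_vs: vector_space "\<lambda>(c::real) (f::real \<Rightarrow> real) t. c * f t"
  by unfold_locales (auto simp: fun_eq_iff algebra_simps)


section \<open>Models and estimators\<close>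

text \<open>A model is given by a finite index set \<open>L = \<Lambda>(m)\<close> of an orthonormal family
  \<open>(\<phi> l)\<close> for \<open>l \<in> L\<close>.\<close>

definition model_space :: "('l \<Rightarrow> real \<Rightarrow> real) \<Rightarrow> 'l set \<Rightarrow> (real \<Rightarrow> real) set" where
  "model_space \<phi> L = fun_vs.span (\<phi> ` L)"

definition model_dim :: "('l \<Rightarrow> real \<Rightarrow> real) \<Rightarrow> 'l set \<Rightarrow> nat" where
  "model_dim \<phi> L = fun_vs.dim (model_space \<phi> L)"

definition orth_proj :: "(real \<Rightarrow> real) set \<Rightarrow> (real \<Rightarrow> real) \<Rightarrow> real \<Rightarrow> real" where
  "orth_proj V s = (THE u. u \<in> V \<and> (\<forall>v\<in>V. L2_inner (\<lambda>t. s t - u t) v = 0))"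

definition phi_model :: "('l \<Rightarrow> real \<Rightarrow> real) \<Rightarrow> 'l set \<Rightarrow> real \<Rightarrow> real" where
  "phi_model \<phi> L t = (\<Sum>l\<in>L. (\<phi> l t)\<^sup>2)"

text \<open>The projection estimator computed from the observations \<open>x i\<close> with \<open>i \<in> I\<close>: the full
  sample is \<open>I = {1..n}\<close>, and leaving out \<open>e\<close> means \<open>I = {1..n} - e\<close>.\<close>

definition proj_est ::
    "('l \<Rightarrow> real \<Rightarrow> real) \<Rightarrow> 'l set \<Rightarrow> nat set \<Rightarrow> (nat \<Rightarrow> real) \<Rightarrow> real \<Rightarrow> real" where
  "proj_est \<phi> L I x t = (\<Sum>l\<in>L. (1 / real (card I) * (\<Sum>i\<in>I. \<phi> l (x i))) * \<phi> l t)"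

definition contrast :: "(real \<Rightarrow> real) \<Rightarrow> real \<Rightarrow> real" where
  "contrast u x = (L2_norm u)\<^sup>2 - 2 * u x"

definition lpo_risk ::
    "('l \<Rightarrow> real \<Rightarrow> real) \<Rightarrow> 'l set \<Rightarrow> nat \<Rightarrow> nat \<Rightarrow> (nat \<Rightarrow> real) \<Rightarrow> real" where
  "lpo_risk \<phi> L n p x =
     1 / real (n choose p) *
     (\<Sum>e | e \<subseteq> {1..n} \<and> card e = p.
        1 / real p * (\<Sum>i\<in>e. contrast (proj_est \<phi> L ({1..n} - e) x) (x i)))"

definition loss ::
    "(real \<Rightarrow> real) \<Rightarrow> ('l \<Rightarrow> real \<Rightarrow> real) \<Rightarrow> 'l set \<Rightarrow> nat \<Rightarrow> (nat \<Rightarrow> real) \<Rightarrow> real" where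
  "loss s \<phi> L n x = (L2_norm (\<lambda>t. s t - proj_est \<phi> L {1..n} x t))\<^sup>2"


section \<open>The sample\<close>

text \<open>For each sample size \<open>n\<close>, \<open>X n 1, \<dots>, X n n\<close> is an i.i.d. sample on the probability
  space \<open>P n\<close>. A single infinite i.i.d. sequence is the case where \<open>P n\<close> and \<open>X n\<close> do not
  depend on \<open>n\<close>.\<close>

definition iid_sample ::
    "'a measure \<Rightarrow> (nat \<Rightarrow> 'a \<Rightarrow> real) \<Rightarrow> nat \<Rightarrow> (real \<Rightarrow> real) \<Rightarrow> bool" where
  "iid_sample P X n s \<longleftrightarrow>
     prob_space P \<and>
     prob_space.indep_vars P (\<lambda>_. unit_leb) X {1..n} \<and>
     (\<forall>i\<in>{1..n}. distributed P unit_leb (X i) (\<lambda>t. ennreal (s t)))"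

definition quad_risk ::
    "'a measure \<Rightarrow> (nat \<Rightarrow> 'a \<Rightarrow> real) \<Rightarrow> (real \<Rightarrow> real) \<Rightarrow> ('l \<Rightarrow> real \<Rightarrow> real) \<Rightarrow> 'l set \<Rightarrow> nat \<Rightarrow> real"
  where
  "quad_risk P X s \<phi> L n = (LINT w|P. loss s \<phi> L n (\<lambda>i. X i w))"


section \<open>Assumptions\<close>

text \<open>\<open>Mod n\<close> indexes the models available for sample size \<open>n\<close>, and all constants are
  chosen before \<open>n\<close>. The assumptions are required for large \<open>n\<close> only: for moderate \<open>n\<close> (such
  as \<open>n = 50\<close>) \<open>sqrt n > n / (ln n)\<^sup>2\<close>, so \<open>assm_Rich\<close> and \<open>assm_Dmax\<close> exclude each other.
  Suprema and infima over \<open>Mod n\<close> that are compared with a bound are written as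
  inequalities for all \<open>m\<close>. \<open>assm_LoEx\<close> excludes models of dimension \<open>0\<close>, because of
  \<open>x / 0 = 0\<close>.\<close>

definition assm_Pol :: "(nat \<Rightarrow> 'm set) \<Rightarrow> bool" where
  "assm_Pol Mod \<longleftrightarrow>
     (\<exists>a\<ge>0. \<forall>\<^sub>F n in sequentially. finite (Mod n) \<and> real (card (Mod n)) \<le> real n powr a)"

definition assm_RegD ::
    "('l \<Rightarrow> real \<Rightarrow> real) \<Rightarrow> ('m \<Rightarrow> 'l set) \<Rightarrow> (nat \<Rightarrow> 'm set) \<Rightarrow> bool" where
  "assm_RegD \<phi> \<Lambda> Mod \<longleftrightarrow>
     (\<exists>\<Phi>>0. \<forall>\<^sub>F n in sequentially. \<forall>m\<in>Mod n.
        Linf_norm (phi_model \<phi> (\<Lambda> m)) / ereal (real (model_dim \<phi> (\<Lambda> m))) \<le> ereal \<Phi>)"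

definition assm_Dmax ::
    "('l \<Rightarrow> real \<Rightarrow> real) \<Rightarrow> ('m \<Rightarrow> 'l set) \<Rightarrow> (nat \<Rightarrow> 'm set) \<Rightarrow> bool" where
  "assm_Dmax \<phi> \<Lambda> Mod \<longleftrightarrow>
     (\<forall>\<^sub>F n in sequentially. \<forall>m\<in>Mod n.
        real (model_dim \<phi> (\<Lambda> m)) \<le> real n / (ln (real n))\<^sup>2)"

definition assm_LoEx ::
    "(nat \<Rightarrow> 'a measure) \<Rightarrow> (nat \<Rightarrow> nat \<Rightarrow> 'a \<Rightarrow> real) \<Rightarrow> (real \<Rightarrow> real) \<Rightarrow>
     ('l \<Rightarrow> real \<Rightarrow> real) \<Rightarrow> ('m \<Rightarrow> 'l set) \<Rightarrow> (nat \<Rightarrow> 'm set) \<Rightarrow> bool" where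
  "assm_LoEx P X s \<phi> \<Lambda> Mod \<longleftrightarrow>
     (\<exists>\<xi>>0. \<forall>\<^sub>F n in sequentially. \<forall>m\<in>Mod n.
        sqrt \<xi> \<le>
        sqrt (real n) *
          (LINT w|P n. L2_norm (\<lambda>t. orth_proj (model_space \<phi> (\<Lambda> m)) s t
                                    - proj_est \<phi> (\<Lambda> m) {1..n} (\<lambda>i. X n i w) t))
        / sqrt (real (model_dim \<phi> (\<Lambda> m))))"

definition assm_Rich ::
    "('l \<Rightarrow> real \<Rightarrow> real) \<Rightarrow> ('m \<Rightarrow> 'l set) \<Rightarrow> (nat \<Rightarrow> 'm set) \<Rightarrow> bool" where
  "assm_Rich \<phi> \<Lambda> Mod \<longleftrightarrow>
     (\<exists>c\<ge>1. \<forall>\<^sub>F n in sequentially. \<exists>m\<in>Mod n.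
        sqrt (real n) \<le> real (model_dim \<phi> (\<Lambda> m)) \<and>
        real (model_dim \<phi> (\<Lambda> m)) \<le> c * sqrt (real n))"

definition assm_Bias ::
    "(real \<Rightarrow> real) \<Rightarrow> ('l \<Rightarrow> real \<Rightarrow> real) \<Rightarrow> ('m \<Rightarrow> 'l set) \<Rightarrow> (nat \<Rightarrow> 'm set) \<Rightarrow> bool"
  where
  "assm_Bias s \<phi> \<Lambda> Mod \<longleftrightarrow>
     (\<exists>cl cu l u. cl > 0 \<and> cu > 0 \<and> l > u \<and> u > 0 \<and>
        (\<forall>\<^sub>F n in sequentially. \<forall>m\<in>Mod n.
           cl * real (model_dim \<phi> (\<Lambda> m)) powr (- l)
             \<le> (L2_norm (\<lambda>t. s t - orth_proj (model_space \<phi> (\<Lambda> m)) s t))\<^sup>2 \<and>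
           (L2_norm (\<lambda>t. s t - orth_proj (model_space \<phi> (\<Lambda> m)) s t))\<^sup>2
             \<le> cu * real (model_dim \<phi> (\<Lambda> m)) powr (- u)))"

definition assm_OrSp ::
    "(nat \<Rightarrow> 'a measure) \<Rightarrow> (nat \<Rightarrow> nat \<Rightarrow> 'a \<Rightarrow> real) \<Rightarrow> (real \<Rightarrow> real) \<Rightarrow>
     ('l \<Rightarrow> real \<Rightarrow> real) \<Rightarrow> ('m \<Rightarrow> 'l set) \<Rightarrow> (nat \<Rightarrow> 'm set) \<Rightarrow> bool" where
  "assm_OrSp P X s \<phi> \<Lambda> Mod \<longleftrightarrow>
     filterlim
       (\<lambda>n. real n * (INF m\<in>Mod n. quad_risk (P n) (X n) s \<phi> (\<Lambda> m) n) / (ln (real n))\<^sup>2)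
       at_top sequentially"


section \<open>The constant in the oracle inequality\<close>

text \<open>Here \<open>d\<close> stands for \<open>\<delta>\<^sub>n\<close>.\<close>

definition K_lpo :: "nat \<Rightarrow> nat \<Rightarrow> real" where
  "K_lpo n p = 1 + 2 / (real n - 1) + real p / (real n - real p) * (1 / (real n - 1))"

definition TB_minus :: "real \<Rightarrow> nat \<Rightarrow> nat \<Rightarrow> real" where
  "TB_minus d n p = 1 - d * K_lpo n p"

definition TV_minus :: "real \<Rightarrow> nat \<Rightarrow> nat \<Rightarrow> real" where
  "TV_minus d n p =
     1 / (1 - real p / real n) * (1 - d) * (1 - 4 * d) - 2 * d * K_lpo n p * (3 - 4 * d)"

definition TB_plus :: "real \<Rightarrow> nat \<Rightarrow> nat \<Rightarrow> real" where
  "TB_plus d n p = 1 + d * K_lpo n p"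

definition TV_plus :: "real \<Rightarrow> nat \<Rightarrow> nat \<Rightarrow> real" where
  "TV_plus d n p =
     1 / (1 - real p / real n) * (1 + d) * (1 + 4 * d) + 2 * d * K_lpo n p * (3 + 4 * d)"

definition C_lpo :: "real \<Rightarrow> nat \<Rightarrow> nat \<Rightarrow> real" where
  "C_lpo d n p = max (TB_plus d n p) (TV_plus d n p) / min (TB_minus d n p) (TV_minus d n p)"

end

theory Submission
  imports Defs
begin

text \<open>
  Write \<open>B\<close> for the squared bias of a model, \<open>D\<close> for its dimension, and decompose the squared norm of the
  vector of centred empirical coefficients, up to normalisation, into its diagonal part \<open>Q\<close> and its off-diagonal part
  \<open>Y\<close>. Multiplied by the sample size \<open>n\<close>, the loss is \<open>n B + Q + Y\<close>. The average over all
  subsets in the leave-p-out risk can be computed (\<open>lpo_risk_eq\<close>): up to a constant that is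
  the same for all models, \<open>n\<close> times the criterion is \<open>n B + \<kappa> Q - \<rho> Y - 2 l\<close>, with \<open>\<kappa> = n / (n - p) \<ge> 1\<close>,
  with \<open>\<rho>\<close> bounded, and with \<open>l\<close> linear in the empirical coefficients. If \<open>Y\<close> and the differences of \<open>l\<close> between
  models are negligible relative to the losses, the criterion lies between one and \<open>\<kappa>\<close> times the loss, and
  its minimiser satisfies the claimed inequality (\<open>criterion_comparison\<close>), since the constant of the theorem is at
  least \<open>\<kappa> (1 + \<delta>) / (1 - \<delta>)\<close> (\<open>C_lpo_ge\<close>). The exceptional event is the same for all \<open>p\<close>, because \<open>p\<close>
  enters only through \<open>\<kappa>\<close> and \<open>\<rho>\<close>.

  It remains to show that the fluctuations are negligible for all models at once. Put \<open>N = n B + D\<close>, which is the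
  order of \<open>n\<close> times the risk. The lower bound on the bias makes \<open>N\<close> at least a positive power \<open>n powr \<eta>\<close> of the
  sample size (\<open>dimension_tradeoff\<close>), while all fluctuations are at most of order \<open>N powr (3 / 4)\<close>. The gap is polynomial,
  and the number of models is polynomial, so it suffices to bound moments of a high but fixed order; exponential
  inequalities for suprema of empirical processes are avoided. The moments of sums of independent variables and
  of degenerate U-statistics both come from one recursion along the sample (\<open>martingale_moment\<close>).

  The density is only square integrable. For the quadratic terms this costs a factor \<open>sqrt D\<close> in the weak variance
  (\<open>score_weak_variance\<close>). For the linear terms, the projections onto two unrelated models are compared, and the
  variance of their difference \<open>f\<close> has to be bounded by \<open>sqrt D\<close> times the squared biases. The reason
  is pointwise (\<open>spiky_square_bound\<close>): where the density exceeds twice the largest possible value of the two projections,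
  the projection error is comparable to the density itself.
\<close>

section \<open>Moments of martingales on a product space\<close>

lemma mult_power_le_max:
  fixes x y :: real
  assumes "0 \<le> x" "0 \<le> y"
  shows "x ^ i * y ^ j \<le> x ^ (i + j) + y ^ (i + j)"
proof (cases "x \<le> y")
  case True
  have "x ^ i * y ^ j \<le> y ^ i * y ^ j"
    using assms True by (intro mult_right_mono power_mono) auto
  also have "\<dots> \<le> x ^ (i + j) + y ^ (i + j)"
    using assms by (simp add: power_add)
  finally show ?thesis .
next
  case False
  have "x ^ i * y ^ j \<le> x ^ i * x ^ j"
    using assms False by (intro mult_left_mono power_mono) auto
  also have "\<dots> \<le> x ^ (i + j) + y ^ (i + j)"
    using assms by (simp add: power_add)
  finally show ?thesis .
qed

text \<open>Evenness removes all absolute values, and the terms of order at least two of the binomial expansion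
are dominated by the two extreme ones. The term of order one is kept exactly because it
averages to zero when \<open>h\<close> is a centred increment.\<close>

lemma even_power_add_le:
  fixes a h :: real
  shows "(a + h) ^ (2 * Suc r) \<le> a ^ (2 * Suc r) + real (2 * Suc r) * a ^ (2 * r + 1) * h
           + 4 ^ Suc r * h\<^sup>2 * (a ^ (2 * r) + h ^ (2 * r))"
proof -
  let ?N = "2 * Suc r"
  let ?t = "\<lambda>k. real (?N choose k) * h ^ k * a ^ (?N - k)"
  let ?b = "h\<^sup>2 * (a ^ (2 * r) + h ^ (2 * r))"
  have b0: "0 \<le> ?b"
    by (intro mult_nonneg_nonneg add_nonneg_nonneg) auto
  have large: "?t k \<le> real (?N choose k) * ?b" if "k \<in> {2..?N}" for k
  proof -
    have k: "k = 2 + (k - 2)" using that by (intro le_add_diff_inverse[symmetric]) simp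
    define i where "i = k - 2"
    note k = k[folded i_def]
    have "h ^ k * a ^ (?N - k) \<le> \<bar>h ^ k * a ^ (?N - k)\<bar>" by simp
    also have "\<dots> = h\<^sup>2 * (\<bar>h\<bar> ^ i * \<bar>a\<bar> ^ (2 * r - i))"
      by (simp add: k abs_mult power_abs power2_eq_square)
    also have "\<dots> \<le> h\<^sup>2 * (\<bar>h\<bar> ^ (i + (2 * r - i)) + \<bar>a\<bar> ^ (i + (2 * r - i)))"
      by (intro mult_left_mono mult_power_le_max) auto
    also have "i + (2 * r - i) = 2 * r"
      using that k by auto
    also have "h\<^sup>2 * (\<bar>h\<bar> ^ (2 * r) + \<bar>a\<bar> ^ (2 * r)) = ?b"
      by (simp add: power_even_abs)
    finally have "h ^ k * a ^ (?N - k) \<le> ?b" .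
    then show ?thesis
      by (simp only: mult.assoc) (intro mult_left_mono, auto)
  qed
  have split: "{..?N} = {0, 1} \<union> {2..?N}" by auto
  have "(a + h) ^ ?N = (\<Sum>k\<le>?N. ?t k)"
    by (subst add.commute, subst binomial_ring) simp
  also have "\<dots> = a ^ ?N + real ?N * a ^ (2 * r + 1) * h + (\<Sum>k\<in>{2..?N}. ?t k)"
    unfolding split by (subst sum.union_disjoint) (auto simp: algebra_simps)
  also have "(\<Sum>k\<in>{2..?N}. ?t k) \<le> (\<Sum>k\<in>{2..?N}. real (?N choose k) * ?b)"
    using large by (intro sum_mono) blast
  also have "\<dots> \<le> (\<Sum>k\<le>?N. real (?N choose k) * ?b)"
    using b0 by (intro sum_mono2) auto
  also have "\<dots> = real (\<Sum>k\<le>?N. ?N choose k) * ?b"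
    by (simp only: sum_distrib_right of_nat_sum)
  also have "\<dots> = 4 ^ Suc r * ?b"
    by (simp only: choose_row_sum of_nat_power of_nat_numeral power_mult) simp
  finally show ?thesis by (simp add: mult.assoc)
qed

text \<open>The factor that the discrete Gronwall argument below produces for the moment of order
\<open>2 * Suc r\<close>: the recursion for \<open>n\<close> steps has rate \<open>4 ^ Suc r / n\<close> per step.\<close>

definition moment_const :: "nat \<Rightarrow> real" where
  "moment_const r = 2 * exp (4 ^ Suc r)"

text \<open>A martingale \<open>A\<close> on an i.i.d. sequence has increments \<open>H\<close> whose conditional variance and size are
controlled by the random scale \<open>\<tau>\<close>, which is itself only bounded in the mean of order \<open>Suc r\<close>, by
\<open>T\<close>. Integrating \<open>even_power_add_le\<close> over the newest observation removes the linear term; the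
remainder is split by Young's inequality, with \<open>a\<close> as the natural scale of \<open>A\<^sup>2\<close> and \<open>T\<close>
as that of \<open>\<tau>\<close>, into a multiple of \<open>A ^ (2 * Suc r)\<close> and a multiple of \<open>\<tau> ^ Suc r\<close>. Each step
contributes only a fraction \<open>1 / n\<close> of the target, so that \<open>n\<close> steps cost a constant factor.
A deterministic \<open>\<tau>\<close> gives sums of independent variables; a random \<open>\<tau>\<close> gives degenerate
U-statistics of order two.\<close>

lemma martingale_moment:
  fixes \<mu> :: "'x measure"
    and A :: "nat \<Rightarrow> (nat \<Rightarrow> 'x) \<Rightarrow> real" and H :: "nat \<Rightarrow> (nat \<Rightarrow> 'x) \<Rightarrow> 'x \<Rightarrow> real"
    and \<tau> :: "nat \<Rightarrow> (nat \<Rightarrow> 'x) \<Rightarrow> real" and n k :: nat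
  defines "\<Omega> \<equiv> \<lambda>k. PiM {1..k} (\<lambda>_. \<mu>)"
  assumes "prob_space \<mu>"
    and A_meas: "\<And>k. A k \<in> borel_measurable (\<Omega> k)"
    and A_bdd: "\<And>k. \<exists>K. \<forall>x\<in>space (\<Omega> k). \<bar>A k x\<bar> \<le> K"
    and A0: "\<And>x. A 0 x = 0"
    and A_Suc: "\<And>k x y. x \<in> space (\<Omega> k) \<Longrightarrow> y \<in> space \<mu> \<Longrightarrow> A (Suc k) (x(Suc k := y)) = A k x + H k x y"
    and H_meas: "\<And>k x. x \<in> space (\<Omega> k) \<Longrightarrow> H k x \<in> borel_measurable \<mu>"
    and H_mean: "\<And>k x. x \<in> space (\<Omega> k) \<Longrightarrow> (\<integral>y. H k x y \<partial>\<mu>) = 0"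
    and H_var: "\<And>k x. x \<in> space (\<Omega> k) \<Longrightarrow> (\<integral>y. (H k x y)\<^sup>2 \<partial>\<mu>) \<le> w * \<tau> k x"
    and H_bdd: "\<And>k x y. x \<in> space (\<Omega> k) \<Longrightarrow> y \<in> space \<mu> \<Longrightarrow> (H k x y)\<^sup>2 \<le> c * \<tau> k x"
    and \<tau>_nonneg: "\<And>k x. 0 \<le> \<tau> k x"
    and \<tau>_int: "\<And>k. integrable (\<Omega> k) (\<lambda>x. \<tau> k x ^ Suc r)"
    and \<tau>_moment: "\<And>k. k < n \<Longrightarrow> (\<integral>x. \<tau> k x ^ Suc r \<partial>\<Omega> k) \<le> C * T ^ Suc r"
    and pos: "0 \<le> w" "0 \<le> c" "0 < T" "0 < a" "0 \<le> C"
    and scale: "real n * w * T \<le> a" "c * T \<le> a"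
    and k_le: "k \<le> n"
  shows "integrable (\<Omega> k) (\<lambda>x. A k x ^ (2 * Suc r)) \<and>
    (\<integral>x. A k x ^ (2 * Suc r) \<partial>\<Omega> k) \<le> C * moment_const r * a ^ Suc r"
proof -
  interpret \<mu>: prob_space \<mu> by fact
  interpret product_prob_space "\<lambda>_. \<mu>" "{1..j}" for j ..
  have prob_\<Omega>: "prob_space (\<Omega> k)" for k
    unfolding \<Omega>_def by (intro prob_space_PiM \<open>prob_space \<mu>\<close>)
  let ?m = "\<lambda>k. \<integral>x. A k x ^ (2 * Suc r) \<partial>\<Omega> k"
  let ?F = "4 ^ Suc r :: real"
  have A_int: "integrable (\<Omega> k) (\<lambda>x. A k x ^ j)" for k j
  proof -
    obtain K where "\<forall>x\<in>space (\<Omega> k). \<bar>A k x\<bar> \<le> K" using A_bdd by blast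
    then have "AE x in \<Omega> k. norm (A k x ^ j) \<le> K ^ j"
      by (intro AE_I2) (auto simp: power_abs intro!: power_mono)
    then show ?thesis
      using A_meas[of k] prob_\<Omega>[of k]
      by (intro finite_measure.integrable_const_bound prob_space.finite_measure) auto
  qed
  have step: "?m (Suc k) \<le> ?m k + ?F / n * (2 * C * a ^ Suc r + ?m k)" if "k < n" for k
  proof -
    from that have n: "0 < real n" by auto
    have wT: "w * T \<le> a / n" using scale n by (simp add: field_simps)
    let ?g = "\<lambda>x. A k x ^ (2 * Suc r) + ?F / n * (2 * a ^ Suc r / T ^ Suc r * \<tau> k x ^ Suc r + A k x ^ (2 * Suc r))"
    \<comment> \<open>The average over the new observation, the past \<open>x\<close> being fixed.\<close>
    have inner: "(\<integral>y. (A k x + H k x y) ^ (2 * Suc r) \<partial>\<mu>) \<le> ?g x"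
      if x: "x \<in> space (\<Omega> k)" for x
    proof -
      let ?a = "A k x"
      let ?t = "\<tau> k x / T"
  let ?G = "2 * a ^ Suc r / T ^ Suc r * \<tau> k x ^ Suc r + ?a ^ (2 * Suc r)"
      have Hb: "\<bar>H k x y\<bar> \<le> sqrt (c * \<tau> k x)" if "y \<in> space \<mu>" for y
        using H_bdd[OF x that] by (simp add: real_le_rsqrt)
      have H_int: "integrable \<mu> (\<lambda>y. H k x y ^ j)" for j
      proof -
        have "AE y in \<mu>. norm (H k x y ^ j) \<le> sqrt (c * \<tau> k x) ^ j"
          using Hb by (intro AE_I2) (auto simp: power_abs intro!: power_mono)
        then show ?thesis
          using H_meas[OF x] by (intro \<mu>.integrable_const_bound) auto
      qed
      have AH_int: "integrable \<mu> (\<lambda>y. (?a + H k x y) ^ (2 * Suc r))"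
      proof -
        have "AE y in \<mu>. norm ((?a + H k x y) ^ (2 * Suc r)) \<le> (\<bar>?a\<bar> + sqrt (c * \<tau> k x)) ^ (2 * Suc r)"
        proof (intro AE_I2)
          fix y assume "y \<in> space \<mu>"
          then show "norm ((?a + H k x y) ^ (2 * Suc r)) \<le> (\<bar>?a\<bar> + sqrt (c * \<tau> k x)) ^ (2 * Suc r)"
            using Hb[of y] unfolding real_norm_def power_abs by (intro power_mono) auto
        qed
        then show ?thesis
          using H_meas[OF x] by (intro \<mu>.integrable_const_bound) auto
      qed
      have "(\<integral>y. (?a + H k x y) ^ (2 * Suc r) \<partial>\<mu>)
          \<le> (\<integral>y. (?a ^ (2 * Suc r) + real (2 * Suc r) * ?a ^ (2 * r + 1) * H k x y)
               + ?F * (?a ^ (2 * r) + (c * \<tau> k x) ^ r) * (H k x y)\<^sup>2 \<partial>\<mu>)"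
      proof (intro integral_mono AH_int)
        show "integrable \<mu> (\<lambda>y. (?a ^ (2 * Suc r) + real (2 * Suc r) * ?a ^ (2 * r + 1) * H k x y)
               + ?F * (?a ^ (2 * r) + (c * \<tau> k x) ^ r) * (H k x y)\<^sup>2)"
          using H_int[of 1] H_int[of 2] by auto
      next
        fix y assume y: "y \<in> space \<mu>"
        have "H k x y ^ (2 * r) \<le> (c * \<tau> k x) ^ r"
          unfolding power_mult by (intro power_mono H_bdd x y) auto
        then have "?F * (H k x y)\<^sup>2 * (?a ^ (2 * r) + H k x y ^ (2 * r))
            \<le> ?F * (H k x y)\<^sup>2 * (?a ^ (2 * r) + (c * \<tau> k x) ^ r)"
          by (intro mult_left_mono) auto
        with even_power_add_le[of ?a "H k x y" r]
        have "(?a + H k x y) ^ (2 * Suc r) \<le> ?a ^ (2 * Suc r) + real (2 * Suc r) * ?a ^ (2 * r + 1) * H k x y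
            + ?F * (H k x y)\<^sup>2 * (?a ^ (2 * r) + (c * \<tau> k x) ^ r)" by linarith
        then show "(?a + H k x y) ^ (2 * Suc r)
            \<le> (?a ^ (2 * Suc r) + real (2 * Suc r) * ?a ^ (2 * r + 1) * H k x y)
               + ?F * (?a ^ (2 * r) + (c * \<tau> k x) ^ r) * (H k x y)\<^sup>2"
          by (simp only: mult_ac)
      qed
      also have "\<dots> = ?a ^ (2 * Suc r)
          + ?F * (?a ^ (2 * r) + (c * \<tau> k x) ^ r) * (\<integral>y. (H k x y)\<^sup>2 \<partial>\<mu>)"
        using H_int[of 1] H_int[of 2] H_mean[OF x] \<mu>.prob_space by simp
      also have "\<dots> \<le> ?a ^ (2 * Suc r) + ?F * (?a ^ (2 * r) + (c * \<tau> k x) ^ r) * (w * \<tau> k x)"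
        using H_var[OF x] pos \<tau>_nonneg
        by (intro add_left_mono mult_left_mono mult_nonneg_nonneg add_nonneg_nonneg) (auto simp: power_mult)
      also have "\<dots> = ?a ^ (2 * Suc r) + ?F * ((?a ^ (2 * r) + (c * \<tau> k x) ^ r) * (w * \<tau> k x))"
        by (simp only: mult.assoc)
      finally have outer: "(\<integral>y. (?a + H k x y) ^ (2 * Suc r) \<partial>\<mu>) \<le> \<dots>" .
      have "(?a ^ (2 * r) + (c * \<tau> k x) ^ r) * (w * \<tau> k x)
          \<le> 1 / n * ?G"
      proof -
        have t0: "0 \<le> ?t" using pos \<tau>_nonneg[of k x] by simp
        have t: "\<tau> k x = T * ?t" using pos by simp
        have "(?a\<^sup>2 / a) ^ r * ?t ^ 1 \<le> (?a\<^sup>2 / a) ^ (r + 1) + ?t ^ (r + 1)"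
          by (intro mult_power_le_max t0) (use pos in auto)
        then have 1: "a ^ Suc r * ((?a\<^sup>2 / a) ^ r * ?t) \<le> a ^ Suc r * ((?a\<^sup>2 / a) ^ Suc r + ?t ^ Suc r)"
          using pos by (intro mult_left_mono) auto
        have 1: "a * (?a ^ (2 * r) * ?t) \<le> ?a ^ (2 * Suc r) + a ^ Suc r * ?t ^ Suc r"
        proof -
          have "a ^ Suc r * ((?a\<^sup>2 / a) ^ r * ?t) = a * (?a ^ (2 * r) * ?t)"
            using pos by (simp add: power_divide power_mult)
          moreover have "a ^ Suc r * ((?a\<^sup>2 / a) ^ Suc r + ?t ^ Suc r) = ?a ^ (2 * Suc r) + a ^ Suc r * ?t ^ Suc r"
            using pos by (simp only: power_divide power_mult distrib_left) (simp del: power_Suc)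
          ultimately show ?thesis using 1 by linarith
        qed
        have "(c * \<tau> k x) ^ r = (c * T * ?t) ^ r" using pos by simp
        also have "\<dots> \<le> (a * ?t) ^ r"
          using scale pos t0 by (intro power_mono mult_right_mono mult_nonneg_nonneg) auto
        finally have "(c * \<tau> k x) ^ r * (a * ?t) \<le> (a * ?t) ^ r * (a * ?t)"
          using pos t0 by (intro mult_right_mono mult_nonneg_nonneg) linarith+
        also have "\<dots> = a ^ Suc r * ?t ^ Suc r" by (simp add: power_mult_distrib power_divide mult_ac)
        finally have 2: "(c * \<tau> k x) ^ r * (a * ?t) \<le> a ^ Suc r * ?t ^ Suc r" .
        have "w * \<tau> k x \<le> a / n * ?t"
          using wT t0 t by (metis mult.assoc mult_right_mono)
        then have "(?a ^ (2 * r) + (c * \<tau> k x) ^ r) * (w * \<tau> k x) \<le> (?a ^ (2 * r) + (c * \<tau> k x) ^ r) * (a / n * ?t)"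
          using pos \<tau>_nonneg by (intro mult_left_mono add_nonneg_nonneg) (auto simp: power_mult)
        also have "\<dots> = 1 / n * (a * (?a ^ (2 * r) * ?t) + (c * \<tau> k x) ^ r * (a * ?t))"
          by (simp add: algebra_simps add_divide_distrib)
        also have "\<dots> \<le> 1 / n * (?a ^ (2 * Suc r) + a ^ Suc r * ?t ^ Suc r + a ^ Suc r * ?t ^ Suc r)"
          using 1 2 by (intro mult_left_mono add_mono) auto
        also have "\<dots> = 1 / n * ?G"
          by (simp add: power_divide)
        finally show ?thesis .
      qed
      then have "?F * ((?a ^ (2 * r) + (c * \<tau> k x) ^ r) * (w * \<tau> k x))
          \<le> ?F * (1 / n * ?G)"
        by (intro mult_left_mono) auto
      also have "\<dots> = ?F / n * ?G"
        by (simp only: mult.assoc[symmetric]) simp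
      finally show ?thesis using outer by linarith
    qed
    have "?m (Suc k) = (\<integral>x. A (Suc k) x ^ (2 * Suc r) \<partial>PiM (insert (Suc k) {1..k}) (\<lambda>_. \<mu>))"
      by (simp add: \<Omega>_def atLeastAtMostSuc_conv)
    also have "\<dots> = (\<integral>x. (\<integral>y. A (Suc k) (x(Suc k := y)) ^ (2 * Suc r) \<partial>\<mu>) \<partial>PiM {1..k} (\<lambda>_. \<mu>))"
    proof (rule product_integral_insert)
      show "integrable (PiM (insert (Suc k) {1..k}) (\<lambda>_. \<mu>)) (\<lambda>x. A (Suc k) x ^ (2 * Suc r))"
        using A_int[of "Suc k" "2 * Suc r"] by (simp add: \<Omega>_def atLeastAtMostSuc_conv)
    qed auto
    also have "\<dots> = (\<integral>x. (\<integral>y. (A k x + H k x y) ^ (2 * Suc r) \<partial>\<mu>) \<partial>\<Omega> k)"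
    proof -
      have "PiM {1..k} (\<lambda>_. \<mu>) = \<Omega> k" by (simp add: \<Omega>_def)
      then show ?thesis
        by (simp only:) (intro Bochner_Integration.integral_cong refl, simp add: A_Suc)
    qed
    also have "\<dots> \<le> (\<integral>x. ?g x \<partial>\<Omega> k)"
    proof (rule integral_mono')
      show "integrable (\<Omega> k) ?g" 
        by (intro Bochner_Integration.integrable_add integrable_mult_right A_int \<tau>_int)
      show "0 \<le> ?g x" if "x \<in> space (\<Omega> k)" for x
        by (rule order_trans[OF _ inner[OF that]], intro integral_nonneg_AE AE_I2 zero_le_even_power) simp
    qed (rule inner)
    also have "\<dots> = ?m k + ?F / n * (2 * a ^ Suc r / T ^ Suc r * (\<integral>x. \<tau> k x ^ Suc r \<partial>\<Omega> k) + ?m k)"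
      using A_int[of k "2 * Suc r"] \<tau>_int[of k] by simp
    also have "\<dots> \<le> ?m k + ?F / n * (2 * a ^ Suc r / T ^ Suc r * (C * T ^ Suc r) + ?m k)"
      using \<tau>_moment[OF \<open>k < n\<close>] pos by (intro add_mono mult_left_mono order_refl) auto
    also have "2 * a ^ Suc r / T ^ Suc r * (C * T ^ Suc r) = 2 * C * a ^ Suc r"
      using pos by simp
    finally show ?thesis .
  qed
  have gronwall: "?m k + 2 * C * a ^ Suc r \<le> (1 + ?F / n) ^ k * (2 * C * a ^ Suc r)" if "k \<le> n" for k
    using that
  proof (induction k)
    case 0
    then show ?case by (simp add: A0)
  next
    case (Suc k)
    have expand: "(1 + u) * (p + z) = p + u * (z + p) + z" for u p z :: real
      by (simp add: algebra_simps)
    have "?m (Suc k) + 2 * C * a ^ Suc r \<le> (1 + ?F / n) * (?m k + 2 * C * a ^ Suc r)"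
      unfolding expand using step[of k] Suc.prems by (intro add_right_mono) simp
    also have "\<dots> \<le> (1 + ?F / n) * ((1 + ?F / n) ^ k * (2 * C * a ^ Suc r))"
      using Suc by (intro mult_left_mono) auto
    finally show ?case by (simp add: mult.assoc)
  qed
  have "(1 + ?F / n) ^ k \<le> exp (?F / n) ^ k"
    by (intro power_mono exp_ge_add_one_self) auto
  also have "\<dots> = exp (k * (?F / n))" by (simp only: exp_of_nat_mult)
  also have "\<dots> \<le> exp ?F"
    using k_le by (cases "n = 0") (auto simp: field_simps)
  finally have "(1 + ?F / n) ^ k * (2 * C * a ^ Suc r) \<le> exp ?F * (2 * C * a ^ Suc r)"
    using pos by (intro mult_right_mono) auto
  moreover have "0 \<le> 2 * C * a ^ Suc r" using pos by auto
  ultimately have "?m k \<le> exp ?F * (2 * C * a ^ Suc r)"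
    using gronwall[OF k_le] by linarith
  then show ?thesis using A_int[of k "2 * Suc r"] by (simp add: moment_const_def mult_ac)
qed

section \<open>Sums of independent variables and degenerate U-statistics\<close>

lemma sum_fun_upd_Suc:
  "(\<Sum>i\<in>{1..Suc k}. f ((x(Suc k := y)) i)) = (\<Sum>i\<in>{1..k}. f (x i)) + (f y :: real)"
proof -
  have "(\<Sum>i\<in>{1..k}. f ((x(Suc k := y)) i)) = (\<Sum>i\<in>{1..k}. f (x i))"
    by (intro sum.cong) auto
  then show ?thesis by simp
qed

lemma PiM_component_space:
  "x \<in> space (PiM I (\<lambda>_. \<mu>)) \<Longrightarrow> i \<in> I \<Longrightarrow> x i \<in> space \<mu>"
  by (auto simp: space_PiM PiE_def Pi_def)

lemma borel_measurable_PiM_component: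
  "f \<in> borel_measurable \<mu> \<Longrightarrow> i \<in> I \<Longrightarrow> (\<lambda>x. f (x i)) \<in> borel_measurable (PiM I (\<lambda>_. \<mu>))"
  using measurable_compose[OF measurable_component_singleton[of i I "\<lambda>_. \<mu>"], of f borel] by blast

lemma sum_moment:
  fixes f :: "'x \<Rightarrow> real"
  assumes "prob_space \<mu>" and f_meas: "f \<in> borel_measurable \<mu>"
    and f_bdd: "\<And>y. y \<in> space \<mu> \<Longrightarrow> \<bar>f y\<bar> \<le> M"
    and f_mean: "(\<integral>y. f y \<partial>\<mu>) = 0" and f_var: "(\<integral>y. (f y)\<^sup>2 \<partial>\<mu>) \<le> v"
    and scale: "real n * v \<le> a" "M\<^sup>2 \<le> a" "0 < a"
  shows "integrable (PiM {1..n} (\<lambda>_. \<mu>)) (\<lambda>x. (\<Sum>i\<in>{1..n}. f (x i)) ^ (2 * Suc r)) \<and>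
    (\<integral>x. (\<Sum>i\<in>{1..n}. f (x i)) ^ (2 * Suc r) \<partial>PiM {1..n} (\<lambda>_. \<mu>)) \<le> moment_const r * a ^ Suc r"
proof -
  have v: "0 \<le> v"
    by (rule order_trans[OF _ f_var]) simp
  interpret \<mu>: prob_space \<mu> by fact
  have P: "prob_space (PiM {1..k::nat} (\<lambda>_. \<mu>))" for k
    by (intro prob_space_PiM \<open>prob_space \<mu>\<close>)
  have "integrable (PiM {1..n} (\<lambda>_. \<mu>)) (\<lambda>x. (\<Sum>i\<in>{1..n}. f (x i)) ^ (2 * Suc r)) \<and>
    (\<integral>x. (\<Sum>i\<in>{1..n}. f (x i)) ^ (2 * Suc r) \<partial>PiM {1..n} (\<lambda>_. \<mu>)) \<le> 1 * moment_const r * a ^ Suc r"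
  proof (rule martingale_moment[where A = "\<lambda>k x. \<Sum>i\<in>{1..k}. f (x i)" and k = n and H = "\<lambda>_ _. f" and \<tau> = "\<lambda>_ _. 1" and T = 1
        and c = "M\<^sup>2" and w = v and n = n])
    show "(\<lambda>x. \<Sum>i\<in>{1..k}. f (x i)) \<in> borel_measurable (PiM {1..k} (\<lambda>_. \<mu>))" for k
      by (rule borel_measurable_sum, rule borel_measurable_PiM_component[OF f_meas])
    show "\<exists>K. \<forall>x\<in>space (PiM {1..k} (\<lambda>_. \<mu>)). \<bar>\<Sum>i\<in>{1..k}. f (x i)\<bar> \<le> K" for k
    proof (intro exI ballI)
      fix x assume x: "x \<in> space (PiM {1..k} (\<lambda>_. \<mu>))"
      have "(\<Sum>i\<in>{1..k}. \<bar>f (x i)\<bar>) \<le> (\<Sum>i\<in>{1..k}. M)"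
        by (intro sum_mono f_bdd) (rule PiM_component_space[OF x])
      then show "\<bar>\<Sum>i\<in>{1..k}. f (x i)\<bar> \<le> (\<Sum>i\<in>{1..k}. M)"
        by (rule order_trans[OF sum_abs])
    qed
    show "(f y)\<^sup>2 \<le> M\<^sup>2 * 1" if "y \<in> space \<mu>" for y
      using f_bdd[OF that] power_mono[of "\<bar>f y\<bar>" M 2] by simp
    show "integrable (PiM {1..k} (\<lambda>_. \<mu>)) (\<lambda>x. 1 ^ Suc r :: real)" for k :: nat
      using prob_space.finite_measure[OF P] by (simp add: finite_measure.integrable_const)
    show "(\<integral>x. 1 ^ Suc r \<partial>PiM {1..k} (\<lambda>_. \<mu>)) \<le> 1 * (1::real) ^ Suc r" for k :: nat
      using prob_space.prob_space[OF P] by simp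
    show "(\<Sum>i\<in>{1..Suc k}. f ((x(Suc k := y)) i)) = (\<Sum>i\<in>{1..k}. f (x i)) + f y" for k x y
      by (rule sum_fun_upd_Suc)
    show "(\<integral>y. (f y)\<^sup>2 \<partial>\<mu>) \<le> v * 1" using f_var by simp
    show "prob_space \<mu>" "f \<in> borel_measurable \<mu>" "(\<integral>y. f y \<partial>\<mu>) = 0" "0 \<le> v"  "0 < a" by fact+
    show "real n * v * 1 \<le> a" "M\<^sup>2 * 1 \<le> a" using scale by simp_all
  qed simp_all
  then show ?thesis by simp
qed

text \<open>Jensen's inequality with weights proportional to \<open>\<sigma>\<close>. It lets a squared norm inherit the moments of
its coordinates at the price of the sum of their own scales, rather than of the dimension times the
worst scale.\<close>

lemma weighted_power_mean:
  fixes u \<sigma> :: "'l \<Rightarrow> real"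
  assumes "finite L" and "\<And>l. l \<in> L \<Longrightarrow> 0 < \<sigma> l" and "\<And>l. l \<in> L \<Longrightarrow> 0 \<le> u l"
  shows "(\<Sum>l\<in>L. u l) ^ Suc r \<le> (\<Sum>l\<in>L. \<sigma> l) ^ r * (\<Sum>l\<in>L. u l ^ Suc r / \<sigma> l ^ r)"
proof (cases "L = {}")
  case False
  let ?s = "\<Sum>l\<in>L. \<sigma> l"
  have s: "0 < ?s" using assms False by (intro sum_pos) auto
  have "(\<Sum>l\<in>L. (\<sigma> l / ?s) *\<^sub>R (u l / \<sigma> l)) ^ Suc r \<le> (\<Sum>l\<in>L. (\<sigma> l / ?s) * (u l / \<sigma> l) ^ Suc r)"
  proof (rule convex_on_sum[where C = "{0..}"])
    show "convex_on {0::real..} (\<lambda>x. x ^ Suc r)"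
    proof (cases "even (Suc r)")
      case True
      then show ?thesis by (intro convex_on_subset[OF convex_power_even]) auto
    qed (rule convex_power_odd, simp)
  qed (use assms False s in \<open>auto simp: less_imp_le simp flip: sum_divide_distrib\<close>)
  also have "(\<Sum>l\<in>L. (\<sigma> l / ?s) *\<^sub>R (u l / \<sigma> l)) = (\<Sum>l\<in>L. u l) / ?s"
    using assms unfolding sum_divide_distrib
    by (intro sum.cong refl) force
  also have "(\<Sum>l\<in>L. (\<sigma> l / ?s) * (u l / \<sigma> l) ^ Suc r) = (\<Sum>l\<in>L. u l ^ Suc r / \<sigma> l ^ r) / ?s"
    unfolding sum_divide_distrib
  proof (intro sum.cong refl)
    fix l assume "l \<in> L"
    then have "0 < \<sigma> l" by (rule assms)
    then show "(\<sigma> l / ?s) * (u l / \<sigma> l) ^ Suc r = u l ^ Suc r / \<sigma> l ^ r / ?s"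
      by (simp add: power_divide)
  qed
  finally have "?s ^ Suc r * (((\<Sum>l\<in>L. u l) / ?s) ^ Suc r) \<le> ?s ^ Suc r * ((\<Sum>l\<in>L. u l ^ Suc r / \<sigma> l ^ r) / ?s)"
    using s by (intro mult_left_mono) auto
  moreover have "?s ^ Suc r * (((\<Sum>l\<in>L. u l) / ?s) ^ Suc r) = (\<Sum>l\<in>L. u l) ^ Suc r"
    using s by (simp add: power_divide del: power_Suc)
  moreover have "?s ^ Suc r * ((\<Sum>l\<in>L. u l ^ Suc r / \<sigma> l ^ r) / ?s) = ?s ^ r * (\<Sum>l\<in>L. u l ^ Suc r / \<sigma> l ^ r)"
    using s by simp
  ultimately show ?thesis by simp
qed simp

text \<open>Moments of the squared norm of a sum of independent centred vectors, of the correct order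
\<open>n * (total variance)\<close>; the coordinates are treated separately by \<open>sum_moment\<close>, and the weights
\<open>\<sigma> l\<close> in \<open>weighted_power_mean\<close> are adapted to the variance of each of them.\<close>

lemma norm_moment:
  fixes g :: "'l \<Rightarrow> 'x \<Rightarrow> real"
  assumes "prob_space \<mu>" and "finite L" and g_meas: "\<And>l. l \<in> L \<Longrightarrow> g l \<in> borel_measurable \<mu>"
    and g_bdd: "\<And>l y. l \<in> L \<Longrightarrow> y \<in> space \<mu> \<Longrightarrow> (g l y)\<^sup>2 \<le> b" and b: "0 \<le> b"
    and g_mean: "\<And>l. l \<in> L \<Longrightarrow> (\<integral>y. g l y \<partial>\<mu>) = 0"
    and scale: "\<And>l. l \<in> L \<Longrightarrow> real n * (\<integral>y. (g l y)\<^sup>2 \<partial>\<mu>) \<le> \<sigma> l" "\<And>l. l \<in> L \<Longrightarrow> b \<le> \<sigma> l"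
      "\<And>l. l \<in> L \<Longrightarrow> 0 < \<sigma> l"
  defines "\<tau> \<equiv> \<lambda>x. \<Sum>l\<in>L. (\<Sum>i\<in>{1..n}. g l (x i))\<^sup>2"
  shows "integrable (PiM {1..n} (\<lambda>_. \<mu>)) (\<lambda>x. \<tau> x ^ Suc r)"
    and "(\<integral>x. \<tau> x ^ Suc r \<partial>PiM {1..n} (\<lambda>_. \<mu>)) \<le> moment_const r * (\<Sum>l\<in>L. \<sigma> l) ^ Suc r"
proof -
  interpret \<mu>: prob_space \<mu> by fact
  let ?P = "PiM {1..n} (\<lambda>_. \<mu>)"
  interpret P: prob_space ?P
    by (intro prob_space_PiM \<open>prob_space \<mu>\<close>)
  let ?S = "\<lambda>l x. \<Sum>i\<in>{1..n}. g l (x i)"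
  have abs_le: "\<bar>g l y\<bar> \<le> sqrt b" if "l \<in> L" "y \<in> space \<mu>" for l y
    using g_bdd[OF that] by (simp add: real_le_rsqrt)
  have S_bdd: "\<bar>?S l x\<bar> \<le> n * sqrt b" if "l \<in> L" "x \<in> space ?P" for l x
  proof -
    have "\<bar>?S l x\<bar> \<le> (\<Sum>i\<in>{1..n}. \<bar>g l (x i)\<bar>)" by (rule sum_abs)
    also have "\<dots> \<le> (\<Sum>i\<in>{1..n}. sqrt b)"
      by (intro sum_mono abs_le that(1)) (rule PiM_component_space[OF that(2)])
    finally show ?thesis by simp
  qed
  have S_meas [measurable]: "?S l \<in> borel_measurable ?P" if "l \<in> L" for l
    by (rule borel_measurable_sum, rule borel_measurable_PiM_component[OF g_meas[OF that]])
  have S_int: "integrable ?P (\<lambda>x. ?S l x ^ j)" if "l \<in> L" for l j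
    using S_bdd[OF that] S_meas[OF that]
    by (intro P.integrable_const_bound[where B = "(n * sqrt b) ^ j"] AE_I2)
       (auto simp: power_abs intro!: power_mono)
  let ?h = "\<lambda>x. (\<Sum>l\<in>L. \<sigma> l) ^ r * (\<Sum>l\<in>L. ?S l x ^ (2 * Suc r) / \<sigma> l ^ r)"
  have h_int: "integrable ?P ?h"
    by (intro integrable_mult_right Bochner_Integration.integrable_sum integrable_divide S_int)
  have \<tau>0: "0 \<le> \<tau> x" for x by (auto simp: \<tau>_def intro: sum_nonneg)
  have \<tau>_le: "\<tau> x ^ Suc r \<le> ?h x" for x
    unfolding \<tau>_def power_mult
    by (rule weighted_power_mean[OF \<open>finite L\<close> scale(3)]) simp_all
  show \<tau>_int: "integrable ?P (\<lambda>x. \<tau> x ^ Suc r)"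
  proof (rule Bochner_Integration.integrable_bound[OF h_int])
    show "(\<lambda>x. \<tau> x ^ Suc r) \<in> borel_measurable ?P"
      unfolding \<tau>_def by (intro borel_measurable_power borel_measurable_sum S_meas)
    show "AE x in ?P. norm (\<tau> x ^ Suc r) \<le> norm (?h x)"
      using \<tau>_le \<tau>0 by (intro AE_I2) (auto simp del: power_Suc intro: order_trans[OF _ abs_ge_self])
  qed
  have "(\<integral>x. \<tau> x ^ Suc r \<partial>?P) \<le> (\<integral>x. ?h x \<partial>?P)"
    by (intro integral_mono \<tau>_int h_int \<tau>_le)
  also have "\<dots> = (\<Sum>l\<in>L. \<sigma> l) ^ r * (\<Sum>l\<in>L. (\<integral>x. ?S l x ^ (2 * Suc r) \<partial>?P) / \<sigma> l ^ r)"
    by (subst integral_mult_right_zero, subst Bochner_Integration.integral_sum)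
       (simp_all only: integral_divide_zero integrable_divide[OF S_int] simp_thms)
  also have "\<dots> \<le> (\<Sum>l\<in>L. \<sigma> l) ^ r * (\<Sum>l\<in>L. moment_const r * \<sigma> l)"
  proof (intro mult_left_mono sum_mono zero_le_power sum_nonneg less_imp_le[OF scale(3)])
    fix l assume l: "l \<in> L"
    have "(\<integral>x. ?S l x ^ (2 * Suc r) \<partial>?P) \<le> moment_const r * \<sigma> l ^ Suc r"
      using scale(2)[OF l] b
      by (intro conjunct2[OF sum_moment[where M = "sqrt b", OF \<open>prob_space \<mu>\<close> g_meas[OF l] abs_le[OF l] g_mean[OF l] order_refl
            scale(1)[OF l] _ scale(3)[OF l]]]) auto
    then show "(\<integral>x. ?S l x ^ (2 * Suc r) \<partial>?P) / \<sigma> l ^ r \<le> moment_const r * \<sigma> l"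
      using scale(3)[OF l] by (simp add: field_simps)
  qed auto
  also have "\<dots> = moment_const r * (\<Sum>l\<in>L. \<sigma> l) ^ Suc r"
    by (simp add: sum_distrib_left[symmetric])
  finally show "(\<integral>x. \<tau> x ^ Suc r \<partial>?P) \<le> moment_const r * (\<Sum>l\<in>L. \<sigma> l) ^ Suc r" .
qed

text \<open>A degenerate U-statistic with kernel \<open>\<langle>g x, g y\<rangle>\<close> is a martingale: given the past, a new observation
\<open>y\<close> adds the inner product of \<open>g y\<close> with the partial sum \<open>S\<close>. Its conditional variance is at most
\<open>w\<close> times the squared norm of \<open>S\<close>, and the gain over the bound in terms of \<open>b\<close> alone lies in
the weak variance \<open>w\<close>, for the scores of a model much smaller than \<open>b\<close>.\<close>

lemma ustat_moment:
  fixes g :: "'l \<Rightarrow> 'x \<Rightarrow> real"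
  assumes "prob_space \<mu>" and "finite L" and g_meas: "\<And>l. l \<in> L \<Longrightarrow> g l \<in> borel_measurable \<mu>"
    and g_bdd: "\<And>y. y \<in> space \<mu> \<Longrightarrow> (\<Sum>l\<in>L. (g l y)\<^sup>2) \<le> b" and b: "0 < b"
    and g_mean: "\<And>l. l \<in> L \<Longrightarrow> (\<integral>y. g l y \<partial>\<mu>) = 0"
    and g_weak: "\<And>c. (\<integral>y. (\<Sum>l\<in>L. c l * g l y)\<^sup>2 \<partial>\<mu>) \<le> w * (\<Sum>l\<in>L. (c l)\<^sup>2)" and w: "0 \<le> w"
    and scale: "(\<Sum>l\<in>L. real n * (\<integral>y. (g l y)\<^sup>2 \<partial>\<mu>) + b) \<le> T"
      "real n * w * T \<le> a" "b * T \<le> a" and pos: "0 < T" "0 < a"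
  shows "integrable (PiM {1..n} (\<lambda>_. \<mu>))
      (\<lambda>x. (\<Sum>i\<in>{1..n}. \<Sum>j\<in>{1..<i}. \<Sum>l\<in>L. g l (x i) * g l (x j)) ^ (2 * Suc r)) \<and>
    (\<integral>x. (\<Sum>i\<in>{1..n}. \<Sum>j\<in>{1..<i}. \<Sum>l\<in>L. g l (x i) * g l (x j)) ^ (2 * Suc r) \<partial>PiM {1..n} (\<lambda>_. \<mu>))
    \<le> (moment_const r)\<^sup>2 * a ^ Suc r"
proof -
  interpret \<mu>: prob_space \<mu> by fact
  let ?P = "\<lambda>k::nat. PiM {1..k} (\<lambda>_. \<mu>)"
  let ?S = "\<lambda>k l x. \<Sum>i\<in>{1..k}. g l (x i)"
  let ?H = "\<lambda>k x y. \<Sum>l\<in>L. ?S k l x * g l y"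
  let ?\<tau> = "\<lambda>k x. \<Sum>l\<in>L. (?S k l x)\<^sup>2"
  let ?A = "\<lambda>k x. \<Sum>i\<in>{1..k}. \<Sum>j\<in>{1..<i}. \<Sum>l\<in>L. g l (x i) * g l (x j)"
  have coord_bdd: "(g l y)\<^sup>2 \<le> b" if "l \<in> L" "y \<in> space \<mu>" for l y
    using member_le_sum[of l L "\<lambda>l. (g l y)\<^sup>2"] g_bdd[OF that(2)] that(1) \<open>finite L\<close> by fastforce
  have mc: "0 < moment_const r" by (simp add: moment_const_def)
  have T_nonneg: "0 \<le> (\<Sum>l\<in>L. real n * (\<integral>y. (g l y)\<^sup>2 \<partial>\<mu>) + b)"
    using b by (intro sum_nonneg add_nonneg_nonneg mult_nonneg_nonneg Bochner_Integration.integral_nonneg) auto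
  have inner_Suc: "?A (Suc k) (x(Suc k := y)) = ?A k x + ?H k x y" for k x y
  proof -
    have "(\<Sum>i\<in>{1..k}. \<Sum>j\<in>{1..<i}. \<Sum>l\<in>L. g l ((x(Suc k := y)) i) * g l ((x(Suc k := y)) j)) = ?A k x"
      by (intro sum.cong refl) auto
    moreover have "(\<Sum>j\<in>{1..<Suc k}. \<Sum>l\<in>L. g l ((x(Suc k := y)) (Suc k)) * g l ((x(Suc k := y)) j)) = ?H k x y"
    proof -
      have "(\<Sum>j\<in>{1..<Suc k}. \<Sum>l\<in>L. g l ((x(Suc k := y)) (Suc k)) * g l ((x(Suc k := y)) j))
        = (\<Sum>j\<in>{1..k}. \<Sum>l\<in>L. g l y * g l (x j))"
        by (intro sum.cong refl) auto
      also have "\<dots> = (\<Sum>l\<in>L. \<Sum>j\<in>{1..k}. g l y * g l (x j))" by (rule sum.swap)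
      finally show ?thesis by (simp add: sum_distrib_left mult.commute)
    qed
    ultimately show ?thesis by (simp only: sum.cl_ivl_Suc) simp
  qed
  have "integrable (?P n) (\<lambda>x. ?A n x ^ (2 * Suc r)) \<and> (\<integral>x. ?A n x ^ (2 * Suc r) \<partial>?P n) \<le> moment_const r * moment_const r * a ^ Suc r"
  proof (rule martingale_moment[where A = ?A and k = n and H = ?H and \<tau> = ?\<tau> and T = T
        and c = b and w = w and n = n])
    show "?A k \<in> borel_measurable (?P k)" for k
    proof (intro borel_measurable_sum borel_measurable_times)
      fix i j l assume "i \<in> {1..k}" "j \<in> {1..<i}" "l \<in> L"
      then show "(\<lambda>x. g l (x i)) \<in> borel_measurable (?P k)" "(\<lambda>x. g l (x j)) \<in> borel_measurable (?P k)"
        by (simp_all add: borel_measurable_PiM_component[OF g_meas])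
    qed
    show "\<exists>K. \<forall>x\<in>space (?P k). \<bar>?A k x\<bar> \<le> K" for k
    proof (intro exI ballI)
      fix x assume x: "x \<in> space (?P k)"
      have inner: "\<bar>\<Sum>l\<in>L. g l (x i) * g l (x j)\<bar> \<le> b" if "i \<in> {1..k}" "j \<in> {1..<i}" for i j
      proof -
        have "x i \<in> space \<mu>" "x j \<in> space \<mu>" 
          by (rule PiM_component_space[OF x], use that in simp)+
        note bds = g_bdd[OF this(1)] g_bdd[OF this(2)]
        have "(\<Sum>l\<in>L. g l (x i) * g l (x j))\<^sup>2 \<le> (\<Sum>l\<in>L. (g l (x i))\<^sup>2) * (\<Sum>l\<in>L. (g l (x j))\<^sup>2)"
          by (rule Cauchy_Schwarz_ineq_sum)
        also have "\<dots> \<le> b\<^sup>2" unfolding power2_eq_square[of b] using bds b by (intro mult_mono sum_nonneg) auto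
        finally have "\<bar>\<Sum>l\<in>L. g l (x i) * g l (x j)\<bar> \<le> \<bar>b\<bar>"
          by (simp only: abs_le_square_iff)
        then show ?thesis using b by linarith
      qed
      have "(\<Sum>i\<in>{1..k}. \<bar>\<Sum>j\<in>{1..<i}. \<Sum>l\<in>L. g l (x i) * g l (x j)\<bar>) \<le> (\<Sum>i\<in>{1..k}. \<Sum>j\<in>{1..<i}. b)"
        by (rule sum_mono, rule order_trans[OF sum_abs], rule sum_mono, rule inner)
      then show "\<bar>?A k x\<bar> \<le> (\<Sum>i\<in>{1..k}. \<Sum>j\<in>{1..<i}. b)"
        by (rule order_trans[OF sum_abs])
    qed
    show "?H k x \<in> borel_measurable \<mu>" for k x
      using g_meas by (intro borel_measurable_sum borel_measurable_times) auto
    show "(\<integral>y. ?H k x y \<partial>\<mu>) = 0" for k x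
    proof -
      have "integrable \<mu> (g l)" if "l \<in> L" for l
        using g_meas[OF that] coord_bdd[OF that]
        by (intro \<mu>.integrable_const_bound[where B = "sqrt b"] AE_I2) (auto simp: real_le_rsqrt)
      then show ?thesis
        using g_mean by (subst Bochner_Integration.integral_sum) auto
    qed
    show "(\<integral>y. (?H k x y)\<^sup>2 \<partial>\<mu>) \<le> w * ?\<tau> k x" for k x
      by (rule g_weak)
    show "(?H k x y)\<^sup>2 \<le> b * ?\<tau> k x" if "y \<in> space \<mu>" for k x y
    proof -
      have "(?H k x y)\<^sup>2 \<le> ?\<tau> k x * (\<Sum>l\<in>L. (g l y)\<^sup>2)" by (rule Cauchy_Schwarz_ineq_sum)
      also have "\<dots> \<le> ?\<tau> k x * b" using g_bdd[OF that] by (intro mult_left_mono sum_nonneg) auto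
      finally show ?thesis by (simp add: mult.commute)
    qed
    show "0 \<le> ?\<tau> k x" for k x by (intro sum_nonneg) auto
    have \<sigma>_pos: "0 < real k * (\<integral>y. (g l y)\<^sup>2 \<partial>\<mu>) + b" for k l
      using b by (simp add: add_nonneg_pos)
    note moment = norm_moment[OF \<open>prob_space \<mu>\<close> \<open>finite L\<close> g_meas coord_bdd less_imp_le[OF b] g_mean]
    show "integrable (?P k) (\<lambda>x. ?\<tau> k x ^ Suc r)" for k
    proof (rule moment(1))
      show "real k * (\<integral>y. (g l y)\<^sup>2 \<partial>\<mu>) \<le> real k * (\<integral>y. (g l y)\<^sup>2 \<partial>\<mu>) + b" for l
        using b by simp
    qed (simp_all add: \<sigma>_pos)
    show "(\<integral>x. ?\<tau> k x ^ Suc r \<partial>?P k) \<le> moment_const r * T ^ Suc r" if "k < n" for k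
    proof -
      have "(\<integral>x. ?\<tau> k x ^ Suc r \<partial>?P k) \<le> moment_const r * (\<Sum>l\<in>L. real n * (\<integral>y. (g l y)\<^sup>2 \<partial>\<mu>) + b) ^ Suc r"
      proof (rule moment(2))
        show "real k * (\<integral>y. (g l y)\<^sup>2 \<partial>\<mu>) \<le> real n * (\<integral>y. (g l y)\<^sup>2 \<partial>\<mu>) + b" for l
          using b that by (intro add_increasing2 mult_right_mono) simp_all
      qed (simp_all add: \<sigma>_pos)
      also have "\<dots> \<le> moment_const r * T ^ Suc r"
        using scale(1) T_nonneg mc by (intro mult_left_mono power_mono) auto
      finally show ?thesis .
    qed
    show "?A (Suc k) (x(Suc k := y)) = ?A k x + ?H k x y" for k x y by (rule inner_Suc)
    show "prob_space \<mu>" "0 \<le> w" "0 < T" "0 < a" "real n * w * T \<le> a" "b * T \<le> a"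
      by fact+
    show "0 \<le> b" "0 \<le> moment_const r" using b mc by simp_all
  qed simp_all
  then show ?thesis by (simp add: power2_eq_square)
qed

section \<open>From the product space to the sample\<close>

text \<open>For the second moment the exact value is needed, to relate a lower bound on the estimation error to
the variance of the model.\<close>

lemma sum_second_moment:
  fixes f :: "'x \<Rightarrow> real"
  assumes "prob_space \<mu>" and f_meas: "f \<in> borel_measurable \<mu>"
    and f_bdd: "\<And>y. y \<in> space \<mu> \<Longrightarrow> \<bar>f y\<bar> \<le> M"
    and f_mean: "(\<integral>y. f y \<partial>\<mu>) = 0"
  shows "integrable (PiM {1..n::nat} (\<lambda>_. \<mu>)) (\<lambda>x. (\<Sum>i\<in>{1..n}. f (x i))\<^sup>2) \<and>
    (\<integral>x. (\<Sum>i\<in>{1..n}. f (x i))\<^sup>2 \<partial>PiM {1..n} (\<lambda>_. \<mu>)) = n * (\<integral>y. (f y)\<^sup>2 \<partial>\<mu>)"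
proof -
  interpret \<mu>: prob_space \<mu> by fact
  interpret product_prob_space "\<lambda>_. \<mu>" "{1..j}" for j ..
  let ?P = "\<lambda>k::nat. PiM {1..k} (\<lambda>_. \<mu>)"
  have P: "prob_space (?P k)" for k
    by (intro prob_space_PiM \<open>prob_space \<mu>\<close>)
  have int: "integrable (?P k) (\<lambda>x. (\<Sum>i\<in>{1..k}. f (x i)) ^ j)" for k j
  proof -
    have "\<bar>\<Sum>i\<in>{1..k}. f (x i)\<bar> \<le> (\<Sum>i\<in>{1..k}. M)" if x: "x \<in> space (?P k)" for x
      by (rule order_trans[OF sum_abs], rule sum_mono, rule f_bdd, rule PiM_component_space[OF x])
    then have "AE x in ?P k. norm ((\<Sum>i\<in>{1..k}. f (x i)) ^ j) \<le> (\<Sum>i\<in>{1..k}. M) ^ j"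
      by (intro AE_I2) (simp only: real_norm_def power_abs, intro power_mono, auto)
    moreover have "(\<lambda>x. \<Sum>i\<in>{1..k}. f (x i)) \<in> borel_measurable (?P k)"
      by (rule borel_measurable_sum, rule borel_measurable_PiM_component[OF f_meas])
    ultimately show ?thesis
      using P[of k] by (intro finite_measure.integrable_const_bound prob_space.finite_measure) auto
  qed
  have f_int: "integrable \<mu> (\<lambda>y. f y ^ j)" for j
    using f_bdd f_meas
    by (intro \<mu>.integrable_const_bound[where B = "M ^ j"] AE_I2) (auto simp: power_abs intro!: power_mono)
  have "(\<integral>x. (\<Sum>i\<in>{1..n}. f (x i))\<^sup>2 \<partial>?P n) = n * (\<integral>y. (f y)\<^sup>2 \<partial>\<mu>)"
  proof (induction n)
    case (Suc k)
    have "(\<integral>x. (\<Sum>i\<in>{1..Suc k}. f (x i))\<^sup>2 \<partial>?P (Suc k))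
        = (\<integral>x. (\<Sum>i\<in>{1..Suc k}. f (x i))\<^sup>2 \<partial>PiM (insert (Suc k) {1..k}) (\<lambda>_. \<mu>))"
      by (simp only: atLeastAtMostSuc_conv)
    also have "\<dots> = (\<integral>x. (\<integral>y. (\<Sum>i\<in>{1..Suc k}. f ((x(Suc k := y)) i))\<^sup>2 \<partial>\<mu>) \<partial>?P k)"
      using int[of "Suc k" 2] by (intro product_integral_insert) (simp_all add: atLeastAtMostSuc_conv)
    also have "\<dots> = (\<integral>x. (\<Sum>i\<in>{1..k}. f (x i))\<^sup>2 + (\<integral>y. (f y)\<^sup>2 \<partial>\<mu>) \<partial>?P k)"
      unfolding sum_fun_upd_Suc
    proof (intro Bochner_Integration.integral_cong refl)
      fix x
      have "(\<integral>y. ((\<Sum>i\<in>{1..k}. f (x i)) + f y)\<^sup>2 \<partial>\<mu>)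
        = (\<integral>y. (\<Sum>i\<in>{1..k}. f (x i))\<^sup>2 + (f y)\<^sup>2 + 2 * (\<Sum>i\<in>{1..k}. f (x i)) * f y \<partial>\<mu>)"
        by (simp only: power2_sum)
      also have "\<dots> = (\<Sum>i\<in>{1..k}. f (x i))\<^sup>2 + (\<integral>y. (f y)\<^sup>2 \<partial>\<mu>)"
        using f_int[of 1] f_int[of 2] f_mean \<mu>.prob_space by simp
      finally show "(\<integral>y. ((\<Sum>i\<in>{1..k}. f (x i)) + f y)\<^sup>2 \<partial>\<mu>)
        = (\<Sum>i\<in>{1..k}. f (x i))\<^sup>2 + (\<integral>y. (f y)\<^sup>2 \<partial>\<mu>)" .
    qed
    also have "\<dots> = (\<integral>x. (\<Sum>i\<in>{1..k}. f (x i))\<^sup>2 \<partial>?P k) + (\<integral>y. (f y)\<^sup>2 \<partial>\<mu>)"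
      using int[of k 2] prob_space.prob_space[OF P[of k]] P[of k]
      by (subst Bochner_Integration.integral_add)
         (simp_all add: finite_measure.integrable_const prob_space.finite_measure)
    also have "\<dots> = Suc k * (\<integral>y. (f y)\<^sup>2 \<partial>\<mu>)"
      by (simp only: Suc.IH) (simp add: algebra_simps)
    finally show ?case .
  qed simp
  with int[of n 2] show ?thesis by blast
qed

lemma moment_tail:
  fixes F :: "'x \<Rightarrow> real"
  assumes T: "T \<in> P \<rightarrow>\<^sub>M N" and distr: "distr P N T = N"
    and F: "integrable N (\<lambda>x. F x ^ (2 * Suc r)) \<and> (\<integral>x. F x ^ (2 * Suc r) \<partial>N) \<le> K" and t: "0 < t"
  shows "\<exists>B\<in>sets P. measure P B \<le> K / t ^ (2 * Suc r) \<and> (\<forall>w\<in>space P - B. \<bar>F (T w)\<bar> \<le> t)"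
proof (intro bexI conjI ballI)
  let ?u = "\<lambda>w. F (T w) ^ (2 * Suc r)"
  let ?B = "{w\<in>space P. t ^ (2 * Suc r) \<le> ?u w}"
  have F_meas: "(\<lambda>x. F x ^ (2 * Suc r)) \<in> borel_measurable N"
    using F by (intro borel_measurable_integrable) blast
  have u_int: "integrable P ?u"
    using F distr integrable_distr[OF T, of "\<lambda>x. F x ^ (2 * Suc r)"] by simp
  have u_eq: "(\<integral>w. ?u w \<partial>P) = (\<integral>x. F x ^ (2 * Suc r) \<partial>N)"
    using integral_distr[OF T F_meas] distr by simp
  show B: "?B \<in> sets P"
    using borel_measurable_integrable[OF u_int] by measurable
  have "measure P ?B \<le> (\<integral>w\<in>space P. ?u w \<partial>P) / t ^ (2 * Suc r)"
  proof (rule integral_Markov_inequality'_measure)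
    show "set_integrable P (space P) ?u"
      unfolding set_integrable_def by (rule integrable_mult_indicator[OF sets.top u_int])
    show "AE w in P. w \<in> space P \<longrightarrow> 0 \<le> ?u w"
      by (intro AE_I2 impI zero_le_even_power) simp
  qed (use t in simp_all)
  also have "(\<integral>w\<in>space P. ?u w \<partial>P) = (\<integral>w. ?u w \<partial>P)"
    by (rule set_integral_space[OF u_int])
  also have "\<dots> / t ^ (2 * Suc r) \<le> K / t ^ (2 * Suc r)"
    unfolding u_eq using F t by (intro divide_right_mono) auto
  finally show "measure P ?B \<le> K / t ^ (2 * Suc r)" .
  fix w assume w: "w \<in> space P - ?B"
  show "\<bar>F (T w)\<bar> \<le> t"
  proof (rule ccontr)
    assume "\<not> \<bar>F (T w)\<bar> \<le> t"
    then have "t ^ (2 * Suc r) \<le> \<bar>F (T w)\<bar> ^ (2 * Suc r)"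
      using t by (intro power_mono) auto
    also have "\<bar>F (T w)\<bar> ^ (2 * Suc r) = ?u w" by (intro power_even_abs) simp
    finally show False using w by blast
  qed
qed

text \<open>The common distribution of the observations. It does not depend on the sample size.\<close>

definition sample_law :: "(real \<Rightarrow> real) \<Rightarrow> real measure" where
  "sample_law s = density unit_leb (\<lambda>t. ennreal (s t))"

lemma sets_sample_law [measurable_cong, simp]: "sets (sample_law s) = sets unit_leb"
  by (simp add: sample_law_def)

lemma space_sample_law [simp]: "space (sample_law s) = space unit_leb"
  by (simp add: sample_law_def)

lemma iid_sample_law:
  assumes "iid_sample P X n s" and n: "1 \<le> n"
  defines "T \<equiv> \<lambda>w. \<lambda>i\<in>{1..n}. X i w"
  shows "prob_space (sample_law s)"
    and "T \<in> P \<rightarrow>\<^sub>M PiM {1..n} (\<lambda>_. sample_law s)"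
    and "distr P (PiM {1..n} (\<lambda>_. sample_law s)) T = PiM {1..n} (\<lambda>_. sample_law s)"
    and "\<And>i. i \<in> {1..n} \<Longrightarrow> X i \<in> P \<rightarrow>\<^sub>M unit_leb"
    and "\<And>i. i \<in> {1..n} \<Longrightarrow> distr P unit_leb (X i) = sample_law s"
proof -
  let ?N = "PiM {1..n} (\<lambda>_. sample_law s)"
  interpret P: prob_space P using assms(1) by (simp add: iid_sample_def)
  have D: "distributed P unit_leb (X i) (\<lambda>t. ennreal (s t))" if "i \<in> {1..n}" for i
    using assms(1) that by (simp add: iid_sample_def)
  then show X: "X i \<in> P \<rightarrow>\<^sub>M unit_leb" and law: "distr P unit_leb (X i) = sample_law s"
    if "i \<in> {1..n}" for i
    using that by (auto simp: distributed_def sample_law_def)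
  have 1: "1 \<in> {1..n}" using n by simp
  show "prob_space (sample_law s)"
    unfolding law[OF 1, symmetric] by (rule P.prob_space_distr[OF X[OF 1]])
  have sets_eq: "sets (?N) = sets (PiM {1..n} (\<lambda>_. unit_leb))"
    by (intro sets_PiM_cong) simp_all
  show "T \<in> P \<rightarrow>\<^sub>M ?N"
    unfolding T_def
  proof (rule measurable_restrict)
    fix i assume "i \<in> {1..n}"
    then have "X i \<in> P \<rightarrow>\<^sub>M unit_leb" by (rule X)
    then show "X i \<in> P \<rightarrow>\<^sub>M sample_law s"
      by (simp only: measurable_cong_sets[OF refl sets_sample_law])
  qed
  have "distr P (?N) T = distr P (PiM {1..n} (\<lambda>_. unit_leb)) T"
    by (intro distr_cong sets_eq) simp_all
  also have "\<dots> = PiM {1..n} (\<lambda>i. distr P unit_leb (X i))"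
  proof -
    have "P.indep_vars (\<lambda>_. unit_leb) X {1..n}" "{1..n} \<noteq> {}"
      using assms(1) n by (simp_all add: iid_sample_def)
    then show ?thesis
      unfolding T_def by (subst (asm) P.indep_vars_iff_distr_eq_PiM'[OF _ X])
  qed
  also have "\<dots> = ?N"
    by (rule PiM_cong[OF refl law])
  finally show "distr P (?N) T = ?N" .
qed

section \<open>Orthonormal families and projections\<close>

lemma borel_measurable_square_integrable: "square_integrable f \<Longrightarrow> f \<in> borel_measurable unit_leb"
  by (simp add: square_integrable_def)

lemma square_integrable_mult:
  assumes "square_integrable f" "square_integrable g"
  shows "integrable unit_leb (\<lambda>t. f t * g t)"
proof (rule Bochner_Integration.integrable_bound)
  show "integrable unit_leb (\<lambda>t. (f t)\<^sup>2 + (g t)\<^sup>2)"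
    using assms by (simp add: square_integrable_def)
  show "(\<lambda>t. f t * g t) \<in> borel_measurable unit_leb"
    by (intro borel_measurable_times borel_measurable_square_integrable assms)
  show "AE t in unit_leb. norm (f t * g t) \<le> norm ((f t)\<^sup>2 + (g t)\<^sup>2)"
  proof (intro AE_I2)
    fix t
    have "2 * (\<bar>f t\<bar> * \<bar>g t\<bar>) \<le> (f t)\<^sup>2 + (g t)\<^sup>2"
      using sum_squares_bound[of "\<bar>f t\<bar>" "\<bar>g t\<bar>"] by (simp add: mult.assoc)
    moreover have "0 \<le> \<bar>f t\<bar> * \<bar>g t\<bar>" by simp
    ultimately have "\<bar>f t\<bar> * \<bar>g t\<bar> \<le> (f t)\<^sup>2 + (g t)\<^sup>2" by linarith
    then show "norm (f t * g t) \<le> norm ((f t)\<^sup>2 + (g t)\<^sup>2)" by (simp add: abs_mult)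
  qed
qed

lemma square_integrable_scale: "square_integrable f \<Longrightarrow> square_integrable (\<lambda>t. c * f t)"
  unfolding square_integrable_def power_mult_distrib
  by (intro conjI borel_measurable_times borel_measurable_const integrable_mult_right) simp_all

lemma square_integrable_add:
  assumes "square_integrable f" "square_integrable g"
  shows "square_integrable (\<lambda>t. f t + g t)"
proof -
  have "integrable unit_leb (\<lambda>t. (f t)\<^sup>2 + (g t)\<^sup>2 + 2 * (f t * g t))"
    using assms square_integrable_mult[OF assms] by (simp add: square_integrable_def)
  then show ?thesis
    unfolding square_integrable_def power2_sum mult.assoc
    by (intro conjI borel_measurable_add borel_measurable_square_integrable assms)
qed

lemma square_integrable_diff:
  assumes "square_integrable f" "square_integrable g"
  shows "square_integrable (\<lambda>t. f t - g t)"
  using square_integrable_add[OF assms(1) square_integrable_scale[OF assms(2), of "-1"]] by simp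

lemma square_integrable_sum:
  assumes "\<And>l. l \<in> L \<Longrightarrow> square_integrable (f l)"
  shows "square_integrable (\<lambda>t. \<Sum>l\<in>L. f l t)"
  using assms
proof (induction L rule: infinite_finite_induct)
  case (insert l L)
  then show ?case using square_integrable_add[of "f l" "\<lambda>t. \<Sum>l\<in>L. f l t"] by simp
qed (simp_all add: square_integrable_def)

lemma L2_inner_commute: "L2_inner f g = L2_inner g f"
  by (simp add: L2_inner_def mult.commute)

lemma L2_inner_sum_right:
  assumes "square_integrable f" "\<And>l. l \<in> L \<Longrightarrow> square_integrable (\<phi> l)"
  shows "L2_inner f (\<lambda>t. \<Sum>l\<in>L. c l * \<phi> l t) = (\<Sum>l\<in>L. c l * L2_inner f (\<phi> l))"
proof -
  have "L2_inner f (\<lambda>t. \<Sum>l\<in>L. c l * \<phi> l t) = (LINT t|unit_leb. (\<Sum>l\<in>L. c l * (f t * \<phi> l t)))"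
    unfolding L2_inner_def sum_distrib_left by (simp add: mult.left_commute)
  also have "\<dots> = (\<Sum>l\<in>L. c l * L2_inner f (\<phi> l))"
    unfolding L2_inner_def using assms square_integrable_mult
    by (subst Bochner_Integration.integral_sum) auto
  finally show ?thesis .
qed

lemma L2_inner_diff_left:
  assumes "square_integrable f" "square_integrable g" "square_integrable h"
  shows "L2_inner (\<lambda>t. f t - g t) h = L2_inner f h - L2_inner g h"
  unfolding L2_inner_def left_diff_distrib
  using assms square_integrable_mult by (intro Bochner_Integration.integral_diff) auto

lemma L2_norm_squared: "(L2_norm f)\<^sup>2 = L2_inner f f"
  by (simp add: L2_norm_def L2_inner_def)

lemma orthonormal_family_square_integrable:
  "orthonormal_family \<phi> L \<Longrightarrow> l \<in> L \<Longrightarrow> square_integrable (\<phi> l)"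
  by (simp add: orthonormal_family_def)

lemma square_integrable_combination:
  assumes "orthonormal_family \<phi> L"
  shows "square_integrable (\<lambda>t. \<Sum>l\<in>L. c l * \<phi> l t)"
  by (intro square_integrable_sum square_integrable_scale orthonormal_family_square_integrable[OF assms])

lemma L2_inner_combination:
  assumes "finite L" "orthonormal_family \<phi> L"
  shows "L2_inner (\<lambda>t. \<Sum>l\<in>L. c l * \<phi> l t) (\<lambda>t. \<Sum>l\<in>L. d l * \<phi> l t) = (\<Sum>l\<in>L. c l * d l)"
proof -
  note si = orthonormal_family_square_integrable[OF assms(2)]
  have "L2_inner (\<lambda>t. \<Sum>l\<in>L. c l * \<phi> l t) (\<phi> l) = c l" if l: "l \<in> L" for l
  proof -
    have "L2_inner (\<lambda>t. \<Sum>l\<in>L. c l * \<phi> l t) (\<phi> l) = (\<Sum>k\<in>L. c k * L2_inner (\<phi> l) (\<phi> k))"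
      by (subst L2_inner_commute) (rule L2_inner_sum_right[OF si[OF l] si])
    also have "\<dots> = (\<Sum>k\<in>L. if k = l then c k else 0)"
      using assms(2) l by (intro sum.cong refl) (auto simp: orthonormal_family_def)
    finally show ?thesis using \<open>finite L\<close> l by simp
  qed
  then have "(\<Sum>l\<in>L. d l * L2_inner (\<lambda>t. \<Sum>l\<in>L. c l * \<phi> l t) (\<phi> l)) = (\<Sum>l\<in>L. c l * d l)"
    by (intro sum.cong refl) (simp add: mult.commute)
  then show ?thesis
    by (subst L2_inner_sum_right[OF square_integrable_combination[OF assms(2)] si])
qed

lemma L2_norm_combination:
  assumes "finite L" "orthonormal_family \<phi> L"
  shows "(L2_norm (\<lambda>t. \<Sum>l\<in>L. c l * \<phi> l t))\<^sup>2 = (\<Sum>l\<in>L. (c l)\<^sup>2)"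
  unfolding L2_norm_squared L2_inner_combination[OF assms] by (simp add: power2_eq_square)

lemma L2_norm_diff_combination:
  assumes s: "square_integrable s" and L: "finite L" "orthonormal_family \<phi> L"
  shows "(L2_norm (\<lambda>t. s t - (\<Sum>l\<in>L. c l * \<phi> l t)))\<^sup>2
    = (L2_norm s)\<^sup>2 - (\<Sum>l\<in>L. (L2_inner s (\<phi> l))\<^sup>2) + (\<Sum>l\<in>L. (c l - L2_inner s (\<phi> l))\<^sup>2)"
proof -
  let ?u = "\<lambda>t. \<Sum>l\<in>L. c l * \<phi> l t"
  note si = orthonormal_family_square_integrable[OF L(2)]
  have inner_s: "L2_inner s ?u = (\<Sum>l\<in>L. c l * L2_inner s (\<phi> l))"
    by (rule L2_inner_sum_right[OF s si])
  have u: "square_integrable ?u" by (rule square_integrable_combination[OF L(2)])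
  have d: "square_integrable (\<lambda>t. s t - ?u t)" by (rule square_integrable_diff[OF s u])
  have "(L2_norm (\<lambda>t. s t - ?u t))\<^sup>2 = L2_inner s s - 2 * L2_inner s ?u + L2_inner ?u ?u"
    unfolding L2_norm_squared L2_inner_diff_left[OF s u d]
    using L2_inner_diff_left[OF s u s] L2_inner_diff_left[OF s u u]
    by (simp add: L2_inner_commute[of s "\<lambda>t. s t - ?u t"] L2_inner_commute[of ?u "\<lambda>t. s t - ?u t"]
        L2_inner_commute[of ?u s])
  also have "\<dots> = (L2_norm s)\<^sup>2 - 2 * (\<Sum>l\<in>L. c l * L2_inner s (\<phi> l)) + (\<Sum>l\<in>L. c l * c l)"
    unfolding L2_inner_combination[OF L] L2_norm_squared inner_s ..
  also have "(\<Sum>l\<in>L. c l * c l) = (\<Sum>l\<in>L. (c l - L2_inner s (\<phi> l))\<^sup>2)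
      + 2 * (\<Sum>l\<in>L. c l * L2_inner s (\<phi> l)) - (\<Sum>l\<in>L. (L2_inner s (\<phi> l))\<^sup>2)"
    unfolding sum_distrib_left sum.distrib[symmetric] sum_subtractf[symmetric]
    by (intro sum.cong refl) (simp add: power2_eq_square algebra_simps)
  finally show ?thesis by simp
qed

lemma combination_eq_zero:
  assumes "finite L" "orthonormal_family \<phi> L" and "L2_inner (\<lambda>t. \<Sum>l\<in>L. c l * \<phi> l t) (\<lambda>t. \<Sum>l\<in>L. c l * \<phi> l t) = 0"
    and "l \<in> L"
  shows "c l = 0"
  using assms by (simp add: L2_inner_combination[OF assms(1,2)] sum_nonneg_eq_0_iff)

lemma inj_on_orthonormal:
  assumes "orthonormal_family \<phi> L"
  shows "inj_on \<phi> L"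
proof (rule inj_onI, rule ccontr)
  fix k l assume kl: "k \<in> L" "l \<in> L" "\<phi> k = \<phi> l" "k \<noteq> l"
  have "L2_inner (\<phi> k) (\<phi> k) = 1" using assms kl(1) by (simp add: orthonormal_family_def)
  moreover have "L2_inner (\<phi> k) (\<phi> l) = 0"
    using assms kl(1,2,4) unfolding orthonormal_family_def by auto
  ultimately show False using kl(3) by simp
qed

text \<open>Relates sums in the vector space of functions to pointwise sums over the index set; injectivity is
needed since the spanning set is the image of the index set.\<close>

lemma sum_fun_image:
  assumes "finite L" "inj_on \<phi> L"
  shows "(\<Sum>v\<in>\<phi> ` L. (\<lambda>t. f v * v t)) = (\<lambda>t. \<Sum>l\<in>L. f (\<phi> l) * \<phi> l t :: real)"
proof -
  have "(\<Sum>v\<in>\<phi> ` L. (\<lambda>t. f v * v t)) = (\<Sum>l\<in>L. (\<lambda>t. f (\<phi> l) * \<phi> l t))"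
    by (rule sum.reindex_cong[OF assms(2) refl refl])
  also have "\<dots> = (\<lambda>t. \<Sum>l\<in>L. f (\<phi> l) * \<phi> l t)"
    using assms(1) by (induction L rule: finite_induct) (simp_all add: fun_eq_iff)
  finally show ?thesis .
qed

lemma model_space_eq:
  assumes "finite L" "orthonormal_family \<phi> L"
  shows "model_space \<phi> L = {u. \<exists>c. u = (\<lambda>t. \<Sum>l\<in>L. c l * \<phi> l t)}"
proof -
  note inj = inj_on_orthonormal[OF assms(2)]
  have "model_space \<phi> L = range (\<lambda>f. \<Sum>v\<in>\<phi> ` L. (\<lambda>t. f v * v t))"
    unfolding model_space_def by (rule fun_vs.span_finite) (simp add: assms)
  also have "\<dots> = {u. \<exists>c. u = (\<lambda>t. \<Sum>l\<in>L. c l * \<phi> l t)}"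
    unfolding sum_fun_image[OF assms(1) inj]
  proof (intro equalityI subsetI)
    fix u assume "u \<in> range (\<lambda>f t. \<Sum>l\<in>L. f (\<phi> l) * \<phi> l t)"
    then obtain f where "u = (\<lambda>t. \<Sum>l\<in>L. f (\<phi> l) * \<phi> l t)" by (rule rangeE)
    then show "u \<in> {u. \<exists>c. u = (\<lambda>t. \<Sum>l\<in>L. c l * \<phi> l t)}"
      by (intro CollectI exI[of _ "\<lambda>l. f (\<phi> l)"])
  next
    fix u assume "u \<in> {u. \<exists>c. u = (\<lambda>t. \<Sum>l\<in>L. c l * \<phi> l t)}"
    then obtain c where "u = (\<lambda>t. \<Sum>l\<in>L. c l * \<phi> l t)" by (elim CollectE exE)
    also have "\<dots> = (\<lambda>t. \<Sum>l\<in>L. c (inv_into L \<phi> (\<phi> l)) * \<phi> l t)"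
      by (rule ext, rule sum.cong[OF refl]) (simp add: inv_into_f_f[OF inj])
    finally show "u \<in> range (\<lambda>f t. \<Sum>l\<in>L. f (\<phi> l) * \<phi> l t)"
      by (rule range_eqI[where x = "\<lambda>v. c (inv_into L \<phi> v)"])
  qed
  finally show ?thesis .
qed

lemma model_dim_eq:
  assumes "finite L" "orthonormal_family \<phi> L"
  shows "model_dim \<phi> L = card L"
proof -
  note inj = inj_on_orthonormal[OF assms(2)]
  have "fun_vs.independent (\<phi> ` L)"
  proof (rule fun_vs.independent_if_scalars_zero)
    fix f v assume eq: "(\<Sum>v\<in>\<phi> ` L. (\<lambda>t. f v * v t)) = 0" and v: "v \<in> \<phi> ` L"
    then obtain l where l: "v = \<phi> l" "l \<in> L" by blast
    have "(\<lambda>t. \<Sum>l\<in>L. f (\<phi> l) * \<phi> l t) = (\<lambda>t. 0)"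
      using eq unfolding sum_fun_image[OF assms(1) inj] by (simp add: zero_fun_def)
    then have "L2_inner (\<lambda>t. \<Sum>l\<in>L. f (\<phi> l) * \<phi> l t) (\<lambda>t. \<Sum>l\<in>L. f (\<phi> l) * \<phi> l t) = 0"
      by (simp only: L2_inner_def) simp
    then have "f (\<phi> l) = 0"
      by (rule combination_eq_zero[OF assms _ l(2)])
    then show "f v = 0" by (simp add: l)
  qed (simp add: assms)
  then have "model_dim \<phi> L = card (\<phi> ` L)"
    unfolding model_dim_def model_space_def by (rule fun_vs.dim_span_eq_card_independent)
  also have "\<dots> = card L" by (rule card_image[OF inj])
  finally show ?thesis .
qed

lemma orth_proj_eq:
  assumes s: "square_integrable s" and L: "finite L" "orthonormal_family \<phi> L"
  shows "orth_proj (model_space \<phi> L) s = (\<lambda>t. \<Sum>l\<in>L. L2_inner s (\<phi> l) * \<phi> l t)"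
  unfolding orth_proj_def
proof (rule the_equality)
  let ?p = "\<lambda>c t. \<Sum>l\<in>L. c l * \<phi> l t"
  let ?b = "\<lambda>l. L2_inner s (\<phi> l)"
  note si = orthonormal_family_square_integrable[OF L(2)]
  note sc = square_integrable_combination[OF L(2)]
  have inner_s: "L2_inner s (?p d) = (\<Sum>l\<in>L. d l * ?b l)" for d
    by (rule L2_inner_sum_right[OF s si])
  have inner: "L2_inner (\<lambda>t. s t - ?p c t) (?p d) = (\<Sum>l\<in>L. d l * (?b l - c l))" for c d
    unfolding L2_inner_diff_left[OF s sc sc] L2_inner_combination[OF L] inner_s
      sum_subtractf[symmetric]
    by (intro sum.cong refl) (simp add: algebra_simps)
  have mem: "?p c \<in> model_space \<phi> L" for c
    unfolding model_space_eq[OF L] by (intro CollectI exI[of _ c] refl)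
  have mem_E: "\<exists>c. u = ?p c" if "u \<in> model_space \<phi> L" for u
    using that unfolding model_space_eq[OF L] by (rule CollectD)
  show "?p ?b \<in> model_space \<phi> L \<and> (\<forall>v\<in>model_space \<phi> L. L2_inner (\<lambda>t. s t - ?p ?b t) v = 0)"
  proof (intro conjI ballI mem)
    fix v assume "v \<in> model_space \<phi> L"
    then obtain d where "v = ?p d" using mem_E by blast
    then show "L2_inner (\<lambda>t. s t - ?p ?b t) v = 0" by (simp add: inner)
  qed
  fix u assume u: "u \<in> model_space \<phi> L \<and> (\<forall>v\<in>model_space \<phi> L. L2_inner (\<lambda>t. s t - u t) v = 0)"
  then obtain c where c: "u = ?p c" using mem_E by blast
  have "L2_inner (\<lambda>t. s t - u t) (?p (\<lambda>l. ?b l - c l)) = 0"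
    using u mem[of "\<lambda>l. ?b l - c l"] by blast
  then have "(\<Sum>l\<in>L. (?b l - c l) * (?b l - c l)) = 0"
    by (simp only: c inner)
  then have "\<forall>l\<in>L. ?b l = c l"
    using L(1) by (simp add: sum_nonneg_eq_0_iff)
  then show "u = ?p ?b" unfolding c by (simp only: cong: sum.cong)
qed

lemma bias_eq:
  assumes "square_integrable s" "finite L" "orthonormal_family \<phi> L"
  shows "(L2_norm (\<lambda>t. s t - orth_proj (model_space \<phi> L) s t))\<^sup>2
    = (L2_norm s)\<^sup>2 - (\<Sum>l\<in>L. (L2_inner s (\<phi> l))\<^sup>2)"
  unfolding orth_proj_eq[OF assms] using L2_norm_diff_combination[OF assms, of "\<lambda>l. L2_inner s (\<phi> l)"]
  by simp

lemma loss_eq: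
  assumes "square_integrable s" "finite L" "orthonormal_family \<phi> L"
  shows "loss s \<phi> L n x = (L2_norm s)\<^sup>2 - (\<Sum>l\<in>L. (L2_inner s (\<phi> l))\<^sup>2)
    + (\<Sum>l\<in>L. (1 / real n * (\<Sum>i\<in>{1..n}. \<phi> l (x i)) - L2_inner s (\<phi> l))\<^sup>2)"
  unfolding loss_def proj_est_def
  using L2_norm_diff_combination[OF assms, of "\<lambda>l. 1 / real n * (\<Sum>i\<in>{1..n}. \<phi> l (x i))"] by simp

section \<open>The leave-p-out risk in closed form\<close>

lemma card_subsets_containing:
  assumes "finite A" "J \<subseteq> A" "card J \<le> p"
  shows "card {e. e \<subseteq> A \<and> card e = p \<and> J \<subseteq> e} = (card A - card J) choose (p - card J)"
proof -
  have J: "finite J" using assms finite_subset by blast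
  have "bij_betw (\<lambda>e. e \<union> J) {e. e \<subseteq> A - J \<and> card e = p - card J} {e. e \<subseteq> A \<and> card e = p \<and> J \<subseteq> e}"
  proof (rule bij_betwI[where g = "\<lambda>e. e - J"])
    show "(\<lambda>e. e \<union> J) \<in> {e. e \<subseteq> A - J \<and> card e = p - card J} \<rightarrow> {e. e \<subseteq> A \<and> card e = p \<and> J \<subseteq> e}"
    proof safe
      fix e assume e: "e \<subseteq> A - J" "card e = p - card J"
      then have "finite e" "e \<inter> J = {}" using assms(1) finite_subset by blast+
      then show "card (e \<union> J) = p" using e J assms(3) by (simp add: card_Un_disjoint)
    qed (use assms(2) in auto)
    show "(\<lambda>e. e - J) \<in> {e. e \<subseteq> A \<and> card e = p \<and> J \<subseteq> e} \<rightarrow> {e. e \<subseteq> A - J \<and> card e = p - card J}"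
      using J by (auto simp: card_Diff_subset)
  qed auto
  from bij_betw_same_card[OF this] show ?thesis
    using assms J by (simp add: n_subsets card_Diff_subset)
qed

text \<open>An index belongs to a random subset of size \<open>p\<close> with probability \<open>p / n\<close>, and a pair of distinct
indices with probability \<open>p (p - 1) / (n (n - 1))\<close>.\<close>

lemma sum_subsets_square:
  fixes a :: "nat \<Rightarrow> real"
  assumes p: "1 \<le> p" and n: "2 \<le> n"
  defines "E \<equiv> {e. e \<subseteq> {1..n} \<and> card e = p}"
    and "S \<equiv> \<Sum>i\<in>{1..n}. a i" and "S2 \<equiv> \<Sum>i\<in>{1..n}. (a i)\<^sup>2"
  shows "(\<Sum>e\<in>E. \<Sum>i\<in>e. a i) = real (n choose p) * (p / n * S)"
    and "(\<Sum>e\<in>E. (\<Sum>i\<in>e. a i)\<^sup>2)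
      = real (n choose p) * (p / n * S2 + p * (real p - 1) / (n * (real n - 1)) * (S\<^sup>2 - S2))"
proof -
  have E: "finite E" unfolding E_def by simp
  let ?o = "\<lambda>i j e. of_bool (i \<in> e) * of_bool (j \<in> e)"
  have restrict: "(\<Sum>i\<in>e. a i) = (\<Sum>i\<in>{1..n}. a i * of_bool (i \<in> e))" if "e \<in> E" for e
    using that by (intro sum.mono_neutral_cong_left) (auto simp: E_def)
  have count: "(\<Sum>e\<in>E. of_bool (J \<subseteq> e)) = real (card {e. e \<subseteq> {1..n} \<and> card e = p \<and> J \<subseteq> e})" for J
  proof -
    have "(\<Sum>e\<in>E. of_bool (J \<subseteq> e)) = real (card (E \<inter> {e. J \<subseteq> e}))"
      using E by (simp add: sum.If_cases of_bool_def)
    also have "E \<inter> {e. J \<subseteq> e} = {e. e \<subseteq> {1..n} \<and> card e = p \<and> J \<subseteq> e}" by (auto simp: E_def)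
    finally show ?thesis .
  qed
  have one: "(\<Sum>e\<in>E. of_bool (i \<in> e)) = real (n choose p) * (p / n)" if "i \<in> {1..n}" for i
  proof -
    obtain n' p' where np: "n = Suc n'" "p = Suc p'" using p n by (cases n; cases p) auto
    have "(\<Sum>e\<in>E. of_bool (i \<in> e)) = real ((n - 1) choose (p - 1))"
      using count[of "{i}"] card_subsets_containing[of "{1..n}" "{i}" p] that p by simp
    moreover have "real p * real (n choose p) = real n * real ((n - 1) choose (p - 1))"
      unfolding np of_nat_mult[symmetric] using Suc_times_binomial_eq[of n' p'] by (simp add: mult.commute)
    ultimately show ?thesis using n by (simp add: field_simps)
  qed
  have two: "(\<Sum>e\<in>E. ?o i j e)
      = real (n choose p) * (p * (real p - 1) / (n * (real n - 1)))"
    if "i \<in> {1..n}" "j \<in> {1..n}" "i \<noteq> j" for i j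
  \<comment> \<open>For \<open>p = 1\<close> no subset contains both indices, and \<open>p - 2\<close> would be truncated.\<close>
  proof (cases "p = 1")
    case True
    have "?o i j e = (0::real)" if "e \<in> E" for e
    proof -
      have "card e = 1" using that True by (simp add: E_def)
      then obtain k where "e = {k}" by (auto simp: card_1_singleton_iff)
      then show ?thesis using \<open>i \<noteq> j\<close> by auto
    qed
    then show ?thesis using True by (simp add: sum.neutral)
  next
    case False
    obtain n' p' where np: "n = Suc (Suc n')" "p = Suc (Suc p')"
      using False p n that[of "n - 2" "p - 2"] by simp
    have "(\<Sum>e\<in>E. ?o i j e) = (\<Sum>e\<in>E. of_bool ({i, j} \<subseteq> e) :: real)"
      by (intro sum.cong refl) auto
    also have "\<dots> = real ((n - 2) choose (p - 2))"
      using count[of "{i, j}"] card_subsets_containing[of "{1..n}" "{i, j}" p] that np by simp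
    finally have eq: "(\<Sum>e\<in>E. ?o i j e) = real (n' choose p')"
      by (simp add: np)
    have r: "real (Suc a) * real (a choose b) = real (Suc a choose Suc b) * real (Suc b)" for a b
      unfolding of_nat_mult[symmetric] Suc_times_binomial_eq ..
    have "real (Suc (Suc p')) * real (Suc p') * real (n choose p)
        = real (Suc p') * (real (Suc (Suc n')) * real (Suc n' choose Suc p'))"
      unfolding r[of "Suc n'" "Suc p'"] np by (simp only: mult_ac)
    also have "\<dots> = real (Suc (Suc n')) * (real (Suc n') * real (n' choose p'))"
      unfolding r[of n' p'] by (simp only: mult_ac)
    finally have "real (Suc (Suc p')) * real (Suc p') * real (n choose p)
        = real (Suc (Suc n')) * (real (Suc n') * real (n' choose p'))" .
    then have "real p * (real p - 1) * real (n choose p) = real n * (real n - 1) * real (n' choose p')"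
      by (simp add: np)
    moreover have "real n * (real n - 1) \<noteq> 0" by (simp add: np)
    ultimately show ?thesis unfolding eq by (simp add: field_simps)
  qed
  have "(\<Sum>e\<in>E. \<Sum>i\<in>e. a i) = (\<Sum>e\<in>E. \<Sum>i\<in>{1..n}. a i * of_bool (i \<in> e))"
    by (intro sum.cong refl restrict)
  also have "\<dots> = (\<Sum>i\<in>{1..n}. a i * (\<Sum>e\<in>E. of_bool (i \<in> e)))"
    by (subst sum.swap) (simp only: sum_distrib_left)
  also have "\<dots> = (\<Sum>i\<in>{1..n}. a i * (real (n choose p) * (p / n)))"
    by (intro sum.cong refl) (simp only: one)
  also have "\<dots> = real (n choose p) * (p / n * S)"
    unfolding S_def sum_distrib_right[symmetric] by (simp only: mult_ac)
  finally show "(\<Sum>e\<in>E. \<Sum>i\<in>e. a i) = real (n choose p) * (p / n * S)" .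
  let ?c1 = "real (n choose p) * (p / n)"
  let ?c2 = "real (n choose p) * (p * (real p - 1) / (n * (real n - 1)))"
  have "(\<Sum>e\<in>E. (\<Sum>i\<in>e. a i)\<^sup>2)
      = (\<Sum>e\<in>E. \<Sum>i\<in>{1..n}. \<Sum>j\<in>{1..n}. a i * a j * (?o i j e))"
  proof (intro sum.cong refl)
    fix e assume "e \<in> E"
    show "(\<Sum>i\<in>e. a i)\<^sup>2 = (\<Sum>i\<in>{1..n}. \<Sum>j\<in>{1..n}. a i * a j * (?o i j e))"
      unfolding restrict[OF \<open>e \<in> E\<close>] power2_eq_square sum_product
      by (intro sum.cong refl) simp
  qed
  also have "\<dots> = (\<Sum>i\<in>{1..n}. \<Sum>j\<in>{1..n}. a i * a j * (\<Sum>e\<in>E. ?o i j e))"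
    by (subst sum.swap, intro sum.cong refl, subst sum.swap) (simp only: sum_distrib_left)
  also have "\<dots> = (\<Sum>i\<in>{1..n}. \<Sum>j\<in>{1..n}. ?c2 * (a i * a j) + (if j = i then (?c1 - ?c2) * (a i * a j) else 0))"
  proof (intro sum.cong refl)
    fix i j assume ij: "i \<in> {1..n}" "j \<in> {1..n}"
    show "a i * a j * (\<Sum>e\<in>E. ?o i j e)
        = ?c2 * (a i * a j) + (if j = i then (?c1 - ?c2) * (a i * a j) else 0)"
    proof (cases "j = i")
      case True
      have "(\<Sum>e\<in>E. of_bool (i \<in> e) * of_bool (i \<in> e)) = (\<Sum>e\<in>E. of_bool (i \<in> e) :: real)"
        by (intro sum.cong refl) auto
      then show ?thesis using one[OF ij(1)] True by (simp add: algebra_simps)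
    next
      case False
      then have "(\<Sum>e\<in>E. ?o i j e) = ?c2" using two[of i j] ij by simp
      with False show ?thesis by (simp only: if_False mult.commute add_0_right)
    qed
  qed
  also have "\<dots> = ?c2 * (\<Sum>i\<in>{1..n}. \<Sum>j\<in>{1..n}. a i * a j) + (\<Sum>i\<in>{1..n}. (?c1 - ?c2) * (a i * a i))"
    by (simp only: sum.distrib sum_distrib_left sum.delta finite_atLeastAtMost) simp
  also have "(\<Sum>i\<in>{1..n}. \<Sum>j\<in>{1..n}. a i * a j) = S\<^sup>2"
    by (simp only: S_def power2_eq_square sum_product)
  also have "(\<Sum>i\<in>{1..n}. (?c1 - ?c2) * (a i * a i)) = (?c1 - ?c2) * S2"
    by (simp only: S2_def power2_eq_square sum_distrib_left)
  finally have "(\<Sum>e\<in>E. (\<Sum>i\<in>e. a i)\<^sup>2) = ?c2 * S\<^sup>2 + (?c1 - ?c2) * S2" .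
  also have "\<dots> = real (n choose p) * (p / n * S2 + p * (real p - 1) / (n * (real n - 1)) * (S\<^sup>2 - S2))"
    by (simp only: distrib_left right_diff_distrib left_diff_distrib mult.assoc)
  finally show "(\<Sum>e\<in>E. (\<Sum>i\<in>e. a i)\<^sup>2)
      = real (n choose p) * (p / n * S2 + p * (real p - 1) / (n * (real n - 1)) * (S\<^sup>2 - S2))" .
qed

text \<open>The averages of \<open>\<Sum>\<^sub>e a\<close> and \<open>(\<Sum>\<^sub>e a)\<^sup>2\<close> over all subsets \<open>e\<close> of size \<open>p\<close>, given by the
previous lemma, are substituted in a polynomial of degree two in \<open>\<Sum>\<^sub>e a\<close>; with \<open>T\<close> the sum of squares,
the coefficients of \<open>T\<close> and \<open>S\<^sup>2 - T\<close> are compared.\<close>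

lemma lpo_identity:
  fixes n p S T :: real
  assumes "p \<noteq> 0" "n \<noteq> p" "n \<noteq> 0" "n \<noteq> 1"
  shows "(S\<^sup>2 - 2 * S * (p / n * S) + (p / n * T + p * (p - 1) / (n * (n - 1)) * (S\<^sup>2 - T))) / (n - p)\<^sup>2
      - 2 / (p * (n - p)) * (S * (p / n * S) - (p / n * T + p * (p - 1) / (n * (n - 1)) * (S\<^sup>2 - T)))
    = T / (n * (n - p)) - (n - p + 1) / (n * (n - 1) * (n - p)) * (S\<^sup>2 - T)"
proof -
  have nz: "n - p \<noteq> 0" "n - 1 \<noteq> 0" using assms by auto
  define d e where "d = n - p" and "e = n - 1"
  have p: "p = n - d" by (simp add: d_def)
  obtain X where X: "S\<^sup>2 = X + T" by (metis diff_add_cancel)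
  have pm: "p - 1 = e - d" by (simp add: d_def e_def)
  have S2: "S * (p / n * S) = p / n * (X + T)" "2 * S * (p / n * S) = 2 * (p / n * (X + T))"
    unfolding X[symmetric] by (simp_all add: power2_eq_square)
  have nz': "d \<noteq> 0" "e \<noteq> 0" using nz by (simp_all add: d_def e_def)
  have T_part: "(T - 2 * (p / n * T) + p / n * T) / d\<^sup>2 - 2 / (p * d) * (p / n * T - p / n * T) = T / (n * d)"
    using assms nz' unfolding p by (simp add: field_simps power2_eq_square)
  have X_part: "(X - 2 * (p / n * X) + p * (e - d) / (n * e) * X) / d\<^sup>2
      - 2 / (p * d) * (p / n * X - p * (e - d) / (n * e) * X) = - ((d + 1) / (n * e * d) * X)"
  proof -
    have "(1 - 2 * (p / n) + p * (e - d) / (n * e)) = d * (d - 1) / (n * e)"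
      using assms nz' by (simp add: field_simps) (simp add: d_def e_def algebra_simps)
    then have 1: "X - 2 * (p / n * X) + p * (e - d) / (n * e) * X = d * (d - 1) / (n * e) * X"
      by (metis (no_types, opaque_lifting) distrib_right left_diff_distrib mult.assoc mult_1)
    have 2: "p / n * X - p * (e - d) / (n * e) * X = p * d / (n * e) * X"
      using assms nz' by (simp add: field_simps)
    show ?thesis
      unfolding 1 2 using assms nz' by (simp add: field_simps power2_eq_square)
  qed
  have "(S\<^sup>2 - 2 * S * (p / n * S) + (p / n * T + p * (p - 1) / (n * (n - 1)) * (S\<^sup>2 - T))) / (n - p)\<^sup>2
      - 2 / (p * (n - p)) * (S * (p / n * S) - (p / n * T + p * (p - 1) / (n * (n - 1)) * (S\<^sup>2 - T)))
    = ((T - 2 * (p / n * T) + p / n * T) / d\<^sup>2 - 2 / (p * d) * (p / n * T - p / n * T))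
     + ((X - 2 * (p / n * X) + p * (e - d) / (n * e) * X) / d\<^sup>2
      - 2 / (p * d) * (p / n * X - p * (e - d) / (n * e) * X))"
    unfolding S2 unfolding X pm d_def[symmetric] e_def[symmetric]
    by (simp add: add_divide_distrib diff_divide_distrib algebra_simps)
  also have "\<dots> = T / (n * d) - (d + 1) / (n * e * d) * X"
    unfolding T_part X_part by simp
  finally show ?thesis by (simp add: X d_def e_def)
qed

lemma lpo_coordinate:
  fixes a :: "nat \<Rightarrow> real"
  assumes p: "1 \<le> p" "p < n"
  defines "E \<equiv> {e. e \<subseteq> {1..n} \<and> card e = p}"
    and "S \<equiv> \<Sum>i\<in>{1..n}. a i" and "S2 \<equiv> \<Sum>i\<in>{1..n}. (a i)\<^sup>2"
  shows "1 / real (n choose p) * (\<Sum>e\<in>E. (1 / real (n - p) * (\<Sum>i\<in>{1..n} - e. a i))\<^sup>2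
        - 2 / real p * (1 / real (n - p) * (\<Sum>i\<in>{1..n} - e. a i)) * (\<Sum>i\<in>e. a i))
    = S2 / (n * (real n - p)) - (real n - p + 1) / (n * (real n - 1) * (real n - p)) * (S\<^sup>2 - S2)"
proof -
  let ?c = "\<lambda>e. 1 / real (n - p) * (\<Sum>i\<in>{1..n} - e. a i)"
  let ?C = "real (n choose p)"
  let ?d = "real n - p"
  let ?Z = "\<lambda>e. \<Sum>i\<in>e. a i"
  have n: "2 \<le> n" using p by simp
  have C: "?C \<noteq> 0" using p by simp
  have cE: "real (card E) = ?C" by (simp add: E_def n_subsets)
  note moments = sum_subsets_square[OF p(1) n, of a, folded E_def S_def S2_def]
  have "(\<Sum>e\<in>E. (?c e)\<^sup>2
        - 2 / real p * (?c e) * ?Z e)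
    = (\<Sum>e\<in>E. S\<^sup>2 / ?d\<^sup>2 - (2 * S / ?d\<^sup>2 + 2 * S / (p * ?d)) * ?Z e + (1 / ?d\<^sup>2 + 2 / (p * ?d)) * (?Z e)\<^sup>2)"
  proof (intro sum.cong refl)
    fix e assume "e \<in> E"
    then have e: "(\<Sum>i\<in>{1..n} - e. a i) = S - ?Z e"
      by (simp add: E_def S_def sum_diff)
    show "(?c e)\<^sup>2
        - 2 / real p * (?c e) * ?Z e
      = S\<^sup>2 / ?d\<^sup>2 - (2 * S / ?d\<^sup>2 + 2 * S / (p * ?d)) * ?Z e + (1 / ?d\<^sup>2 + 2 / (p * ?d)) * (?Z e)\<^sup>2"
      using p unfolding e
      by (simp add: of_nat_diff power_divide power2_diff)
         (simp add: power2_eq_square add_divide_distrib diff_divide_distrib algebra_simps)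
  qed
  also have "\<dots> = real (card E) * (S\<^sup>2 / ?d\<^sup>2) - (2 * S / ?d\<^sup>2 + 2 * S / (p * ?d)) * (\<Sum>e\<in>E. ?Z e)
      + (1 / ?d\<^sup>2 + 2 / (p * ?d)) * (\<Sum>e\<in>E. (?Z e)\<^sup>2)"
    by (simp only: sum.distrib sum_subtractf sum_distrib_left sum_constant)
  also have "\<dots> = ?C * ((S\<^sup>2 - 2 * S * (p / n * S) + (p / n * S2 + p * (real p - 1) / (n * (real n - 1)) * (S\<^sup>2 - S2))) / ?d\<^sup>2
      - 2 / (p * ?d) * (S * (p / n * S) - (p / n * S2 + p * (real p - 1) / (n * (real n - 1)) * (S\<^sup>2 - S2))))"
    unfolding moments cE
    by (simp only: distrib_left distrib_right right_diff_distrib left_diff_distrib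
         add_divide_distrib diff_divide_distrib mult.assoc) (simp add: algebra_simps)
  also have "\<dots> = ?C * (S2 / (n * ?d) - (?d + 1) / (n * (real n - 1) * ?d) * (S\<^sup>2 - S2))"
    using p n by (subst lpo_identity) simp_all
  finally show ?thesis using C by simp
qed

text \<open>The average over all subsets turns the leave-p-out risk into a combination of the diagonal and the
off-diagonal part of the squared empirical coefficients, so that it can be studied for all \<open>p\<close> at
once.\<close>

lemma lpo_risk_eq:
  assumes L: "finite L" "orthonormal_family \<phi> L" and p: "1 \<le> p" "p < n"
  shows "lpo_risk \<phi> L n p x = (\<Sum>l\<in>L. (\<Sum>i\<in>{1..n}. (\<phi> l (x i))\<^sup>2) / (n * (real n - p))
     - (real n - p + 1) / (n * (real n - 1) * (real n - p))
       * ((\<Sum>i\<in>{1..n}. \<phi> l (x i))\<^sup>2 - (\<Sum>i\<in>{1..n}. (\<phi> l (x i))\<^sup>2)))"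
proof -
  let ?E = "{e. e \<subseteq> {1..n} \<and> card e = p}"
  let ?c = "\<lambda>l e. 1 / real (n - p) * (\<Sum>i\<in>{1..n} - e. \<phi> l (x i))"
  have inner: "1 / real p * (\<Sum>i\<in>e. contrast (proj_est \<phi> L ({1..n} - e) x) (x i))
      = (\<Sum>l\<in>L. (?c l e)\<^sup>2 - 2 / real p * ?c l e * (\<Sum>i\<in>e. \<phi> l (x i)))" if e: "e \<in> ?E" for e
  proof -
    have fin: "finite e" using e finite_subset by blast
    have card: "card ({1..n} - e) = n - p" using e fin by (simp add: card_Diff_subset)
    have est: "proj_est \<phi> L ({1..n} - e) x = (\<lambda>t. \<Sum>l\<in>L. ?c l e * \<phi> l t)"
      by (rule ext) (simp only: proj_est_def card)
    have "(\<Sum>i\<in>e. contrast (proj_est \<phi> L ({1..n} - e) x) (x i))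
        = real p * (\<Sum>l\<in>L. (?c l e)\<^sup>2) - 2 * (\<Sum>i\<in>e. \<Sum>l\<in>L. ?c l e * \<phi> l (x i))"
      unfolding contrast_def est L2_norm_combination[OF L] sum_subtractf sum_constant
      using e by (simp add: sum_distrib_left)
    also have "(\<Sum>i\<in>e. \<Sum>l\<in>L. ?c l e * \<phi> l (x i)) = (\<Sum>l\<in>L. ?c l e * (\<Sum>i\<in>e. \<phi> l (x i)))"
      by (subst sum.swap) (simp only: sum_distrib_left)
    finally have "1 / real p * (\<Sum>i\<in>e. contrast (proj_est \<phi> L ({1..n} - e) x) (x i))
        = (\<Sum>l\<in>L. (?c l e)\<^sup>2) - 2 / real p * (\<Sum>l\<in>L. ?c l e * (\<Sum>i\<in>e. \<phi> l (x i)))"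
      using p by (simp add: right_diff_distrib)
    also have "\<dots> = (\<Sum>l\<in>L. (?c l e)\<^sup>2 - 2 / real p * ?c l e * (\<Sum>i\<in>e. \<phi> l (x i)))"
    proof -
      have "2 / real p * (\<Sum>l\<in>L. h l * k l) = (\<Sum>l\<in>L. 2 / real p * h l * k l)" for h k :: "_ \<Rightarrow> real"
        by (simp only: sum_distrib_left mult.assoc)
      then show ?thesis by (simp only: sum_subtractf)
    qed
    finally show ?thesis .
  qed
  have "lpo_risk \<phi> L n p x = 1 / real (n choose p)
      * (\<Sum>e\<in>?E. \<Sum>l\<in>L. (?c l e)\<^sup>2 - 2 / real p * ?c l e * (\<Sum>i\<in>e. \<phi> l (x i)))"
    unfolding lpo_risk_def by (intro arg_cong2[where f = "(*)"] refl sum.cong inner)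
  also have "\<dots> = (\<Sum>l\<in>L. 1 / real (n choose p) * (\<Sum>e\<in>?E. (?c l e)\<^sup>2 - 2 / real p * ?c l e * (\<Sum>i\<in>e. \<phi> l (x i))))"
    by (subst sum.swap) (simp only: sum_distrib_left)
  also have "\<dots> = (\<Sum>l\<in>L. (\<Sum>i\<in>{1..n}. (\<phi> l (x i))\<^sup>2) / (n * (real n - p))
     - (real n - p + 1) / (n * (real n - 1) * (real n - p))
       * ((\<Sum>i\<in>{1..n}. \<phi> l (x i))\<^sup>2 - (\<Sum>i\<in>{1..n}. (\<phi> l (x i))\<^sup>2)))"
    by (intro sum.cong refl lpo_coordinate p)
  finally show ?thesis .
qed

section \<open>Centred scores of a model\<close>

text \<open>The basis functions are bounded only almost everywhere. Setting the centred function to zero off a set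
\<open>G\<close> of full measure gives a function that is bounded everywhere and has the same distribution.\<close>

definition truncated_centering :: "'x measure \<Rightarrow> 'x set \<Rightarrow> ('x \<Rightarrow> real) \<Rightarrow> 'x \<Rightarrow> real" where
  "truncated_centering \<mu> G h t = (if t \<in> G then h t - (\<integral>y. h y \<partial>\<mu>) else 0)"

lemma truncated_centering:
  assumes "prob_space \<mu>" and G: "G \<in> sets \<mu>" "AE t in \<mu>. t \<in> G"
    and h: "h \<in> borel_measurable \<mu>" and bdd: "\<And>t. t \<in> G \<Longrightarrow> \<bar>h t\<bar> \<le> c" and c: "0 \<le> c"
  shows "integrable \<mu> h" and "integrable \<mu> (\<lambda>t. (h t)\<^sup>2)"
    and "truncated_centering \<mu> G h \<in> borel_measurable \<mu>"
    and "\<bar>truncated_centering \<mu> G h t\<bar> \<le> 2 * c"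
    and "(\<integral>t. truncated_centering \<mu> G h t \<partial>\<mu>) = 0"
    and "(\<integral>t. (truncated_centering \<mu> G h t)\<^sup>2 \<partial>\<mu>) \<le> (\<integral>t. (h t)\<^sup>2 \<partial>\<mu>)"
proof -
  interpret prob_space \<mu> by fact
  have ae: "AE t in \<mu>. \<bar>h t\<bar> \<le> c" using G(2) by eventually_elim (rule bdd)
  show h_int: "integrable \<mu> h"
    using ae h by (intro integrable_const_bound[where B = c]) auto
  show h2_int: "integrable \<mu> (\<lambda>t. (h t)\<^sup>2)"
  proof (rule integrable_const_bound[where B = "c\<^sup>2"])
    show "AE t in \<mu>. norm ((h t)\<^sup>2) \<le> c\<^sup>2"
      using ae
    proof eventually_elim
      case (elim t)
      then have "\<bar>h t\<bar>\<^sup>2 \<le> c\<^sup>2" by (intro power_mono) auto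
      then show ?case by simp
    qed
    show "(\<lambda>t. (h t)\<^sup>2) \<in> borel_measurable \<mu>" using h by (rule borel_measurable_power)
  qed
  show meas: "truncated_centering \<mu> G h \<in> borel_measurable \<mu>"
    unfolding truncated_centering_def using G(1) h by measurable
  have "\<bar>\<integral>y. h y \<partial>\<mu>\<bar> \<le> (\<integral>y. \<bar>h y\<bar> \<partial>\<mu>)" by (rule integral_abs_bound)
  also have "\<dots> \<le> (\<integral>y. c \<partial>\<mu>)"
    using ae h_int by (intro integral_mono_AE) auto
  finally have m: "\<bar>\<integral>y. h y \<partial>\<mu>\<bar> \<le> c" by (simp add: prob_space)
  show "\<bar>truncated_centering \<mu> G h t\<bar> \<le> 2 * c"
  proof (cases "t \<in> G")
    case True
    with bdd[OF True] m show ?thesis by (simp add: truncated_centering_def)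
  qed (use c in \<open>simp add: truncated_centering_def\<close>)
  have eq: "AE t in \<mu>. truncated_centering \<mu> G h t = h t - (\<integral>y. h y \<partial>\<mu>)"
    using G(2) by eventually_elim (simp add: truncated_centering_def)
  have "(\<integral>t. truncated_centering \<mu> G h t \<partial>\<mu>) = (\<integral>t. h t - (\<integral>y. h y \<partial>\<mu>) \<partial>\<mu>)"
    by (intro integral_cong_AE eq meas borel_measurable_diff h) simp
  also have "\<dots> = 0" using h_int by (simp add: prob_space)
  finally show "(\<integral>t. truncated_centering \<mu> G h t \<partial>\<mu>) = 0" .
  have "(\<integral>t. (truncated_centering \<mu> G h t)\<^sup>2 \<partial>\<mu>) = variance h"
  proof (rule integral_cong_AE)
    show "AE t in \<mu>. (truncated_centering \<mu> G h t)\<^sup>2 = (h t - expectation h)\<^sup>2"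
      using eq by eventually_elim simp
    show "(\<lambda>t. (truncated_centering \<mu> G h t)\<^sup>2) \<in> borel_measurable \<mu>"
      using meas by (rule borel_measurable_power)
    show "(\<lambda>t. (h t - expectation h)\<^sup>2) \<in> borel_measurable \<mu>"
      by (intro borel_measurable_power borel_measurable_diff h) simp
  qed
  also have "\<dots> = (\<integral>t. (h t)\<^sup>2 \<partial>\<mu>) - (expectation h)\<^sup>2"
    by (rule variance_eq[OF h_int h2_int])
  finally show "(\<integral>t. (truncated_centering \<mu> G h t)\<^sup>2 \<partial>\<mu>) \<le> (\<integral>t. (h t)\<^sup>2 \<partial>\<mu>)" by simp
qed

lemma truncated_centering_sum:
  assumes "\<And>l. l \<in> L \<Longrightarrow> integrable \<mu> (h l)"
  shows "(\<Sum>l\<in>L. c l * truncated_centering \<mu> G (h l) t) = truncated_centering \<mu> G (\<lambda>t. \<Sum>l\<in>L. c l * h l t) t"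
proof -
  have "(\<integral>y. (\<Sum>l\<in>L. c l * h l y) \<partial>\<mu>) = (\<Sum>l\<in>L. c l * (\<integral>y. h l y \<partial>\<mu>))"
    using assms by (subst Bochner_Integration.integral_sum) auto
  then show ?thesis
    by (simp add: truncated_centering_def right_diff_distrib sum_subtractf)
qed

text \<open>\<open>b\<close> bounds the squared norm of the evaluation functional on the model at almost every point.\<close>

definition regular_model :: "('l \<Rightarrow> real \<Rightarrow> real) \<Rightarrow> 'l set \<Rightarrow> real \<Rightarrow> bool" where
  "regular_model \<phi> L b \<longleftrightarrow> finite L \<and> orthonormal_family \<phi> L \<and> 0 < b \<and>
     (AE t in unit_leb. phi_model \<phi> L t \<le> b)"

definition regular_points :: "('l \<Rightarrow> real \<Rightarrow> real) \<Rightarrow> 'l set \<Rightarrow> real \<Rightarrow> real set" where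
  "regular_points \<phi> L b = {t \<in> space unit_leb. phi_model \<phi> L t \<le> b}"

lemma combination_bound:
  assumes "phi_model \<phi> L t \<le> b" "0 \<le> b"
  shows "(\<Sum>l\<in>L. c l * \<phi> l t)\<^sup>2 \<le> (\<Sum>l\<in>L. (c l)\<^sup>2) * b"
proof -
  have "(\<Sum>l\<in>L. c l * \<phi> l t)\<^sup>2 \<le> (\<Sum>l\<in>L. (c l)\<^sup>2) * (\<Sum>l\<in>L. (\<phi> l t)\<^sup>2)"
    by (rule Cauchy_Schwarz_ineq_sum)
  also have "\<dots> \<le> (\<Sum>l\<in>L. (c l)\<^sup>2) * b"
    using assms unfolding phi_model_def by (intro mult_left_mono sum_nonneg) auto
  finally show ?thesis .
qed

lemma bessel_inequality:
  assumes "square_integrable s" "finite L" "orthonormal_family \<phi> L"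
  shows "(\<Sum>l\<in>L. (L2_inner s (\<phi> l))\<^sup>2) \<le> (L2_norm s)\<^sup>2"
proof -
  have "0 \<le> (L2_norm (\<lambda>t. s t - (\<Sum>l\<in>L. L2_inner s (\<phi> l) * \<phi> l t)))\<^sup>2" by simp
  then show ?thesis unfolding L2_norm_diff_combination[OF assms] by simp
qed

text \<open>The setting for one fixed sample size.\<close>

locale L2_sample =
  fixes s :: "real \<Rightarrow> real" and P :: "'a measure" and X :: "nat \<Rightarrow> 'a \<Rightarrow> real" and n :: nat
  assumes s_nonneg: "\<And>t. t \<in> {0..1} \<Longrightarrow> 0 \<le> s t"
    and s_L2: "square_integrable s"
    and iid: "iid_sample P X n s"
    and n_pos: "1 \<le> n"
begin

abbreviation law :: "real measure" where
  "law \<equiv> sample_law s"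

abbreviation coef :: "('l \<Rightarrow> real \<Rightarrow> real) \<Rightarrow> 'l \<Rightarrow> real" where
  "coef \<phi> l \<equiv> L2_inner s (\<phi> l)"

lemma space_unit_leb: "space unit_leb = {0..1}"
  by (simp add: unit_leb_def space_restrict_space)

lemma prob_law: "prob_space law"
  by (rule iid_sample_law(1)[OF iid n_pos])

lemma prob_P: "prob_space P"
  using iid by (simp add: iid_sample_def)

lemma borel_measurable_law: "f \<in> borel_measurable unit_leb \<Longrightarrow> f \<in> borel_measurable law"
  by (simp only: measurable_cong_sets[OF sets_sample_law refl])

lemma integral_law:
  assumes "f \<in> borel_measurable unit_leb"
  shows "(\<integral>t. f t \<partial>law) = (\<integral>t. s t * f t \<partial>unit_leb)"
  unfolding sample_law_def
  using assms s_L2 s_nonneg by (subst integral_density) (auto simp: space_unit_leb square_integrable_def)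

lemma AE_law: "AE t in unit_leb. Q t \<Longrightarrow> AE t in law. Q t"
  unfolding sample_law_def using borel_measurable_square_integrable[OF s_L2]
  by (subst AE_density) auto

lemma regular_points:
  assumes "regular_model \<phi> L b"
  shows "regular_points \<phi> L b \<in> sets law" "AE t in law. t \<in> regular_points \<phi> L b"
proof -
  have "phi_model \<phi> L \<in> borel_measurable unit_leb"
    unfolding phi_model_def using assms
    by (intro borel_measurable_sum borel_measurable_power borel_measurable_square_integrable)
       (simp add: regular_model_def orthonormal_family_def)
  then show "regular_points \<phi> L b \<in> sets law"
    unfolding regular_points_def by simp
  have "AE t in law. phi_model \<phi> L t \<le> b"
    using assms by (intro AE_law) (simp add: regular_model_def)
  then show "AE t in law. t \<in> regular_points \<phi> L b"
    using AE_space by eventually_elim (simp add: regular_points_def)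
qed

definition score :: "('l \<Rightarrow> real \<Rightarrow> real) \<Rightarrow> 'l set \<Rightarrow> real \<Rightarrow> 'l \<Rightarrow> real \<Rightarrow> real" where
  "score \<phi> L b l = truncated_centering law (regular_points \<phi> L b) (\<phi> l)"

lemma score:
  assumes m: "regular_model \<phi> L b" and l: "l \<in> L"
  shows "score \<phi> L b l \<in> borel_measurable law"
    and "integrable law (\<phi> l)"
    and "(\<integral>t. score \<phi> L b l t \<partial>law) = 0"
    and "(\<integral>t. \<phi> l t \<partial>law) = coef \<phi> l"
    and "t \<in> regular_points \<phi> L b \<Longrightarrow> score \<phi> L b l t = \<phi> l t - coef \<phi> l"
proof -
  have \<phi>: "\<phi> l \<in> borel_measurable unit_leb"
    using m l by (simp add: regular_model_def orthonormal_family_def square_integrable_def)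
  have bdd: "\<bar>\<phi> l t\<bar> \<le> sqrt b" if "t \<in> regular_points \<phi> L b" for t
  proof -
    have "(\<phi> l t)\<^sup>2 \<le> phi_model \<phi> L t"
      unfolding phi_model_def using m l by (intro member_le_sum) (auto simp: regular_model_def)
    also have "\<dots> \<le> b" using that by (simp add: regular_points_def)
    finally show ?thesis by (simp add: real_le_rsqrt)
  qed
  have b: "0 \<le> sqrt b" using m by (simp add: regular_model_def)
  note tc = truncated_centering[OF prob_law regular_points[OF m] borel_measurable_law[OF \<phi>] bdd b]
  show "score \<phi> L b l \<in> borel_measurable law"
    "integrable law (\<phi> l)" "(\<integral>t. score \<phi> L b l t \<partial>law) = 0"
    unfolding score_def using tc(3,1,5) by simp_all
  show eq: "(\<integral>t. \<phi> l t \<partial>law) = coef \<phi> l"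
    by (simp only: integral_law[OF \<phi>] L2_inner_def)
  show "score \<phi> L b l t = \<phi> l t - coef \<phi> l" if "t \<in> regular_points \<phi> L b"
    using that by (simp only: score_def truncated_centering_def eq if_True)
qed

lemma score_bound:
  assumes m: "regular_model \<phi> L b"
  shows "(\<Sum>l\<in>L. (score \<phi> L b l t)\<^sup>2) \<le> 2 * (b + (L2_norm s)\<^sup>2)"
proof (cases "t \<in> regular_points \<phi> L b")
  case True
  have "(\<Sum>l\<in>L. (score \<phi> L b l t)\<^sup>2) = (\<Sum>l\<in>L. (\<phi> l t - coef \<phi> l)\<^sup>2)"
    using score(5)[OF m _ True] by (intro sum.cong refl) simp
  also have "\<dots> \<le> (\<Sum>l\<in>L. 2 * (\<phi> l t)\<^sup>2 + 2 * (coef \<phi> l)\<^sup>2)"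
  proof (rule sum_mono)
    fix l
    have "0 \<le> (\<phi> l t + coef \<phi> l)\<^sup>2" by simp
    then show "(\<phi> l t - coef \<phi> l)\<^sup>2 \<le> 2 * (\<phi> l t)\<^sup>2 + 2 * (coef \<phi> l)\<^sup>2"
      by (simp add: power2_sum power2_diff)
  qed
  also have "\<dots> = 2 * (phi_model \<phi> L t + (\<Sum>l\<in>L. (coef \<phi> l)\<^sup>2))"
    by (simp only: phi_model_def sum.distrib sum_distrib_left distrib_left)
  also have "\<dots> \<le> 2 * (b + (L2_norm s)\<^sup>2)"
    using True m bessel_inequality[OF s_L2, of L \<phi>] by (simp add: regular_points_def regular_model_def)
  finally show ?thesis .
next
  case False
  then have "score \<phi> L b l t = 0" for l by (simp add: score_def truncated_centering_def)
  then show ?thesis using m by (simp add: regular_model_def)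
qed

text \<open>The variance of a unit vector \<open>h\<close> of the model is of order \<open>sqrt b\<close> and not \<open>b\<close>: one factor \<open>\<bar>h\<bar>\<close> of
\<open>h\<^sup>2 s\<close> is bounded by \<open>sqrt b\<close>, and the remaining \<open>\<bar>h\<bar> s\<close> is integrated using \<open>s \<in> L\<^sup>2\<close>.
No bound on \<open>s\<close> itself enters.\<close>

lemma score_weak_variance:
  assumes m: "regular_model \<phi> L b"
  shows "(\<integral>t. (\<Sum>l\<in>L. c l * score \<phi> L b l t)\<^sup>2 \<partial>law)
    \<le> sqrt b * (1 + (L2_norm s)\<^sup>2) / 2 * (\<Sum>l\<in>L. (c l)\<^sup>2)"
proof -
  let ?h = "\<lambda>t. \<Sum>l\<in>L. c l * \<phi> l t"
  let ?k = "\<Sum>l\<in>L. (c l)\<^sup>2"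
  let ?R = "\<lambda>t. sqrt b / 2 * ((?h t)\<^sup>2 + ?k * (s t)\<^sup>2)"
  have L: "finite L" "orthonormal_family \<phi> L" and b: "0 < b"
    using m by (auto simp: regular_model_def)
  have k: "0 \<le> ?k" by (intro sum_nonneg) simp
  have h_L2: "square_integrable ?h" by (rule square_integrable_combination[OF L(2)])
  note h = borel_measurable_square_integrable[OF h_L2]
  have h_bdd: "\<bar>?h t\<bar> \<le> sqrt (?k * b)" if "phi_model \<phi> L t \<le> b" for t
    using combination_bound[OF that less_imp_le[OF b], of c] by (intro real_le_rsqrt) simp
  have h_reg: "\<bar>?h t\<bar> \<le> sqrt (?k * b)" if "t \<in> regular_points \<phi> L b" for t
    using that by (intro h_bdd) (simp add: regular_points_def)
  have kb: "0 \<le> sqrt (?k * b)" using k b by simp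
  have "(\<lambda>t. \<Sum>l\<in>L. c l * score \<phi> L b l t) = truncated_centering law (regular_points \<phi> L b) ?h"
    unfolding score_def by (rule ext, rule truncated_centering_sum, rule score(2)[OF m])
  then have "(\<integral>t. (\<Sum>l\<in>L. c l * score \<phi> L b l t)\<^sup>2 \<partial>law)
      = (\<integral>t. (truncated_centering law (regular_points \<phi> L b) ?h t)\<^sup>2 \<partial>law)"
    by (simp add: fun_eq_iff)
  also have "\<dots> \<le> (\<integral>t. (?h t)\<^sup>2 \<partial>law)"
    by (rule truncated_centering(6)[OF prob_law regular_points[OF m] borel_measurable_law[OF h] h_reg kb])
  also have "\<dots> = (\<integral>t. s t * (?h t)\<^sup>2 \<partial>unit_leb)"
    by (rule integral_law[OF borel_measurable_power[OF h]])
  also have "\<dots> \<le> (\<integral>t. ?R t \<partial>unit_leb)"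
  proof (rule integral_mono_AE')
    show "integrable unit_leb (\<lambda>t. ?R t)"
      using h_L2 s_L2 by (simp add: square_integrable_def)
    have "AE t in unit_leb. phi_model \<phi> L t \<le> b" using m by (simp add: regular_model_def)
    then show "AE t in unit_leb. s t * (?h t)\<^sup>2 \<le> ?R t"
      using AE_space
    proof eventually_elim
      case (elim t)
      let ?u = "\<bar>?h t\<bar>"
      have st: "0 \<le> s t" using elim s_nonneg by (simp add: space_unit_leb)
      have u: "?u \<le> sqrt b * sqrt ?k" using h_bdd[OF elim(1)] by (simp add: real_sqrt_mult mult.commute)
      have "s t * (?h t)\<^sup>2 = (s t * ?u) * ?u" by (simp add: power2_eq_square abs_mult_self_eq)
      also have "\<dots> \<le> (s t * ?u) * (sqrt b * sqrt ?k)"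
        using st by (intro mult_left_mono u) simp
      also have "\<dots> = sqrt b / 2 * (2 * ?u * (sqrt ?k * s t))" by simp
      also have "\<dots> \<le> sqrt b / 2 * (?u\<^sup>2 + (sqrt ?k * s t)\<^sup>2)"
        using sum_squares_bound[of ?u "sqrt ?k * s t"] b by (intro mult_left_mono) auto
      also have "\<dots> = ?R t"
        using k by (simp add: power_mult_distrib)
      finally show ?case .
    qed
    show "AE t in unit_leb. 0 \<le> ?R t"
      using k b by (intro AE_I2) simp
  qed
  also have "\<dots> = sqrt b / 2 * ((\<integral>t. (?h t)\<^sup>2 \<partial>unit_leb) + ?k * (\<integral>t. (s t)\<^sup>2 \<partial>unit_leb))"
    using h_L2 s_L2 by (simp add: square_integrable_def)
  also have "(\<integral>t. (?h t)\<^sup>2 \<partial>unit_leb) = ?k"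
    using L2_norm_combination[OF L, of c] unfolding L2_norm_squared by (simp only: L2_inner_def power2_eq_square)
  also have "(\<integral>t. (s t)\<^sup>2 \<partial>unit_leb) = (L2_norm s)\<^sup>2"
    unfolding L2_norm_squared by (simp only: L2_inner_def power2_eq_square)
  finally show ?thesis by (simp add: algebra_simps add_divide_distrib)
qed

end

section \<open>Deviations of the quadratic and linear terms\<close>

lemma sum_square_eq_diag_plus_cross:
  fixes a :: "nat \<Rightarrow> real"
  shows "(\<Sum>i\<in>{1..n}. a i)\<^sup>2 = (\<Sum>i\<in>{1..n}. (a i)\<^sup>2) + 2 * (\<Sum>i\<in>{1..n}. \<Sum>j\<in>{1..<i}. a i * a j)"
proof (induction n)
  case (Suc n)
  have "{1..<Suc n} = {1..n}" by auto
  then have "(\<Sum>j\<in>{1..<Suc n}. a (Suc n) * a j) = a (Suc n) * (\<Sum>i\<in>{1..n}. a i)"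
    by (simp add: sum_distrib_left)
  with Suc show ?case by (simp add: power2_sum)
qed simp

text \<open>Here \<open>p\<close> and \<open>q\<close> stand for the values of two projections of the density \<open>s\<close> at the same point,
both bounded by \<open>c\<close>. The claim is immediate where \<open>s \<le> 2 * c\<close>. Where \<open>s\<close> is larger, it is so much
larger than its projections that the projection error is at least \<open>s / 2\<close>, and
\<open>s (2 c)\<^sup>2 \<le> 2 c s\<^sup>2\<close>.\<close>

lemma spiky_square_bound:
  fixes s p q c :: real
  assumes "0 \<le> s" "\<bar>p\<bar> \<le> c" "\<bar>q\<bar> \<le> c"
  shows "s * (p - q)\<^sup>2 \<le> 2 * c * (6 * (s - p)\<^sup>2 + 2 * (s - q)\<^sup>2)"
proof (cases "s \<le> 2 * c")
  case True
  have "0 \<le> ((s - p) + (s - q))\<^sup>2" by simp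
  then have "(p - q)\<^sup>2 \<le> 2 * (s - p)\<^sup>2 + 2 * (s - q)\<^sup>2"
    by (simp add: power2_eq_square algebra_simps)
  also have "\<dots> \<le> 6 * (s - p)\<^sup>2 + 2 * (s - q)\<^sup>2" by simp
  finally show ?thesis using True assms(1) by (intro mult_mono) auto
next
  case False
  have c: "0 \<le> c" using assms(2) by linarith
  have "\<bar>p - q\<bar>\<^sup>2 \<le> (2 * c)\<^sup>2" using assms by (intro power_mono) linarith+
  then have "s * (p - q)\<^sup>2 \<le> s * (2 * c)\<^sup>2" using assms(1) by (intro mult_left_mono) auto
  also have "\<dots> = (2 * c) * (s * (2 * c))" by (simp add: power2_eq_square)
  also have "\<dots> \<le> (2 * c) * (s * s)"
    using False assms(1) c by (intro mult_left_mono) auto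
  also have "s * s \<le> 4 * (s - p)\<^sup>2"
  proof -
    have "s \<le> 2 * (s - p)" using False assms(2) abs_ge_self[of p] by argo
    then have "s\<^sup>2 \<le> (2 * (s - p))\<^sup>2" using assms(1) by (intro power_mono) auto
    then show ?thesis by (simp add: power2_eq_square algebra_simps)
  qed
  also have "4 * (s - p)\<^sup>2 \<le> 6 * (s - p)\<^sup>2 + 2 * (s - q)\<^sup>2" by simp
  finally show ?thesis using c by (simp add: mult_left_mono)
qed

context L2_sample
begin

definition sq_bias :: "('l \<Rightarrow> real \<Rightarrow> real) \<Rightarrow> 'l set \<Rightarrow> real" where
  "sq_bias \<phi> L = (L2_norm s)\<^sup>2 - (\<Sum>l\<in>L. (coef \<phi> l)\<^sup>2)"

abbreviation projection :: "('l \<Rightarrow> real \<Rightarrow> real) \<Rightarrow> 'l set \<Rightarrow> real \<Rightarrow> real" where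
  "projection \<phi> L t \<equiv> \<Sum>l\<in>L. coef \<phi> l * \<phi> l t"

lemma projection:
  fixes b c :: real
  assumes m: "regular_model \<phi> L b" and c: "(L2_norm s)\<^sup>2 * b \<le> c\<^sup>2" "0 \<le> c"
  shows "square_integrable (projection \<phi> L)"
    and "phi_model \<phi> L t \<le> b \<Longrightarrow> \<bar>projection \<phi> L t\<bar> \<le> c"
    and "square_integrable (\<lambda>t. s t - projection \<phi> L t)"
    and "(\<integral>t. (s t - projection \<phi> L t)\<^sup>2 \<partial>unit_leb) = sq_bias \<phi> L"
proof -
  have L: "finite L" "orthonormal_family \<phi> L" and b: "0 < b"
    using m by (auto simp: regular_model_def)
  show p: "square_integrable (projection \<phi> L)" by (rule square_integrable_combination[OF L(2)])
  then show "square_integrable (\<lambda>t. s t - projection \<phi> L t)" by (rule square_integrable_diff[OF s_L2])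
  show "\<bar>projection \<phi> L t\<bar> \<le> c" if "phi_model \<phi> L t \<le> b"
  proof -
    have "(projection \<phi> L t)\<^sup>2 \<le> (\<Sum>l\<in>L. (coef \<phi> l)\<^sup>2) * b"
      by (rule combination_bound[OF that less_imp_le[OF b]])
    also have "\<dots> \<le> (L2_norm s)\<^sup>2 * b"
      using bessel_inequality[OF s_L2 L] b by (intro mult_right_mono) auto
    also have "\<dots> \<le> c\<^sup>2" by (rule c)
    finally have "\<bar>projection \<phi> L t\<bar> \<le> \<bar>c\<bar>" by (simp only: abs_le_square_iff)
    then show ?thesis using c by linarith
  qed
  have "(L2_norm (\<lambda>t. s t - projection \<phi> L t))\<^sup>2 = sq_bias \<phi> L"
    unfolding L2_norm_diff_combination[OF s_L2 L] sq_bias_def by simp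
  then show "(\<integral>t. (s t - projection \<phi> L t)\<^sup>2 \<partial>unit_leb) = sq_bias \<phi> L"
    unfolding L2_norm_squared by (simp only: L2_inner_def power2_eq_square)
qed

text \<open>The linear terms of two models have to be compared, and these models need not be nested: the
difference of the two projections lies in a sum of spaces on which no relation between the supremum norm
and the \<open>L\<^sup>2\<close>-norm is available. By \<open>spiky_square_bound\<close>, its variance is nevertheless at most
a multiple of \<open>c\<close> times the sum of the two squared biases.\<close>

lemma projection_difference_tail:
  fixes c a t :: real
  assumes m1: "regular_model \<phi> L b1" and m2: "regular_model \<phi> M b2"
    and c: "(L2_norm s)\<^sup>2 * b1 \<le> c\<^sup>2" "(L2_norm s)\<^sup>2 * b2 \<le> c\<^sup>2" "0 \<le> c"
    and a: "12 * c * (n * (sq_bias \<phi> L + sq_bias \<phi> M)) \<le> a" "16 * c\<^sup>2 \<le> a" "0 < a" and t: "0 < t"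
  defines "h \<equiv> truncated_centering law (regular_points \<phi> L b1 \<inter> regular_points \<phi> M b2)
      (\<lambda>t. projection \<phi> L t - projection \<phi> M t)"
  shows "\<exists>B\<in>sets P. measure P B \<le> moment_const r * a ^ Suc r / t ^ (2 * Suc r)
    \<and> (\<forall>w\<in>space P - B. \<bar>\<Sum>i\<in>{1..n}. h (X i w)\<bar> \<le> t)"
proof -
  let ?R = "\<lambda>t. 2 * c * (6 * (s t - projection \<phi> L t)\<^sup>2 + 2 * (s t - projection \<phi> M t)\<^sup>2)"
  let ?f = "\<lambda>t. projection \<phi> L t - projection \<phi> M t"
  let ?G = "regular_points \<phi> L b1 \<inter> regular_points \<phi> M b2"
  note p1 = projection[OF m1 c(1,3)] and p2 = projection[OF m2 c(2,3)]
  have f_L2: "square_integrable ?f" by (rule square_integrable_diff[OF p1(1) p2(1)])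
  note f = borel_measurable_square_integrable[OF f_L2]
  have G: "?G \<in> sets law" "AE t in law. t \<in> ?G"
    using regular_points[OF m1] regular_points[OF m2] by auto
  have bdd: "\<bar>?f t\<bar> \<le> 2 * c" if "t \<in> ?G" for t
    using p1(2)[of t] p2(2)[of t] that by (simp add: regular_points_def)
  have c2: "0 \<le> 2 * c" using c by simp
  note tc = truncated_centering[OF prob_law G borel_measurable_law[OF f] bdd c2, folded h_def]
  have bias: "0 \<le> sq_bias \<phi> L" "0 \<le> sq_bias \<phi> M"
    unfolding p1(4)[symmetric] p2(4)[symmetric] by simp_all
  have "(\<integral>t. (h t)\<^sup>2 \<partial>law) \<le> (\<integral>t. (?f t)\<^sup>2 \<partial>law)" by (rule tc(6))
  also have "\<dots> = (\<integral>t. s t * (?f t)\<^sup>2 \<partial>unit_leb)"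
    by (rule integral_law[OF borel_measurable_power[OF f]])
  also have "\<dots> \<le> (\<integral>t. ?R t \<partial>unit_leb)"
  proof (rule integral_mono_AE')
    show "integrable unit_leb (\<lambda>t. ?R t)"
      using p1(3) p2(3) unfolding square_integrable_def
      by (intro integrable_mult_right Bochner_Integration.integrable_add) simp_all
    have "AE t in unit_leb. phi_model \<phi> L t \<le> b1" "AE t in unit_leb. phi_model \<phi> M t \<le> b2"
      using m1 m2 by (simp_all add: regular_model_def)
    then show "AE t in unit_leb. s t * (?f t)\<^sup>2
        \<le> ?R t"
      using AE_space
    proof eventually_elim
      case (elim t)
      show ?case
        using elim by (intro spiky_square_bound s_nonneg p1(2) p2(2)) (simp_all add: space_unit_leb)
    qed
    show "AE t in unit_leb. 0 \<le> ?R t"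
      using c by (intro AE_I2) simp
  qed
  also have "\<dots> = 2 * c * (6 * sq_bias \<phi> L + 2 * sq_bias \<phi> M)"
    using p1(3,4) p2(3,4) unfolding square_integrable_def by simp
  also have "\<dots> \<le> 12 * c * (sq_bias \<phi> L + sq_bias \<phi> M)"
    using bias mult_nonneg_nonneg[OF c(3) bias(2)] by (simp add: algebra_simps)
  finally have var: "(\<integral>t. (h t)\<^sup>2 \<partial>law) \<le> 12 * c * (sq_bias \<phi> L + sq_bias \<phi> M)" .
  have h_bdd: "\<bar>h t\<bar> \<le> 4 * c" for t using tc(4)[of t] by simp
  have mom: "integrable (PiM {1..n} (\<lambda>_. law)) (\<lambda>x. (\<Sum>i\<in>{1..n}. h (x i)) ^ (2 * Suc r)) \<and>
    (\<integral>x. (\<Sum>i\<in>{1..n}. h (x i)) ^ (2 * Suc r) \<partial>PiM {1..n} (\<lambda>_. law)) \<le> moment_const r * a ^ Suc r"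
    using a c by (intro sum_moment[OF prob_law tc(3) h_bdd tc(5) var])
      (simp_all add: power_mult_distrib mult_ac)
  from moment_tail[OF iid_sample_law(2,3)[OF iid n_pos] mom t]
  have "\<exists>B\<in>sets P. measure P B \<le> moment_const r * a ^ Suc r / t ^ (2 * Suc r)
    \<and> (\<forall>w\<in>space P - B. \<bar>\<Sum>i\<in>{1..n}. h ((\<lambda>i\<in>{1..n}. X i w) i)\<bar> \<le> t)" .
  moreover have "(\<Sum>i\<in>{1..n}. h ((\<lambda>i\<in>{1..n}. X i w) i)) = (\<Sum>i\<in>{1..n}. h (X i w))" for w
    by (intro sum.cong refl) simp
  ultimately show ?thesis by simp
qed

text \<open>The squared norm of the vector of empirical scores splits into a diagonal part, which is a sum of
independent variables, and twice a degenerate U-statistic of order two.\<close>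

lemma model_tail:
  fixes c w a t :: real
  assumes m: "regular_model \<phi> L b" and D: "card L \<le> n" and L_ne: "L \<noteq> {}"
    and c: "2 * (b + (L2_norm s)\<^sup>2) \<le> c" and w: "sqrt b * (1 + (L2_norm s)\<^sup>2) / 2 \<le> w"
    and a: "2 * w * c \<le> a" "4 * c\<^sup>2 \<le> n * a" and t: "0 < t"
  defines "V \<equiv> \<integral>y. (\<Sum>l\<in>L. (score \<phi> L b l y)\<^sup>2) \<partial>law"
  shows "\<exists>B\<in>sets P. measure P B \<le> ((moment_const r)\<^sup>2 + moment_const r) * a ^ Suc r / t ^ (2 * Suc r)
    \<and> (\<forall>w\<in>space P - B. \<bar>(\<Sum>l\<in>L. \<Sum>i\<in>{1..n}. (score \<phi> L b l (X i w))\<^sup>2) / n - V\<bar> \<le> t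
      \<and> \<bar>((\<Sum>l\<in>L. (\<Sum>i\<in>{1..n}. score \<phi> L b l (X i w))\<^sup>2)
           - (\<Sum>l\<in>L. \<Sum>i\<in>{1..n}. (score \<phi> L b l (X i w))\<^sup>2)) / n\<bar> \<le> 2 * t)"
proof -
  let ?g = "score \<phi> L b"
  let ?Q = "\<lambda>w. \<Sum>l\<in>L. \<Sum>i\<in>{1..n}. (?g l (X i w))\<^sup>2"
  let ?F = "\<lambda>w. \<Sum>l\<in>L. (\<Sum>i\<in>{1..n}. ?g l (X i w))\<^sup>2"
  have L: "finite L" and b: "0 < b" using m by (auto simp: regular_model_def)
  have n0: "0 < real n" using n_pos by simp
  have c0: "0 < c" using c b by (intro less_le_trans[OF _ c]) (simp add: add_pos_nonneg)
  have w0: "0 < w" using b by (intro less_le_trans[OF _ w]) (simp add: add_pos_nonneg)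
  have a0: "0 < a" using mult_pos_pos[OF w0 c0] a(1) by linarith
  have bdd: "(\<Sum>l\<in>L. (?g l y)\<^sup>2) \<le> c" for y using score_bound[OF m, of y] c by linarith
  have g_meas: "?g l \<in> borel_measurable law" if "l \<in> L" for l by (rule score(1)[OF m that])
  have weak: "(\<integral>y. (\<Sum>l\<in>L. d l * ?g l y)\<^sup>2 \<partial>law) \<le> w * (\<Sum>l\<in>L. (d l)\<^sup>2)" for d
    by (rule order_trans[OF score_weak_variance[OF m] mult_right_mono[OF w]]) (simp add: sum_nonneg)
  interpret law: prob_space law by (rule prob_law)
  let ?h = "\<lambda>y. \<Sum>l\<in>L. (?g l y)\<^sup>2"
  have h_meas: "?h \<in> borel_measurable law"
    by (intro borel_measurable_sum borel_measurable_power g_meas)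
  have h0: "0 \<le> ?h y" for y by (intro sum_nonneg) simp
  have g2_int: "integrable law (\<lambda>y. (?g l y)\<^sup>2)" if "l \<in> L" for l
  proof (rule law.integrable_const_bound)
    show "AE y in law. norm ((?g l y)\<^sup>2) \<le> c"
      using member_le_sum[of l L "\<lambda>l. (?g l y)\<^sup>2" for y] that L bdd by (intro AE_I2) (fastforce intro: order_trans)
    show "(\<lambda>y. (?g l y)\<^sup>2) \<in> borel_measurable law"
      by (rule borel_measurable_power[OF g_meas[OF that]])
  qed
  have V_eq: "V = (\<Sum>l\<in>L. \<integral>y. (?g l y)\<^sup>2 \<partial>law)"
    unfolding V_def by (rule Bochner_Integration.integral_sum[OF g2_int])
  have "V \<le> (\<integral>y. c \<partial>law)"
    unfolding V_def
    by (rule integral_mono[OF Bochner_Integration.integrable_sum[OF g2_int] law.integrable_const bdd])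
  then have V_le: "V \<le> c" by (simp add: law.prob_space[unfolded space_sample_law])
  have mc: "0 \<le> moment_const r" by (simp add: moment_const_def)
  let ?A = "\<lambda>x. \<Sum>i\<in>{1..n}. \<Sum>j\<in>{1..<i}. \<Sum>l\<in>L. ?g l (x i) * ?g l (x j)"
  let ?N = "PiM {1..n} (\<lambda>_. law)"
  have scale_a: "0 < (real n)\<^sup>2 * a" using n0 a0 by simp
  \<comment> \<open>The total variance is at most \<open>c\<close>, and the dimension at most \<open>n\<close>.\<close>
  have T: "(\<Sum>l\<in>L. real n * (\<integral>y. (?g l y)\<^sup>2 \<partial>law) + c) \<le> 2 * n * c"
  proof -
    have "(\<Sum>l\<in>L. real n * (\<integral>y. (?g l y)\<^sup>2 \<partial>law) + c) = real n * V + real (card L) * c"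
      by (simp only: V_eq sum.distrib sum_distrib_left sum_constant)
    also have "\<dots> \<le> real n * c + real n * c"
      using V_le D c0 by (intro add_mono mult_left_mono mult_right_mono) auto
    finally show ?thesis by (simp add: mult_ac)
  qed
  have "integrable ?N (\<lambda>x. ?A x ^ (2 * Suc r)) \<and>
      (\<integral>x. ?A x ^ (2 * Suc r) \<partial>?N) \<le> (moment_const r)\<^sup>2 * ((real n)\<^sup>2 * a) ^ Suc r"
  proof (rule ustat_moment[OF prob_law L g_meas bdd c0 score(3)[OF m] weak less_imp_le[OF w0] T _ _ _ scale_a])
    have "(real n)\<^sup>2 * (2 * w * c) \<le> (real n)\<^sup>2 * a" using a(1) by (intro mult_left_mono) auto
    then show "real n * w * (2 * n * c) \<le> (real n)\<^sup>2 * a" by (simp add: power2_eq_square mult_ac)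
    have "0 \<le> c\<^sup>2" by simp
    with a(2) have "2 * c\<^sup>2 \<le> n * a" by linarith
    then have "real n * (2 * c\<^sup>2) \<le> real n * (n * a)" by (intro mult_left_mono) auto
    then show "c * (2 * n * c) \<le> (real n)\<^sup>2 * a" by (simp add: power2_eq_square mult_ac)
    show "0 < 2 * n * c" using n0 c0 by simp
  qed
  from moment_tail[OF iid_sample_law(2,3)[OF iid n_pos] this, of "n * t"]
  obtain B1 where B1: "B1 \<in> sets P"
      "measure P B1 \<le> (moment_const r)\<^sup>2 * ((real n)\<^sup>2 * a) ^ Suc r / (n * t) ^ (2 * Suc r)"
      "\<And>w. w \<in> space P - B1 \<Longrightarrow> \<bar>?A (\<lambda>i\<in>{1..n}. X i w)\<bar> \<le> n * t"
    using t n0 by (meson mult_pos_pos)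
  \<comment> \<open>The scores are bounded everywhere, so the sum of their squares can be centred without cutting off.\<close>
  let ?k = "truncated_centering law (space law) ?h"
  note tc = truncated_centering[OF prob_law sets.top AE_space h_meas, of c]
  have h_abs: "\<bar>?h y\<bar> \<le> c" for y using h0[of y] bdd[of y] by simp
  have k_var: "(\<integral>y. (?k y)\<^sup>2 \<partial>law) \<le> c\<^sup>2"
  proof -
    have "(\<integral>y. (?k y)\<^sup>2 \<partial>law) \<le> (\<integral>y. (?h y)\<^sup>2 \<partial>law)"
      by (rule tc(6)[OF h_abs less_imp_le[OF c0]])
    also have "\<dots> \<le> (\<integral>y. c\<^sup>2 \<partial>law)"
      using h0 bdd by (intro integral_mono tc(2)[OF h_abs less_imp_le[OF c0]] power_mono) auto
    finally show ?thesis by (simp add: law.prob_space[unfolded space_sample_law])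
  qed
  have k_abs: "\<bar>?k y\<bar> \<le> 2 * c" for y by (rule tc(4)[OF h_abs less_imp_le[OF c0]])
  have "integrable ?N (\<lambda>x. (\<Sum>i\<in>{1..n}. ?k (x i)) ^ (2 * Suc r)) \<and>
      (\<integral>x. (\<Sum>i\<in>{1..n}. ?k (x i)) ^ (2 * Suc r) \<partial>?N) \<le> moment_const r * ((real n)\<^sup>2 * a) ^ Suc r"
  proof (rule sum_moment[OF prob_law tc(3)[OF h_abs less_imp_le[OF c0]] k_abs
        tc(5)[OF h_abs less_imp_le[OF c0]] k_var _ _ scale_a])
    have le: "4 * real n * c\<^sup>2 \<le> (real n)\<^sup>2 * a"
      using mult_left_mono[OF a(2), of "real n"] by (simp add: power2_eq_square mult_ac)
    then show "real n * c\<^sup>2 \<le> (real n)\<^sup>2 * a"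
    proof -
      have "0 \<le> real n * c\<^sup>2" by simp
      with le show ?thesis by linarith
    qed
    have "1 * (4 * c\<^sup>2) \<le> real n * (4 * c\<^sup>2)" using n_pos by (intro mult_right_mono) auto
    with le show "(2 * c)\<^sup>2 \<le> (real n)\<^sup>2 * a" by (simp add: power_mult_distrib)
  qed
  from moment_tail[OF iid_sample_law(2,3)[OF iid n_pos] this, of "n * t"]
  obtain B2 where B2: "B2 \<in> sets P"
      "measure P B2 \<le> moment_const r * ((real n)\<^sup>2 * a) ^ Suc r / (n * t) ^ (2 * Suc r)"
      "\<And>w. w \<in> space P - B2 \<Longrightarrow> \<bar>\<Sum>i\<in>{1..n}. ?k ((\<lambda>i\<in>{1..n}. X i w) i)\<bar> \<le> n * t"
    using t n0 by (meson mult_pos_pos)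
  have scale_eq: "((real n)\<^sup>2 * a) ^ Suc r / (n * t) ^ (2 * Suc r) = a ^ Suc r / t ^ (2 * Suc r)"
    unfolding power_mult[of _ 2 "Suc r"] power_mult_distrib using n0 by (simp del: power_Suc)
  show ?thesis
  proof (intro bexI[of _ "B1 \<union> B2"] conjI ballI)
    show "B1 \<union> B2 \<in> sets P" using B1 B2 by blast
    interpret P: prob_space P by (rule prob_P)
    have "measure P (B1 \<union> B2) \<le> measure P B1 + measure P B2"
      by (rule measure_Un_le[OF B1(1) B2(1)])
    also have "\<dots> \<le> (moment_const r)\<^sup>2 * (a ^ Suc r / t ^ (2 * Suc r)) + moment_const r * (a ^ Suc r / t ^ (2 * Suc r))"
      using B1(2) B2(2) unfolding times_divide_eq_right[symmetric] scale_eq by (rule add_mono)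
    finally show "measure P (B1 \<union> B2) \<le> ((moment_const r)\<^sup>2 + moment_const r) * a ^ Suc r / t ^ (2 * Suc r)"
      by (simp only: distrib_right add_divide_distrib times_divide_eq_right)
  next
    fix w assume "w \<in> space P - (B1 \<union> B2)"
    then have w: "w \<in> space P - B1" "w \<in> space P - B2" by auto
    have "(\<Sum>i\<in>{1..n}. ?k ((\<lambda>i\<in>{1..n}. X i w) i)) = (\<Sum>i\<in>{1..n}. ?h (X i w) - V)"
    proof (intro sum.cong refl)
      fix i assume i: "i \<in> {1..n}"
      have "X i w \<in> space law"
        using measurable_space[OF iid_sample_law(4)[OF iid n_pos i], of w] w by simp
      then show "?k ((\<lambda>i\<in>{1..n}. X i w) i) = ?h (X i w) - V"
        using i by (simp only: restrict_apply if_True truncated_centering_def V_def)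
    qed
    also have "\<dots> = ?Q w - n * V"
      by (subst sum.swap) (simp add: sum_subtractf)
    finally have "\<bar>?Q w - n * V\<bar> \<le> n * t"
      using B2(3)[OF w(2)] by simp
    then have "\<bar>?Q w - n * V\<bar> / n \<le> t"
      using n0 by (simp add: field_simps)
    also have "\<bar>?Q w - n * V\<bar> / n
        = \<bar>(?Q w - n * V) / n\<bar>"
      using n0 by simp
    also have "(?Q w - n * V) / n
        = ?Q w / n - V"
      using n0 by (simp add: diff_divide_distrib)
    finally show "\<bar>?Q w / n - V\<bar> \<le> t" .
    have "?F w - ?Q w
        = 2 * (\<Sum>l\<in>L. \<Sum>i\<in>{1..n}. \<Sum>j\<in>{1..<i}. ?g l (X i w) * ?g l (X j w))"
      unfolding sum_square_eq_diag_plus_cross sum.distrib sum_distrib_left[symmetric] by simp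
    also have "(\<Sum>l\<in>L. \<Sum>i\<in>{1..n}. \<Sum>j\<in>{1..<i}. ?g l (X i w) * ?g l (X j w))
        = (\<Sum>i\<in>{1..n}. \<Sum>j\<in>{1..<i}. \<Sum>l\<in>L. ?g l (X i w) * ?g l (X j w))"
      by (subst sum.swap, rule sum.cong[OF refl], rule sum.swap)
    also have "\<dots> = ?A (\<lambda>i\<in>{1..n}. X i w)"
      by (intro sum.cong refl) auto
    finally have eq: "?F w - ?Q w
        = 2 * ?A (\<lambda>i\<in>{1..n}. X i w)" .
    have "\<bar>2 * ?A (\<lambda>i\<in>{1..n}. X i w) / n\<bar> = 2 * \<bar>?A (\<lambda>i\<in>{1..n}. X i w)\<bar> / n"
      by (simp only: abs_divide abs_mult abs_numeral abs_of_nat)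
    also have "\<dots> \<le> 2 * (n * t) / n"
      using B1(3)[OF w(1)] n0 by (intro divide_right_mono mult_left_mono) simp_all
    also have "\<dots> = 2 * t" using n0 by simp
    finally show "\<bar>(?F w - ?Q w) / n\<bar> \<le> 2 * t"
      unfolding eq .
  qed
qed

end

section \<open>Simultaneous control of two models\<close>

text \<open>The sum of the constants in the scale conditions of \<open>model_tail\<close> and \<open>projection_difference_tail\<close>, with
\<open>\<Phi>\<close> the regularity constant of the models and \<open>\<sigma>\<close> the squared norm of the density; the summand
\<open>1\<close> makes positivity evident.\<close>

definition deviation_const :: "real \<Rightarrow> real \<Rightarrow> real" where
  "deviation_const \<Phi> \<sigma> = 2 * sqrt \<Phi> * (1 + \<sigma>) * (\<Phi> + \<sigma>) + 16 * (\<Phi> + \<sigma>)\<^sup>2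
     + 12 * sqrt (\<sigma> * \<Phi>) + 16 * (\<sigma> * \<Phi>) + 1"

lemma deviation_const_ge:
  assumes "0 < \<Phi>" "0 \<le> \<sigma>"
  shows "2 * sqrt \<Phi> * (1 + \<sigma>) * (\<Phi> + \<sigma>) \<le> deviation_const \<Phi> \<sigma>"
    and "16 * (\<Phi> + \<sigma>)\<^sup>2 \<le> deviation_const \<Phi> \<sigma>"
    and "12 * sqrt (\<sigma> * \<Phi>) \<le> deviation_const \<Phi> \<sigma>"
    and "16 * (\<sigma> * \<Phi>) \<le> deviation_const \<Phi> \<sigma>"
    and "1 \<le> deviation_const \<Phi> \<sigma>"
proof -
  have "0 \<le> 2 * sqrt \<Phi> * (1 + \<sigma>) * (\<Phi> + \<sigma>)" "0 \<le> 16 * (\<Phi> + \<sigma>)\<^sup>2"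
    "0 \<le> 12 * sqrt (\<sigma> * \<Phi>)" "0 \<le> 16 * (\<sigma> * \<Phi>)"
    using assms by simp_all
  then show "2 * sqrt \<Phi> * (1 + \<sigma>) * (\<Phi> + \<sigma>) \<le> deviation_const \<Phi> \<sigma>"
    "16 * (\<Phi> + \<sigma>)\<^sup>2 \<le> deviation_const \<Phi> \<sigma>"
    "12 * sqrt (\<sigma> * \<Phi>) \<le> deviation_const \<Phi> \<sigma>"
    "16 * (\<sigma> * \<Phi>) \<le> deviation_const \<Phi> \<sigma>"
    "1 \<le> deviation_const \<Phi> \<sigma>"
    unfolding deviation_const_def by linarith+
qed

context L2_sample
begin

text \<open>The terms \<open>Q\<close>, \<open>Y\<close> and \<open>l\<close> of the overview are \<open>diag_dev / n\<close>, \<open>(full_dev - diag_dev) / n\<close>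
and \<open>lin_dev\<close>.\<close>

definition diag_dev :: "('l \<Rightarrow> real \<Rightarrow> real) \<Rightarrow> 'l set \<Rightarrow> 'a \<Rightarrow> real" where
  "diag_dev \<phi> L w = (\<Sum>l\<in>L. \<Sum>i\<in>{1..n}. (\<phi> l (X i w) - coef \<phi> l)\<^sup>2)"

definition full_dev :: "('l \<Rightarrow> real \<Rightarrow> real) \<Rightarrow> 'l set \<Rightarrow> 'a \<Rightarrow> real" where
  "full_dev \<phi> L w = (\<Sum>l\<in>L. (\<Sum>i\<in>{1..n}. \<phi> l (X i w) - coef \<phi> l)\<^sup>2)"

definition lin_dev :: "('l \<Rightarrow> real \<Rightarrow> real) \<Rightarrow> 'l set \<Rightarrow> 'a \<Rightarrow> real" where
  "lin_dev \<phi> L w = (\<Sum>l\<in>L. coef \<phi> l * (\<Sum>i\<in>{1..n}. \<phi> l (X i w) - coef \<phi> l))"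

definition model_variance :: "('l \<Rightarrow> real \<Rightarrow> real) \<Rightarrow> 'l set \<Rightarrow> real \<Rightarrow> real" where
  "model_variance \<phi> L b = (\<integral>y. (\<Sum>l\<in>L. (score \<phi> L b l y)\<^sup>2) \<partial>law)"

lemma AE_sample:
  assumes "AE t in law. Q t"
  shows "AE w in P. \<forall>i\<in>{1..n}. Q (X i w)"
proof (rule AE_finite_allI)
  fix i assume i: "i \<in> {1..n}"
  have "AE t in distr P unit_leb (X i). Q t"
    using assms by (simp only: iid_sample_law(5)[OF iid n_pos i])
  then show "AE w in P. Q (X i w)"
    by (rule AE_distrD[OF iid_sample_law(4)[OF iid n_pos i]])
qed simp

lemma full_dev_score:
  assumes m: "regular_model \<phi> L b" and w: "\<forall>i\<in>{1..n}. X i w \<in> regular_points \<phi> L b"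
  shows "full_dev \<phi> L w = (\<Sum>l\<in>L. (\<Sum>i\<in>{1..n}. score \<phi> L b l (X i w))\<^sup>2)"
    and "diag_dev \<phi> L w = (\<Sum>l\<in>L. \<Sum>i\<in>{1..n}. (score \<phi> L b l (X i w))\<^sup>2)"
proof -
  have eq: "\<phi> l (X i w) - coef \<phi> l = score \<phi> L b l (X i w)" if "l \<in> L" "i \<in> {1..n}" for l i
    using score(5)[OF m that(1), of "X i w"] w that(2) by simp
  show "full_dev \<phi> L w = (\<Sum>l\<in>L. (\<Sum>i\<in>{1..n}. score \<phi> L b l (X i w))\<^sup>2)"
    unfolding full_dev_def by (intro sum.cong refl arg_cong[where f = "\<lambda>x. x\<^sup>2"] eq)
  show "diag_dev \<phi> L w = (\<Sum>l\<in>L. \<Sum>i\<in>{1..n}. (score \<phi> L b l (X i w))\<^sup>2)"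
    unfolding diag_dev_def by (intro sum.cong refl arg_cong[where f = "\<lambda>x. x\<^sup>2"] eq)
qed

lemma lin_dev_difference:
  assumes m1: "regular_model \<phi> L b1" and m2: "regular_model \<phi> M b2"
    and w: "\<forall>i\<in>{1..n}. X i w \<in> regular_points \<phi> L b1 \<inter> regular_points \<phi> M b2"
  shows "lin_dev \<phi> L w - lin_dev \<phi> M w = (\<Sum>i\<in>{1..n}. truncated_centering law
      (regular_points \<phi> L b1 \<inter> regular_points \<phi> M b2) (\<lambda>t. projection \<phi> L t - projection \<phi> M t) (X i w))"
proof -
  let ?b = "\<lambda>l. coef \<phi> l"
  have int: "integrable law (projection \<phi> K)"
    and mean: "(\<integral>t. projection \<phi> K t \<partial>law) = (\<Sum>l\<in>K. (?b l)\<^sup>2)"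
    if m: "regular_model \<phi> K b" for K b
  proof -
    show "integrable law (projection \<phi> K)"
      by (intro Bochner_Integration.integrable_sum integrable_mult_right score(2)[OF m])
    have "(\<integral>t. projection \<phi> K t \<partial>law) = (\<Sum>l\<in>K. \<integral>t. ?b l * \<phi> l t \<partial>law)"
      by (rule Bochner_Integration.integral_sum) (rule integrable_mult_right[OF score(2)[OF m]])
    also have "\<dots> = (\<Sum>l\<in>K. (?b l)\<^sup>2)"
      by (intro sum.cong refl) (simp add: score(4)[OF m] power2_eq_square)
    finally show "(\<integral>t. projection \<phi> K t \<partial>law) = (\<Sum>l\<in>K. (?b l)\<^sup>2)" .
  qed
  have lin: "lin_dev \<phi> K w = (\<Sum>i\<in>{1..n}. projection \<phi> K (X i w)) - n * (\<Sum>l\<in>K. (?b l)\<^sup>2)" for K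
  proof -
    have "lin_dev \<phi> K w = (\<Sum>l\<in>K. (\<Sum>i\<in>{1..n}. ?b l * \<phi> l (X i w)) - n * (?b l)\<^sup>2)"
      unfolding lin_dev_def sum_distrib_left right_diff_distrib sum_subtractf
      by (simp add: sum_distrib_left power2_eq_square mult_ac)
    also have "\<dots> = (\<Sum>l\<in>K. \<Sum>i\<in>{1..n}. ?b l * \<phi> l (X i w)) - n * (\<Sum>l\<in>K. (?b l)\<^sup>2)"
      by (simp only: sum_subtractf sum_distrib_left)
    also have "(\<Sum>l\<in>K. \<Sum>i\<in>{1..n}. ?b l * \<phi> l (X i w)) = (\<Sum>i\<in>{1..n}. projection \<phi> K (X i w))"
      by (rule sum.swap)
    finally show ?thesis .
  qed
  have "(\<integral>t. projection \<phi> L t - projection \<phi> M t \<partial>law)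
      = (\<Sum>l\<in>L. (?b l)\<^sup>2) - (\<Sum>l\<in>M. (?b l)\<^sup>2)"
    by (simp only: Bochner_Integration.integral_diff[OF int[OF m1] int[OF m2]] mean[OF m1] mean[OF m2])
  then have "(\<Sum>i\<in>{1..n}. truncated_centering law
      (regular_points \<phi> L b1 \<inter> regular_points \<phi> M b2) (\<lambda>t. projection \<phi> L t - projection \<phi> M t) (X i w))
    = (\<Sum>i\<in>{1..n}. projection \<phi> L (X i w) - projection \<phi> M (X i w)
        - ((\<Sum>l\<in>L. (?b l)\<^sup>2) - (\<Sum>l\<in>M. (?b l)\<^sup>2)))"
    using w by (intro sum.cong refl) (simp add: truncated_centering_def)
  also have "\<dots> = (\<Sum>i\<in>{1..n}. projection \<phi> L (X i w)) - (\<Sum>i\<in>{1..n}. projection \<phi> M (X i w))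
      - n * ((\<Sum>l\<in>L. (?b l)\<^sup>2) - (\<Sum>l\<in>M. (?b l)\<^sup>2))"
    by (simp only: sum_subtractf sum_constant card_atLeastAtMost diff_Suc_1 add_diff_cancel_right'
        right_diff_distrib)
  finally show ?thesis unfolding lin right_diff_distrib by simp
qed

text \<open>Since \<open>\<parallel>s\<^sub>m - estimator\<parallel>\<^sup>2\<close> has mean \<open>model_variance / n\<close>, a lower bound on the mean of
the norm itself gives a lower bound on the variance. Instead of Jensen's inequality,
\<open>2 * sqrt Y \<le> Y / h + h\<close> is used with the optimal \<open>h\<close>, which does not require the integrability of \<open>sqrt Y\<close>.\<close>

lemma variance_lower_bound:
  assumes m: "regular_model \<phi> L b" and D: "0 < card L" and \<xi>: "0 < \<xi>"
    and low: "sqrt \<xi> \<le> sqrt n * (\<integral>w. L2_norm (\<lambda>t. orth_proj (model_space \<phi> L) s t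
         - proj_est \<phi> L {1..n} (\<lambda>i. X i w) t) \<partial>P) / sqrt (card L)"
  shows "\<xi> * card L \<le> model_variance \<phi> L b"
proof -
  let ?err = "\<lambda>w. L2_norm (\<lambda>t. orth_proj (model_space \<phi> L) s t - proj_est \<phi> L {1..n} (\<lambda>i. X i w) t)"
  have L: "finite L" "orthonormal_family \<phi> L" and b: "0 < b"
    using m by (auto simp: regular_model_def)
  have n0: "0 < real n" using n_pos by simp
  let ?g = "score \<phi> L b"
  let ?Y = "\<lambda>w. \<Sum>l\<in>L. (\<Sum>i\<in>{1..n}. ?g l (X i w))\<^sup>2"
  let ?I = "\<integral>w. ?err w \<partial>P"
  have norm_eq: "?err w
      = sqrt (full_dev \<phi> L w) / n" for w
  proof -
    let ?c = "\<lambda>l. - (\<Sum>i\<in>{1..n}. \<phi> l (X i w) - coef \<phi> l) / n"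
    have "orth_proj (model_space \<phi> L) s t - proj_est \<phi> L {1..n} (\<lambda>i. X i w) t = (\<Sum>l\<in>L. ?c l * \<phi> l t)" for t
      unfolding orth_proj_eq[OF s_L2 L] proj_est_def sum_subtractf[symmetric] using n0
      by (intro sum.cong refl) (simp add: sum_subtractf field_simps)
    then have "(?err w)\<^sup>2
        = (\<Sum>l\<in>L. (?c l)\<^sup>2)"
      using L2_norm_combination[OF L, of ?c] by simp
    also have "\<dots> = full_dev \<phi> L w / (real n)\<^sup>2"
      by (simp only: full_dev_def power_divide power2_minus sum_divide_distrib)
    finally have "sqrt ((?err w)\<^sup>2)
        = sqrt (full_dev \<phi> L w / (real n)\<^sup>2)" by simp
    moreover have "0 \<le> L2_norm f" for f by (simp add: L2_norm_def L2_inner_def)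
    ultimately show ?thesis using n0 by (simp add: real_sqrt_divide)
  qed
  interpret P: prob_space P by (rule prob_P)
  have g_abs: "\<bar>?g l y\<bar> \<le> sqrt (2 * (b + (L2_norm s)\<^sup>2))" if "l \<in> L" for l y
  proof -
    have "(?g l y)\<^sup>2 \<le> (\<Sum>l\<in>L. (?g l y)\<^sup>2)" using that L by (intro member_le_sum) auto
    then show ?thesis using score_bound[OF m, of y] by (intro real_le_rsqrt) simp
  qed
  let ?T = "\<lambda>w. \<lambda>i\<in>{1..n}. X i w"
  have restrict: "(\<Sum>i\<in>{1..n}. ?g l (?T w i)) = (\<Sum>i\<in>{1..n}. ?g l (X i w))" for l w
    by (intro sum.cong refl) simp
  have Yl_int: "integrable P (\<lambda>w. (\<Sum>i\<in>{1..n}. ?g l (X i w))\<^sup>2)"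
    and Yl_eq: "(\<integral>w. (\<Sum>i\<in>{1..n}. ?g l (X i w))\<^sup>2 \<partial>P) = n * (\<integral>y. (?g l y)\<^sup>2 \<partial>law)"
    if l: "l \<in> L" for l
  proof -
    let ?F = "\<lambda>x. (\<Sum>i\<in>{1..n}. ?g l (x i))\<^sup>2"
    let ?N = "PiM {1..n} (\<lambda>_. law)"
    have F: "integrable ?N ?F" "(\<integral>x. ?F x \<partial>?N) = n * (\<integral>y. (?g l y)\<^sup>2 \<partial>law)"
      using sum_second_moment[OF prob_law score(1)[OF m l] g_abs[OF l] score(3)[OF m l], of n] by auto
    have "integrable P (\<lambda>w. ?F (?T w))"
      using F(1) integrable_distr[OF iid_sample_law(2)[OF iid n_pos], of ?F]
      by (simp only: iid_sample_law(3)[OF iid n_pos])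
    then show "integrable P (\<lambda>w. (\<Sum>i\<in>{1..n}. ?g l (X i w))\<^sup>2)" by (simp only: restrict)
    have "(\<integral>w. ?F (?T w) \<partial>P) = (\<integral>x. ?F x \<partial>?N)"
      using integral_distr[OF iid_sample_law(2)[OF iid n_pos] borel_measurable_integrable[OF F(1)]]
      by (simp only: iid_sample_law(3)[OF iid n_pos])
    then show "(\<integral>w. (\<Sum>i\<in>{1..n}. ?g l (X i w))\<^sup>2 \<partial>P) = n * (\<integral>y. (?g l y)\<^sup>2 \<partial>law)"
      by (simp only: restrict F(2))
  qed
  interpret law: prob_space law by (rule prob_law)
  have g2_int: "integrable law (\<lambda>y. (?g l y)\<^sup>2)" if "l \<in> L" for l
  proof (rule law.integrable_const_bound)
    show "AE y in law. norm ((?g l y)\<^sup>2) \<le> (sqrt (2 * (b + (L2_norm s)\<^sup>2)))\<^sup>2"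
      using power_mono[OF g_abs[OF that] abs_ge_zero, where n = 2] by (intro AE_I2) simp
    show "(\<lambda>y. (?g l y)\<^sup>2) \<in> borel_measurable law"
      by (rule borel_measurable_power[OF score(1)[OF m that]])
  qed
  have V_eq: "model_variance \<phi> L b = (\<Sum>l\<in>L. \<integral>y. (?g l y)\<^sup>2 \<partial>law)"
    unfolding model_variance_def by (rule Bochner_Integration.integral_sum[OF g2_int])
  have Y_int: "integrable P ?Y" by (rule Bochner_Integration.integrable_sum[OF Yl_int])
  have Y_eq: "(\<integral>w. ?Y w \<partial>P) = n * model_variance \<phi> L b"
  proof -
    have "(\<integral>w. ?Y w \<partial>P) = (\<Sum>l\<in>L. \<integral>w. (\<Sum>i\<in>{1..n}. ?g l (X i w))\<^sup>2 \<partial>P)"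
      by (rule Bochner_Integration.integral_sum[OF Yl_int])
    also have "\<dots> = (\<Sum>l\<in>L. n * (\<integral>y. (?g l y)\<^sup>2 \<partial>law))"
      by (intro sum.cong refl Yl_eq)
    finally show ?thesis by (simp only: V_eq sum_distrib_left)
  qed
  have ae: "AE w in P. full_dev \<phi> L w = ?Y w"
    using AE_sample[OF regular_points(2)[OF m]] by eventually_elim (rule full_dev_score(1)[OF m])
  define h where "h = sqrt (\<xi> * n * card L)"
  have h: "0 < h" using \<xi> n0 D by (simp add: h_def)
  have h_sq: "h\<^sup>2 = \<xi> * n * card L" using \<xi> n0 by (simp add: h_def)
  have "?I \<le> (\<integral>w. (?Y w / h + h) / (2 * n) \<partial>P)"
  proof (rule integral_mono_AE')
    show "integrable P (\<lambda>w. (?Y w / h + h) / (2 * n))"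
      by (intro integrable_divide Bochner_Integration.integrable_add Y_int P.integrable_const)
    show "AE w in P. ?err w
        \<le> (?Y w / h + h) / (2 * n)"
      using ae
    proof eventually_elim
      case (elim w)
      have Y0: "0 \<le> ?Y w" by (intro sum_nonneg) simp
      have "2 * sqrt (?Y w) * h \<le> (sqrt (?Y w))\<^sup>2 + h\<^sup>2" by (rule sum_squares_bound)
      then have "2 * sqrt (?Y w) * h \<le> ?Y w + h\<^sup>2" using Y0 by simp
      then have "2 * sqrt (?Y w) \<le> ?Y w / h + h"
        using h by (simp add: field_simps power2_eq_square)
      then have "2 * sqrt (?Y w) / (2 * n) \<le> (?Y w / h + h) / (2 * n)"
        using n0 by (intro divide_right_mono) auto
      then show ?case unfolding norm_eq elim by simp
    qed
    show "AE w in P. 0 \<le> (?Y w / h + h) / (2 * n)"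
      using h by (intro AE_I2 divide_nonneg_nonneg add_nonneg_nonneg sum_nonneg) auto
  qed
  also have "\<dots> = (n * model_variance \<phi> L b / h + h) / (2 * n)"
    using Y_int Y_eq by (simp add: P.prob_space)
  finally have I: "?I \<le> (n * model_variance \<phi> L b / h + h) / (2 * n)" .
  have "sqrt \<xi> * sqrt (card L) \<le> sqrt n * ?I"
    using low D by (simp add: field_simps)
  then have "sqrt n * (sqrt \<xi> * sqrt (card L)) \<le> sqrt n * (sqrt n * ?I)"
    by (intro mult_left_mono) auto
  also have "\<dots> = n * ?I"
    by (simp only: mult.assoc[symmetric] real_sqrt_mult_self abs_of_nat)
  also have "sqrt n * (sqrt \<xi> * sqrt (card L)) = h"
    by (simp add: h_def real_sqrt_mult)
  finally have "h \<le> n * ?I" .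
  also have "\<dots> \<le> n * ((n * model_variance \<phi> L b / h + h) / (2 * n))"
    using I n0 by (intro mult_left_mono) auto
  also have "\<dots> = (n * model_variance \<phi> L b / h + h) / 2"
    using n0 by simp
  finally have "h \<le> n * model_variance \<phi> L b / h" by simp
  then have "h\<^sup>2 \<le> n * model_variance \<phi> L b"
    using h by (simp add: field_simps power2_eq_square)
  then have "n * (\<xi> * card L) \<le> n * model_variance \<phi> L b"
    unfolding h_sq by (simp add: mult_ac)
  then show ?thesis using n0 by simp
qed

text \<open>With \<open>N\<close> the order of \<open>n\<close> times the risk, all fluctuations are at most of size \<open>N powr (3 / 4)\<close>: the
U-statistic because its variance is of order \<open>D powr (3 / 2)\<close> for dimension \<open>D\<close>, the linear term because its
variance is of order \<open>sqrt N\<close> times \<open>n\<close> times the squared bias. Relative to \<open>N\<close> they therefore decrease polynomially in \<open>N\<close>,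
and moments of high order give probabilities of any polynomial order.\<close>

lemma pair_event:
  fixes \<phi> :: "'l \<Rightarrow> real \<Rightarrow> real" and \<Phi> N \<epsilon> :: real
  assumes m1: "regular_model \<phi> L (\<Phi> * card L)" and m2: "regular_model \<phi> M (\<Phi> * card M)"
    and \<Phi>: "0 < \<Phi>" and D: "1 \<le> card L" "card L \<le> n" "1 \<le> card M"
    and N: "card L \<le> N" "card M \<le> N" "n * (sq_bias \<phi> L + sq_bias \<phi> M) \<le> N" and \<epsilon>: "0 < \<epsilon>"
  shows "\<exists>B\<in>sets P.
     measure P B \<le> ((moment_const r)\<^sup>2 + 2 * moment_const r)
        * (deviation_const \<Phi> ((L2_norm s)\<^sup>2) / (\<epsilon>\<^sup>2 * sqrt N)) ^ Suc r
     \<and> (\<forall>w\<in>space P - B. \<bar>diag_dev \<phi> L w / n - model_variance \<phi> L (\<Phi> * card L)\<bar> \<le> \<epsilon> * N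
        \<and> \<bar>(full_dev \<phi> L w - diag_dev \<phi> L w) / n\<bar> \<le> 2 * (\<epsilon> * N)
        \<and> \<bar>lin_dev \<phi> L w - lin_dev \<phi> M w\<bar> \<le> \<epsilon> * N)"
proof -
  define \<sigma> where "\<sigma> = (L2_norm s)\<^sup>2"
  let ?k = "deviation_const \<Phi> \<sigma>"
  let ?D = "real (card L)"
  let ?Q = "\<lambda>w. \<Sum>l\<in>L. \<Sum>i\<in>{1..n}. (score \<phi> L (\<Phi> * ?D) l (X i w))\<^sup>2"
  let ?F = "\<lambda>w. \<Sum>l\<in>L. (\<Sum>i\<in>{1..n}. score \<phi> L (\<Phi> * ?D) l (X i w))\<^sup>2"
  let ?V = "\<integral>y. (\<Sum>l\<in>L. (score \<phi> L (\<Phi> * ?D) l y)\<^sup>2) \<partial>law"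
  define a where "a = ?k * (N * sqrt N)"
  have \<sigma>: "0 \<le> \<sigma>" by (simp add: \<sigma>_def)
  note k = deviation_const_ge[OF \<Phi> \<sigma>]
  have N1: "1 \<le> N" using D(1) N(1) by linarith
  have N0: "0 < N" using N1 by simp
  have sN: "1 \<le> sqrt N" using N1 by simp
  have NsN: "N \<le> N * sqrt N" using N0 sN by simp
  have NsN0: "0 < N * sqrt N" using N0 by simp
  have a0: "0 < a" unfolding a_def using k(5) N0 by (intro mult_pos_pos) auto
  have t0: "0 < \<epsilon> * N" using \<epsilon> N0 by simp
  have n0: "0 < real n" using n_pos by simp
  have DN: "?D * sqrt ?D \<le> N * sqrt N"
    using N(1) by (intro mult_mono) auto
  have D1: "1 \<le> ?D" using D(1) by simp
  \<comment> \<open>Since the dimension is at least \<open>1\<close>, the bounds for the scores become multiples of \<open>?D\<close> and \<open>sqrt ?D\<close>.\<close>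
  have "\<exists>B\<in>sets P. measure P B \<le> ((moment_const r)\<^sup>2 + moment_const r) * a ^ Suc r / (\<epsilon> * N) ^ (2 * Suc r)
    \<and> (\<forall>w\<in>space P - B. \<bar>?Q w / n
          - ?V\<bar> \<le> \<epsilon> * N
      \<and> \<bar>(?F w
           - ?Q w) / n\<bar> \<le> 2 * (\<epsilon> * N))"
  proof (rule model_tail[OF m1 D(2) _ _ _ _ _ t0, where c = "2 * (\<Phi> + \<sigma>) * ?D"
        and w = "sqrt \<Phi> * (1 + \<sigma>) / 2 * sqrt ?D"])
    let ?c = "2 * (\<Phi> + \<sigma>) * ?D"
    show "L \<noteq> {}" using D(1) by auto
    show "2 * (\<Phi> * ?D + (L2_norm s)\<^sup>2) \<le> ?c"
      using mult_left_mono[OF D1 \<sigma>] by (simp add: \<sigma>_def[symmetric] algebra_simps)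
    show "sqrt (\<Phi> * ?D) * (1 + (L2_norm s)\<^sup>2) / 2 \<le> sqrt \<Phi> * (1 + \<sigma>) / 2 * sqrt ?D"
      by (simp add: \<sigma>_def real_sqrt_mult)
    have "2 * (sqrt \<Phi> * (1 + \<sigma>) / 2 * sqrt ?D) * ?c = (2 * sqrt \<Phi> * (1 + \<sigma>) * (\<Phi> + \<sigma>)) * (?D * sqrt ?D)"
      by simp
    also have "\<dots> \<le> ?k * (N * sqrt N)"
      by (rule mult_mono[OF k(1) DN]) (use k(5) in auto)
    finally show "2 * (sqrt \<Phi> * (1 + \<sigma>) / 2 * sqrt ?D) * ?c \<le> a" by (simp only: a_def)
    have "4 * ?c\<^sup>2 = 16 * (\<Phi> + \<sigma>)\<^sup>2 * (?D * ?D)" by algebra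
    also have "\<dots> \<le> ?k * (n * (N * sqrt N))"
    proof (intro mult_mono k(2))
      show "?D \<le> real n" using D(2) by simp
      show "?D \<le> N * sqrt N" using N(1) NsN by linarith
    qed (use k(5) N0 in auto)
    finally have "4 * ?c\<^sup>2 \<le> ?k * (n * (N * sqrt N))" .
    then show "4 * ?c\<^sup>2 \<le> n * a" by (simp only: a_def mult_ac)
  qed
  then obtain B1 where B1: "B1 \<in> sets P"
    "measure P B1 \<le> ((moment_const r)\<^sup>2 + moment_const r) * a ^ Suc r / (\<epsilon> * N) ^ (2 * Suc r)"
    "\<And>w. w \<in> space P - B1 \<Longrightarrow> \<bar>?Q w / n
          - ?V\<bar> \<le> \<epsilon> * N"
    "\<And>w. w \<in> space P - B1 \<Longrightarrow> \<bar>(?F w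
           - ?Q w) / n\<bar> \<le> 2 * (\<epsilon> * N)"
    by blast
  let ?G = "regular_points \<phi> L (\<Phi> * card L) \<inter> regular_points \<phi> M (\<Phi> * card M)"
  let ?h = "truncated_centering law ?G (\<lambda>t. projection \<phi> L t - projection \<phi> M t)"
  have "\<exists>B\<in>sets P. measure P B \<le> moment_const r * a ^ Suc r / (\<epsilon> * N) ^ (2 * Suc r)
    \<and> (\<forall>w\<in>space P - B. \<bar>\<Sum>i\<in>{1..n}. ?h (X i w)\<bar> \<le> \<epsilon> * N)"
  proof (rule projection_difference_tail[OF m1 m2 _ _ _ _ _ a0 t0, where c = "sqrt (\<sigma> * \<Phi> * N)"])
    have c2: "(sqrt (\<sigma> * \<Phi> * N))\<^sup>2 = \<sigma> * \<Phi> * N" using \<sigma> \<Phi> N0 by simp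
    show "(L2_norm s)\<^sup>2 * (\<Phi> * card L) \<le> (sqrt (\<sigma> * \<Phi> * N))\<^sup>2" "(L2_norm s)\<^sup>2 * (\<Phi> * card M) \<le> (sqrt (\<sigma> * \<Phi> * N))\<^sup>2"
      unfolding c2 \<sigma>_def[symmetric] using \<sigma> \<Phi> N(1,2) by (simp_all add: mult.assoc mult_left_mono)
    show "0 \<le> sqrt (\<sigma> * \<Phi> * N)" using \<sigma> \<Phi> N0 by simp
    have "12 * sqrt (\<sigma> * \<Phi> * N) * (n * (sq_bias \<phi> L + sq_bias \<phi> M)) \<le> 12 * sqrt (\<sigma> * \<Phi> * N) * N"
      using N(3) \<sigma> \<Phi> N0 by (intro mult_left_mono) auto
    also have "\<dots> = 12 * sqrt (\<sigma> * \<Phi>) * (N * sqrt N)" by (simp add: real_sqrt_mult)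
    also have "\<dots> \<le> a" unfolding a_def using k(3) N0 by (intro mult_right_mono) auto
    finally show "12 * sqrt (\<sigma> * \<Phi> * N) * (n * (sq_bias \<phi> L + sq_bias \<phi> M)) \<le> a" .
    have "16 * (sqrt (\<sigma> * \<Phi> * N))\<^sup>2 = 16 * (\<sigma> * \<Phi>) * N" unfolding c2 by simp
    also have "\<dots> \<le> a" unfolding a_def using k(4,5) NsN N0 by (intro mult_mono) auto
    finally show "16 * (sqrt (\<sigma> * \<Phi> * N))\<^sup>2 \<le> a" .
  qed
  then obtain B2 where B2: "B2 \<in> sets P"
    "measure P B2 \<le> moment_const r * a ^ Suc r / (\<epsilon> * N) ^ (2 * Suc r)"
    "\<And>w. w \<in> space P - B2 \<Longrightarrow> \<bar>\<Sum>i\<in>{1..n}. ?h (X i w)\<bar> \<le> \<epsilon> * N"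
    by blast
  have "AE w in P. (\<forall>i\<in>{1..n}. X i w \<in> ?G)"
    using regular_points(2)[OF m1] regular_points(2)[OF m2] by (intro AE_sample) auto
  then obtain B3 where B3: "{w \<in> space P. \<not> (\<forall>i\<in>{1..n}. X i w \<in> ?G)} \<subseteq> B3" "emeasure P B3 = 0" "B3 \<in> sets P"
    by (rule AE_E)
  have quotient: "a ^ Suc r / (\<epsilon> * N) ^ (2 * Suc r) = (?k / (\<epsilon>\<^sup>2 * sqrt N)) ^ Suc r"
  proof -
    have "a / (\<epsilon> * N)\<^sup>2 = ?k / (\<epsilon>\<^sup>2 * sqrt N)"
    proof -
      have eq: "(\<epsilon> * N)\<^sup>2 = (\<epsilon>\<^sup>2 * sqrt N) * (N * sqrt N)"
        using N0 by (simp add: power2_eq_square)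
      have nz: "N * sqrt N \<noteq> 0" using NsN0 by linarith
      show ?thesis
        unfolding a_def eq by (rule mult_divide_mult_cancel_right[OF nz])
    qed
    then show ?thesis unfolding power_mult[of _ 2 "Suc r"] power_divide[symmetric] by simp
  qed
  show ?thesis
  proof (intro bexI[of _ "B1 \<union> B2 \<union> B3"] conjI ballI)
    show "B1 \<union> B2 \<union> B3 \<in> sets P" using B1 B2 B3 by blast
    have "measure P (B1 \<union> B2 \<union> B3) \<le> measure P B1 + measure P B2 + measure P B3"
      using measure_Un_le[of "B1 \<union> B2" P B3] measure_Un_le[of B1 P B2] B1(1) B2(1) B3(3) by auto
    also have "measure P B3 = 0" using B3(2) by (simp add: measure_def)
    also have "measure P B1 + measure P B2 + 0
        \<le> ((moment_const r)\<^sup>2 + moment_const r) * (a ^ Suc r / (\<epsilon> * N) ^ (2 * Suc r))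
          + moment_const r * (a ^ Suc r / (\<epsilon> * N) ^ (2 * Suc r))"
      using B1(2) B2(2) unfolding times_divide_eq_right by linarith
    also have "\<dots> = ((moment_const r)\<^sup>2 + 2 * moment_const r) * (?k / (\<epsilon>\<^sup>2 * sqrt N)) ^ Suc r"
      unfolding quotient by (simp only: distrib_right mult_2 add.assoc)
    finally show "measure P (B1 \<union> B2 \<union> B3) \<le> ((moment_const r)\<^sup>2 + 2 * moment_const r)
        * (deviation_const \<Phi> ((L2_norm s)\<^sup>2) / (\<epsilon>\<^sup>2 * sqrt N)) ^ Suc r" by (simp only: \<sigma>_def)
  next
    fix w assume "w \<in> space P - (B1 \<union> B2 \<union> B3)"
    then have w: "w \<in> space P - B1" "w \<in> space P - B2" "\<forall>i\<in>{1..n}. X i w \<in> ?G"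
      using B3(1) by auto
    then have wL: "\<forall>i\<in>{1..n}. X i w \<in> regular_points \<phi> L (\<Phi> * card L)" by blast
    show "\<bar>diag_dev \<phi> L w / n - model_variance \<phi> L (\<Phi> * card L)\<bar> \<le> \<epsilon> * N"
      unfolding full_dev_score(2)[OF m1 wL] model_variance_def by (rule B1(3)[OF w(1)])
    show "\<bar>(full_dev \<phi> L w - diag_dev \<phi> L w) / n\<bar> \<le> 2 * (\<epsilon> * N)"
      unfolding full_dev_score[OF m1 wL] by (rule B1(4)[OF w(1)])
    show "\<bar>lin_dev \<phi> L w - lin_dev \<phi> M w\<bar> \<le> \<epsilon> * N"
      unfolding lin_dev_difference[OF m1 m2 w(3)] by (rule B2(3)[OF w(2)])
  qed
qed

end

section \<open>Comparison of the leave-p-out criterion with the loss\<close>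

text \<open>The two terms in the numerator and in the denominator of the constant are compared with the ones that
do not contain \<open>K_lpo n p\<close>, which lies between \<open>1\<close> and \<open>3\<close> for all \<open>p\<close>.\<close>

lemma C_lpo_ge:
  assumes n: "3 \<le> n" and p: "1 \<le> p" "p < n" and d: "0 < d" "d \<le> 1 / 40"
  shows "1 \<le> C_lpo d n p" and "real n / (real n - real p) * ((1 + d) / (1 - d)) \<le> C_lpo d n p"
proof -
  define \<kappa> where "\<kappa> = real n / (real n - real p)"
  define K where "K = K_lpo n p"
  have np: "1 \<le> real n - real p" using p by linarith
  have \<kappa>: "1 \<le> \<kappa>" using np by (simp add: \<kappa>_def)
  have inv: "1 / (1 - real p / real n) = \<kappa>" using n by (simp add: \<kappa>_def field_simps)
  have "real p / (real n - real p) \<le> real p / 1" using np by (intro divide_left_mono) auto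
  also have "\<dots> \<le> real n - 1" using p by linarith
  finally have "real p / (real n - real p) * (1 / (real n - 1)) \<le> (real n - 1) * (1 / (real n - 1))"
    using n by (intro mult_right_mono) auto
  moreover have "(real n - 1) * (1 / (real n - 1)) = 1" using n by simp
  moreover have "2 / (real n - 1) \<le> 1" using n by simp
  moreover have "0 \<le> 2 / (real n - 1)" "0 \<le> real p / (real n - real p) * (1 / (real n - 1))"
    using n p by simp_all
  ultimately have K: "1 \<le> K" "K \<le> 3" unfolding K_def K_lpo_def by linarith+
  have dK: "d \<le> d * K" "d * K \<le> d * 3" using K d by simp_all
  have TBm: "TB_minus d n p \<le> 1 - d" "0 < TB_minus d n p"
    unfolding TB_minus_def K_def[symmetric] using dK d by linarith+
  have "2 * d * K * (3 - 4 * d) \<le> 2 * d * 3 * 3"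
    using K d by (intro mult_mono) auto
  moreover have "1 * ((1 - d) * (1 - 4 * d)) \<le> \<kappa> * ((1 - d) * (1 - 4 * d))"
    using \<kappa> d by (intro mult_right_mono) auto
  moreover have "1 - 5 * d \<le> (1 - d) * (1 - 4 * d)" using d by (simp add: algebra_simps)
  ultimately have TVm: "0 < TV_minus d n p"
    using d unfolding TV_minus_def inv K_def[symmetric] mult.assoc by linarith
  have "0 \<le> 2 * d * K * (3 + 4 * d)" using d K by simp
  moreover have "\<kappa> * (1 + d) * 1 \<le> \<kappa> * (1 + d) * (1 + 4 * d)"
    using d \<kappa> by (intro mult_left_mono) auto
  ultimately have TVp: "\<kappa> * (1 + d) \<le> TV_plus d n p"
    unfolding TV_plus_def inv K_def[symmetric] by linarith
  have "\<kappa> * (1 + d) / (1 - d) \<le> C_lpo d n p"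
  proof -
    have "0 \<le> \<kappa> * (1 + d)" using \<kappa> d by simp
    then have "0 \<le> TV_plus d n p" using TVp by linarith
    then show ?thesis
      unfolding C_lpo_def using TBm TVm TVp by (intro frac_le) (auto simp: le_max_iff_disj)
  qed
  then show le: "real n / (real n - real p) * ((1 + d) / (1 - d)) \<le> C_lpo d n p"
    by (simp add: \<kappa>_def)
  have "1 \<le> (1 + d) / (1 - d)" using d by simp
  then have "1 * 1 \<le> \<kappa> * ((1 + d) / (1 - d))" using \<kappa> by (intro mult_mono) auto
  with le show "1 \<le> C_lpo d n p" by (simp add: \<kappa>_def)
qed

text \<open>Both the loss \<open>z = b + q + y\<close> and the criterion \<open>b + \<kappa> q - \<rho> y - 2 l\<close> consist of the bias \<open>b\<close>, the
diagonal term \<open>q\<close>, the off-diagonal term \<open>y\<close> and, for the criterion, a linear term \<open>l\<close>. If \<open>y\<close> and the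
differences of \<open>l\<close> are negligible, the criterion lies between \<open>z\<close> and \<open>\<kappa> z\<close>, since \<open>b\<close> and \<open>q\<close>
are nonnegative and \<open>\<kappa> \<ge> 1\<close>.\<close>

lemma criterion_comparison:
  fixes b b' q q' y y' l l' \<kappa> \<rho> e d :: real
  defines "z \<equiv> b + q + y" and "z' \<equiv> b' + q' + y'"
  assumes nonneg: "0 \<le> b" "0 \<le> q'" "0 \<le> z" "0 \<le> z'"
    and \<kappa>: "1 \<le> \<kappa>" and \<rho>: "0 \<le> \<rho>" "\<rho> \<le> 4"
    and y: "\<bar>y\<bar> \<le> e * z" "\<bar>y'\<bar> \<le> e * z'" and l: "\<bar>l' - l\<bar> \<le> e * (z' + z)"
    and e: "0 \<le> e" "7 * e \<le> d" and d: "d < 1"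
    and crit: "b' + \<kappa> * q' - \<rho> * y' - 2 * l' \<le> b + \<kappa> * q - \<rho> * y - 2 * l"
  shows "z' \<le> \<kappa> * ((1 + d) / (1 - d)) * z"
proof -
  have ez: "0 \<le> e * z" "0 \<le> e * z'" using e nonneg by simp_all
  have "(\<rho> + 1) * y' \<le> (\<rho> + 1) * (e * z')" using y \<rho> by (intro mult_left_mono) auto
  also have "\<dots> \<le> 5 * (e * z')" using \<rho> ez by (intro mult_right_mono) auto
  finally have 1: "(\<rho> + 1) * y' \<le> 5 * (e * z')" .
  have "0 \<le> (\<kappa> - 1) * q'" "0 \<le> (\<kappa> - 1) * b" using \<kappa> nonneg by simp_all
  then have lower: "z' - 5 * (e * z') \<le> b' + \<kappa> * q' - \<rho> * y'"
    and upper: "b + \<kappa> * q - \<rho> * y \<le> \<kappa> * z + (\<rho> + \<kappa>) * (- y)"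
    using 1 unfolding z_def z'_def by (simp_all add: algebra_simps)
  have "(\<rho> + \<kappa>) * (- y) \<le> (\<rho> + \<kappa>) * (e * z)" using y \<rho> \<kappa> by (intro mult_left_mono) auto
  also have "\<dots> \<le> (5 * \<kappa>) * (e * z)" using \<rho> \<kappa> ez by (intro mult_right_mono) auto
  finally have "z' - 5 * (e * z') \<le> \<kappa> * z + 5 * \<kappa> * (e * z) + 2 * (e * (z' + z))"
    using lower upper crit l by linarith
  moreover have "1 * (e * z) \<le> \<kappa> * (e * z)" using \<kappa> ez by (intro mult_right_mono) auto
  ultimately have "z' - 7 * (e * z') \<le> \<kappa> * z + 7 * (\<kappa> * (e * z))"
    by (simp add: distrib_left)
  moreover have "7 * e * z' \<le> d * z'" "7 * e * (\<kappa> * z) \<le> d * (\<kappa> * z)"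
    using e nonneg \<kappa> by (intro mult_right_mono; simp)+
  ultimately have "(1 - d) * z' \<le> (1 + d) * (\<kappa> * z)"
    by (simp add: algebra_simps)
  then show ?thesis using d by (simp add: field_simps)
qed

context L2_sample
begin

lemma sq_bias_nonneg: "finite L \<Longrightarrow> orthonormal_family \<phi> L \<Longrightarrow> 0 \<le> sq_bias \<phi> L"
  using bessel_inequality[OF s_L2, of L \<phi>] by (simp add: sq_bias_def)

lemma loss_decomposition:
  assumes "finite L" "orthonormal_family \<phi> L"
  shows "n * loss s \<phi> L n (\<lambda>i. X i w)
    = n * sq_bias \<phi> L + diag_dev \<phi> L w / n + (full_dev \<phi> L w - diag_dev \<phi> L w) / n"
proof -
  have n0: "real n \<noteq> 0" using n_pos by simp
  have "(\<Sum>l\<in>L. (1 / real n * (\<Sum>i\<in>{1..n}. \<phi> l (X i w)) - coef \<phi> l)\<^sup>2)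
      = (\<Sum>l\<in>L. (\<Sum>i\<in>{1..n}. \<phi> l (X i w) - coef \<phi> l)\<^sup>2 / (real n)\<^sup>2)"
  proof (intro sum.cong refl)
    fix l
    have "1 / real n * (\<Sum>i\<in>{1..n}. \<phi> l (X i w)) - coef \<phi> l
        = (\<Sum>i\<in>{1..n}. \<phi> l (X i w) - coef \<phi> l) / n"
      using n0 by (simp add: sum_subtractf field_simps)
    then show "(1 / real n * (\<Sum>i\<in>{1..n}. \<phi> l (X i w)) - coef \<phi> l)\<^sup>2
        = (\<Sum>i\<in>{1..n}. \<phi> l (X i w) - coef \<phi> l)\<^sup>2 / (real n)\<^sup>2"
      by (simp only: power_divide)
  qed
  also have "\<dots> = full_dev \<phi> L w / (real n)\<^sup>2"
    by (simp only: full_dev_def sum_divide_distrib)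
  finally have "loss s \<phi> L n (\<lambda>i. X i w) = sq_bias \<phi> L + full_dev \<phi> L w / (real n)\<^sup>2"
    unfolding loss_eq[OF s_L2 assms] sq_bias_def by simp
  then show ?thesis using n0 by (simp add: field_simps power2_eq_square)
qed

lemma lpo_decomposition:
  assumes L: "finite L" "orthonormal_family \<phi> L" and p: "1 \<le> p" "p < n"
  shows "n * (lpo_risk \<phi> L n p (\<lambda>i. X i w) + (L2_norm s)\<^sup>2)
    = n * sq_bias \<phi> L + n / (real n - p) * (diag_dev \<phi> L w / n)
      - n * (real n - p + 1) / ((real n - 1) * (real n - p)) * ((full_dev \<phi> L w - diag_dev \<phi> L w) / n)
      - 2 * lin_dev \<phi> L w"
proof -
  let ?b = "\<lambda>l. coef \<phi> l"
  let ?d = "real n - p"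
  let ?\<rho> = "n * (?d + 1) / ((real n - 1) * ?d)"
  let ?S = "\<lambda>l. \<Sum>i\<in>{1..n}. \<phi> l (X i w)" and ?T = "\<lambda>l. \<Sum>i\<in>{1..n}. (\<phi> l (X i w))\<^sup>2"
  let ?z = "\<lambda>l. \<Sum>i\<in>{1..n}. \<phi> l (X i w) - ?b l" and ?q = "\<lambda>l. \<Sum>i\<in>{1..n}. (\<phi> l (X i w) - ?b l)\<^sup>2"
  have n0: "real n \<noteq> 0" "real n - 1 \<noteq> 0" "?d \<noteq> 0" using p by simp_all
  have coord: "n * (?T l / (n * ?d) - (?d + 1) / (n * (real n - 1) * ?d) * ((?S l)\<^sup>2 - ?T l))
      = n / ?d * (?q l / n) - ?\<rho> * (((?z l)\<^sup>2 - ?q l) / n) - 2 * (?b l * ?z l) - n * (?b l)\<^sup>2" for l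
  proof -
    define z q \<beta> where "z = ?z l" and "q = ?q l" and "\<beta> = ?b l"
    have S: "?S l = z + n * \<beta>" by (simp add: z_def \<beta>_def sum_subtractf)
    have "q = (\<Sum>i\<in>{1..n}. (\<phi> l (X i w))\<^sup>2 + \<beta>\<^sup>2 - 2 * \<beta> * \<phi> l (X i w))"
      unfolding q_def \<beta>_def by (intro sum.cong refl) (simp add: power2_diff)
    also have "\<dots> = ?T l + n * \<beta>\<^sup>2 - 2 * \<beta> * ?S l"
      by (simp add: sum_subtractf sum.distrib sum_distrib_left)
    finally have T: "?T l = q + 2 * \<beta> * z + n * \<beta>\<^sup>2"
      unfolding S by (simp add: power2_eq_square algebra_simps)
    have ST: "(?S l)\<^sup>2 - ?T l = (z\<^sup>2 - q) + (real n - 1) * (2 * \<beta> * z + n * \<beta>\<^sup>2)"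
      unfolding T S by (simp add: power2_eq_square algebra_simps)
    have split: "n * ((?d + 1) / (n * (real n - 1) * ?d) * ((z\<^sup>2 - q) + (real n - 1) * (2 * \<beta> * z + n * \<beta>\<^sup>2)))
        = ?\<rho> * ((z\<^sup>2 - q) / n) + (?d + 1) / ?d * (2 * \<beta> * z + n * \<beta>\<^sup>2)"
    proof -
      have "n * (x / (n * v * u) * (r + v * t)) = n * x / (v * u) * (r / n) + x / u * t"
        if "u \<noteq> 0" "v \<noteq> 0" for u v r t x :: real
        using that n0(1) by (simp add: field_simps)
      from this[OF n0(3) n0(2)] show ?thesis .
    qed
    have "n * (?T l / (n * ?d)) = (q + (2 * \<beta> * z + n * \<beta>\<^sup>2)) / ?d"
    proof -
      have "n * (v / (n * u)) = v / u" for u v :: real using n0(1) by simp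
      then show ?thesis by (simp only: T add.assoc)
    qed
    also have "\<dots> = n / ?d * (q / n) + 1 / ?d * (2 * \<beta> * z + n * \<beta>\<^sup>2)"
    proof -
      have "(v + v') / u = n / u * (v / n) + 1 / u * v'" for u v v' :: real
        using n0(1) by (simp add: add_divide_distrib)
      then show ?thesis .
    qed
    finally have first: "n * (?T l / (n * ?d)) = n / ?d * (q / n) + 1 / ?d * (2 * \<beta> * z + n * \<beta>\<^sup>2)" .
    let ?u = "2 * \<beta> * z + n * \<beta>\<^sup>2"
    have collapse: "x + 1 / ?d * v - (y + (?d + 1) / ?d * v) = x - y - v" for x y v
    proof -
      have "(?d + 1) / ?d = 1 + 1 / ?d" using n0(3) by (simp add: add_divide_distrib)
      then show ?thesis by (simp add: distrib_right)
    qed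
    have "n * (?T l / (n * ?d) - (?d + 1) / (n * (real n - 1) * ?d) * ((?S l)\<^sup>2 - ?T l))
        = n * (?T l / (n * ?d)) - n * ((?d + 1) / (n * (real n - 1) * ?d) * ((?S l)\<^sup>2 - ?T l))"
      by (rule right_diff_distrib)
    also have "\<dots> = n / ?d * (q / n) - ?\<rho> * ((z\<^sup>2 - q) / n) - ?u"
      unfolding first ST split by (rule collapse)
    also have "\<dots> = n / ?d * (q / n) - ?\<rho> * ((z\<^sup>2 - q) / n) - 2 * (\<beta> * z) - n * \<beta>\<^sup>2"
      by (simp only: mult.assoc diff_diff_eq)
    finally show ?thesis by (simp only: z_def q_def \<beta>_def)
  qed
  have "n * lpo_risk \<phi> L n p (\<lambda>i. X i w)
      = (\<Sum>l\<in>L. n / ?d * (?q l / n) - ?\<rho> * (((?z l)\<^sup>2 - ?q l) / n) - 2 * (?b l * ?z l) - n * (?b l)\<^sup>2)"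
    unfolding lpo_risk_eq[OF L p] sum_distrib_left[of "real n" _ L] by (intro sum.cong refl coord)
  also have "\<dots> = n / ?d * (diag_dev \<phi> L w / n) - ?\<rho> * ((full_dev \<phi> L w - diag_dev \<phi> L w) / n)
      - 2 * lin_dev \<phi> L w - n * (\<Sum>l\<in>L. (?b l)\<^sup>2)"
    unfolding diag_dev_def full_dev_def lin_dev_def sum_subtractf[of _ _ L, symmetric]
      sum_divide_distrib[of _ L] sum_distrib_left[of _ _ L] by (rule refl)
  finally show ?thesis by (simp add: sq_bias_def algebra_simps)
qed

text \<open>The event for a single pair of models is intersected over all pairs. Pairs \<open>(m, m)\<close> control the quadratic
terms of the model \<open>m\<close>, and show that \<open>n\<close> times its loss is at least a multiple of \<open>n B + D\<close>; every fluctuation is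
then a small fraction of the losses, as \<open>criterion_comparison\<close> requires.\<close>

lemma finite_sample_oracle:
  fixes \<phi> :: "'l \<Rightarrow> real \<Rightarrow> real" and \<Lambda> :: "'m \<Rightarrow> 'l set" and \<Phi> \<xi> \<epsilon> d N0 :: real
  assumes fin: "finite Ms" and \<Phi>: "0 < \<Phi>" and \<xi>: "0 < \<xi>" and \<epsilon>: "0 < \<epsilon>"
    and n: "3 \<le> n" and N0: "0 < N0"
    and d: "d \<le> 1 / 40" "28 * \<epsilon> \<le> min 1 \<xi> / 2 * d"
    and model: "\<And>m. m \<in> Ms \<Longrightarrow> regular_model \<phi> (\<Lambda> m) (\<Phi> * card (\<Lambda> m))"
      "\<And>m. m \<in> Ms \<Longrightarrow> 1 \<le> card (\<Lambda> m)" "\<And>m. m \<in> Ms \<Longrightarrow> card (\<Lambda> m) \<le> n"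
      "\<And>m. m \<in> Ms \<Longrightarrow> \<xi> * card (\<Lambda> m) \<le> model_variance \<phi> (\<Lambda> m) (\<Phi> * card (\<Lambda> m))"
      "\<And>m. m \<in> Ms \<Longrightarrow> N0 \<le> n * sq_bias \<phi> (\<Lambda> m) + card (\<Lambda> m)"
  shows "\<exists>\<Omega>\<in>sets P. 1 - (real (card Ms))\<^sup>2 * (((moment_const r)\<^sup>2 + 2 * moment_const r)
        * (deviation_const \<Phi> ((L2_norm s)\<^sup>2) / (\<epsilon>\<^sup>2 * sqrt N0)) ^ Suc r) \<le> measure P \<Omega>
    \<and> (\<forall>w\<in>\<Omega>. \<forall>p\<in>{1..n-1}. \<forall>m\<in>Ms. \<forall>m'\<in>Ms.
        lpo_risk \<phi> (\<Lambda> m') n p (\<lambda>i. X i w) \<le> lpo_risk \<phi> (\<Lambda> m) n p (\<lambda>i. X i w) \<longrightarrow>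
        loss s \<phi> (\<Lambda> m') n (\<lambda>i. X i w) \<le> C_lpo d n p * loss s \<phi> (\<Lambda> m) n (\<lambda>i. X i w))"
proof -
  let ?crit = "\<lambda>m p w. lpo_risk \<phi> (\<Lambda> m) n p (\<lambda>i. X i w)"
  let ?loss = "\<lambda>m w. loss s \<phi> (\<Lambda> m) n (\<lambda>i. X i w)"
  let ?D = "\<lambda>m. real (card (\<Lambda> m))"
  let ?B = "\<lambda>m. sq_bias \<phi> (\<Lambda> m)"
  define N where "N = (\<lambda>m. n * ?B m + ?D m)"
  let ?x = "((moment_const r)\<^sup>2 + 2 * moment_const r)
        * (deviation_const \<Phi> ((L2_norm s)\<^sup>2) / (\<epsilon>\<^sup>2 * sqrt N0)) ^ Suc r"
  have L: "finite (\<Lambda> m)" "orthonormal_family \<phi> (\<Lambda> m)" if "m \<in> Ms" for m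
    using model(1)[OF that] by (simp_all add: regular_model_def)
  have B0: "0 \<le> ?B m" if "m \<in> Ms" for m by (rule sq_bias_nonneg[OF L[OF that]])
  have N_ge: "?D m \<le> N m" "n * ?B m \<le> N m" "N0 \<le> N m" "0 \<le> N m" if "m \<in> Ms" for m
    using B0[OF that] model(5)[OF that] by (simp_all add: N_def)
  let ?good = "\<lambda>m m' w. \<bar>diag_dev \<phi> (\<Lambda> m) w / n - model_variance \<phi> (\<Lambda> m) (\<Phi> * ?D m)\<bar> \<le> \<epsilon> * (N m + N m')
        \<and> \<bar>(full_dev \<phi> (\<Lambda> m) w - diag_dev \<phi> (\<Lambda> m) w) / n\<bar> \<le> 2 * (\<epsilon> * (N m + N m'))
        \<and> \<bar>lin_dev \<phi> (\<Lambda> m) w - lin_dev \<phi> (\<Lambda> m') w\<bar> \<le> \<epsilon> * (N m + N m')"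
  have "\<exists>E. E \<in> sets P \<and> measure P E \<le> ?x \<and> (\<forall>w\<in>space P - E. ?good (fst z) (snd z) w)"
    if z: "z \<in> Ms \<times> Ms" for z
  proof -
    obtain m m' where z_eq: "z = (m, m')" and mm: "m \<in> Ms" "m' \<in> Ms" using z by auto
    have le: "?D m \<le> N m + N m'" "?D m' \<le> N m + N m'" "n * (?B m + ?B m') \<le> N m + N m'" "N0 \<le> N m + N m'"
      using N_ge[OF mm(1)] N_ge[OF mm(2)] by (simp_all add: distrib_left)
    have "((moment_const r)\<^sup>2 + 2 * moment_const r)
        * (deviation_const \<Phi> ((L2_norm s)\<^sup>2) / (\<epsilon>\<^sup>2 * sqrt (N m + N m'))) ^ Suc r \<le> ?x"
    proof (intro mult_left_mono power_mono divide_left_mono)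
      have k: "1 \<le> deviation_const \<Phi> ((L2_norm s)\<^sup>2)"
        by (rule deviation_const_ge(5)[OF \<Phi>]) simp
      then show "0 \<le> deviation_const \<Phi> ((L2_norm s)\<^sup>2)" by simp
      have "0 < \<epsilon>\<^sup>2 * sqrt (N m + N m')" "0 < \<epsilon>\<^sup>2 * sqrt N0" using \<epsilon> N0 le(4) by simp_all
      then show "0 < \<epsilon>\<^sup>2 * sqrt (N m + N m') * (\<epsilon>\<^sup>2 * sqrt N0)" by (rule mult_pos_pos)
      show "0 \<le> deviation_const \<Phi> ((L2_norm s)\<^sup>2) / (\<epsilon>\<^sup>2 * sqrt (N m + N m'))"
        using k N0 le(4) by (intro divide_nonneg_nonneg mult_nonneg_nonneg) auto
    qed (use le(4) in \<open>simp_all add: moment_const_def\<close>)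
    moreover obtain E where "E \<in> sets P" "measure P E \<le> ((moment_const r)\<^sup>2 + 2 * moment_const r)
        * (deviation_const \<Phi> ((L2_norm s)\<^sup>2) / (\<epsilon>\<^sup>2 * sqrt (N m + N m'))) ^ Suc r" "\<forall>w\<in>space P - E. ?good m m' w"
      using pair_event[OF model(1)[OF mm(1)] model(1)[OF mm(2)] \<Phi> model(2,3)[OF mm(1)] model(2)[OF mm(2)] le(1-3) \<epsilon>]
      by blast
    ultimately show ?thesis unfolding z_eq fst_conv snd_conv by (intro exI[of _ E] conjI) auto
  qed
  then have "\<forall>z\<in>Ms \<times> Ms. \<exists>E. E \<in> sets P \<and> measure P E \<le> ?x \<and> (\<forall>w\<in>space P - E. ?good (fst z) (snd z) w)"
    by blast
  from bchoice[OF this] obtain E where E: "\<forall>z\<in>Ms \<times> Ms. E z \<in> sets P \<and> measure P (E z) \<le> ?x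
      \<and> (\<forall>w\<in>space P - E z. ?good (fst z) (snd z) w)" by blast
  define Bad where "Bad = (\<Union>z\<in>Ms \<times> Ms. E z)"
  have fin2: "finite (Ms \<times> Ms)" using fin by simp
  have Bad: "Bad \<in> sets P" unfolding Bad_def using fin2 E by (intro sets.finite_UN) auto
  have "measure P Bad \<le> (\<Sum>z\<in>Ms \<times> Ms. measure P (E z))"
    unfolding Bad_def using fin2 E by (intro measure_UNION_le) auto
  also have "\<dots> \<le> (\<Sum>z\<in>Ms \<times> Ms. ?x)" using E by (intro sum_mono) blast
  also have "\<dots> = (real (card Ms))\<^sup>2 * ?x"
    by (simp only: sum_constant card_cartesian_product of_nat_mult power2_eq_square)
  finally have "measure P Bad \<le> (real (card Ms))\<^sup>2 * ?x" .
  moreover have "measure P (space P - Bad) = 1 - measure P Bad"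
    by (rule prob_space.prob_compl[OF prob_P Bad])
  ultimately have prob: "1 - (real (card Ms))\<^sup>2 * ?x \<le> measure P (space P - Bad)" by linarith
  \<comment> \<open>The loss of \<open>m\<close> will be at least \<open>c0 * N m / n\<close>; with \<open>e\<close>, fluctuations are measured relative to the loss.\<close>
  define c0 where "c0 = min 1 \<xi> / 2"
  have c0: "0 < c0" using \<xi> by (simp add: c0_def)
  define e where "e = 4 * \<epsilon> / c0"
  have e: "0 < e" "7 * e \<le> d" using \<epsilon> c0 d(2) by (simp_all add: e_def c0_def[symmetric] field_simps)
  have ec: "4 * \<epsilon> = e * c0" using c0 by (simp add: e_def)
  have d0: "0 < d" using e by linarith
  have "6 * \<epsilon> \<le> c0"
  proof -
    have "c0 * d \<le> c0 * 1" using c0 d(1) by (intro mult_left_mono) auto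
    then show ?thesis using d(2) \<epsilon> unfolding c0_def[symmetric] by linarith
  qed
  note small = this
  have comparison: "?loss m' w \<le> C_lpo d n p * ?loss m w"
    if w: "w \<in> space P - Bad" and p: "p \<in> {1..n-1}" and mm: "m \<in> Ms" "m' \<in> Ms" and crit: "?crit m' p w \<le> ?crit m p w"
    for w p m m'
  proof -
    have p': "1 \<le> p" "p < n" using p n by auto
    have good: "?good k k' w" if "k \<in> Ms" "k' \<in> Ms" for k k'
      using E w that unfolding Bad_def by force
    let ?b = "\<lambda>m. n * ?B m" and ?q = "\<lambda>m. diag_dev \<phi> (\<Lambda> m) w / n"
      and ?y = "\<lambda>m. (full_dev \<phi> (\<Lambda> m) w - diag_dev \<phi> (\<Lambda> m) w) / n"
    let ?z = "\<lambda>m. ?b m + ?q m + ?y m"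
    have size: "c0 * N k \<le> ?z k" "\<bar>?y k\<bar> \<le> e * ?z k" "0 \<le> ?q k" "0 \<le> ?b k" if k: "k \<in> Ms" for k
    proof -
      have double: "\<epsilon> * (N k + N k) = 2 * (\<epsilon> * N k)" by simp
      have "\<bar>?q k - model_variance \<phi> (\<Lambda> k) (\<Phi> * ?D k)\<bar> \<le> 2 * (\<epsilon> * N k)" "\<bar>?y k\<bar> \<le> 2 * (2 * (\<epsilon> * N k))"
        using good[OF k k] unfolding double by blast+
      then have y: "\<bar>?y k\<bar> \<le> 4 * \<epsilon> * N k" and q: "\<xi> * ?D k - 2 * (\<epsilon> * N k) \<le> ?q k"
        using model(4)[OF k] by linarith+
      have "min 1 \<xi> * N k \<le> ?b k + \<xi> * ?D k"
      proof -
        have "min 1 \<xi> * (?b k) \<le> 1 * ?b k" "min 1 \<xi> * ?D k \<le> \<xi> * ?D k"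
          using B0[OF k] by (intro mult_right_mono; simp)+
        then show ?thesis unfolding N_def distrib_left by linarith
      qed
      then have "2 * c0 * N k \<le> ?b k + \<xi> * ?D k" by (simp add: c0_def)
      moreover have "6 * \<epsilon> * N k \<le> c0 * N k" using small N_ge(4)[OF k] by (intro mult_right_mono)
      ultimately show z: "c0 * N k \<le> ?z k" using y q by linarith
      have "4 * \<epsilon> * N k = e * (c0 * N k)" by (simp add: ec)
      also have "\<dots> \<le> e * ?z k" using z e by (intro mult_left_mono) auto
      finally show "\<bar>?y k\<bar> \<le> e * ?z k" using y by linarith
      show "0 \<le> ?q k" "0 \<le> ?b k"
        using B0[OF k] by (simp_all add: diag_dev_def sum_nonneg)
    qed
    let ?\<rho> = "n * (real n - p + 1) / ((real n - 1) * (real n - p))"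
    have z': "?z m' \<le> n / (real n - p) * ((1 + d) / (1 - d)) * ?z m"
    proof (rule criterion_comparison[where e = e and \<rho> = ?\<rho> and l = "lin_dev \<phi> (\<Lambda> m) w"
          and l' = "lin_dev \<phi> (\<Lambda> m') w"])
      show "0 \<le> ?b m" "0 \<le> ?q m'" "\<bar>?y m\<bar> \<le> e * ?z m" "\<bar>?y m'\<bar> \<le> e * ?z m'"
        using size mm by blast+
      have "0 \<le> c0 * N k" if "k \<in> Ms" for k using c0 N_ge(4)[OF that] by simp
      then show "0 \<le> ?z m" "0 \<le> ?z m'" using size(1) mm order_trans by blast+
      show "1 \<le> n / (real n - p)" using p' by simp
      show "0 \<le> ?\<rho>" using p' n by simp
      have "?\<rho> = n / (real n - 1) * ((real n - p + 1) / (real n - p))" by simp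
      also have "\<dots> \<le> 2 * 2"
      proof (intro mult_mono)
        show "n / (real n - 1) \<le> 2" using n by (simp add: field_simps)
        have "1 \<le> real n - p" using p' by linarith
        then show "(real n - p + 1) / (real n - p) \<le> 2" "0 \<le> (real n - p + 1) / (real n - p)"
          by (simp_all add: field_simps)
      qed simp
      finally show "?\<rho> \<le> 4" by simp
      have "\<bar>lin_dev \<phi> (\<Lambda> m') w - lin_dev \<phi> (\<Lambda> m) w\<bar> \<le> \<epsilon> * (N m' + N m)"
        using good[OF mm(2,1)] by blast
      also have "\<dots> \<le> 4 * \<epsilon> * (N m' + N m)"
        using \<epsilon> N_ge(4)[OF mm(1)] N_ge(4)[OF mm(2)] by (intro mult_right_mono) auto
      also have "\<dots> = e * (c0 * N m' + c0 * N m)" by (simp only: ec mult.assoc distrib_left)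
      also have "\<dots> \<le> e * (?z m' + ?z m)"
        using e size(1)[OF mm(1)] size(1)[OF mm(2)] by (intro mult_left_mono) auto
      finally show "\<bar>lin_dev \<phi> (\<Lambda> m') w - lin_dev \<phi> (\<Lambda> m) w\<bar> \<le> e * (?z m' + ?z m)" .
      show "0 \<le> e" "7 * e \<le> d" "d < 1" using e d by simp_all
      have "n * (?crit m' p w + (L2_norm s)\<^sup>2)
          \<le> n * (?crit m p w + (L2_norm s)\<^sup>2)"
        using crit by (intro mult_left_mono) auto
      then show "?b m' + n / (real n - p) * ?q m' - ?\<rho> * ?y m' - 2 * lin_dev \<phi> (\<Lambda> m') w
          \<le> ?b m + n / (real n - p) * ?q m - ?\<rho> * ?y m - 2 * lin_dev \<phi> (\<Lambda> m) w"
        unfolding lpo_decomposition[OF L[OF mm(1)] p'] lpo_decomposition[OF L[OF mm(2)] p'] .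
    qed
    have z0: "0 \<le> ?z m" using size(1)[OF mm(1)] c0 N_ge(4)[OF mm(1)] mult_nonneg_nonneg[of c0 "N m"] by linarith
    note z'
    also have "n / (real n - p) * ((1 + d) / (1 - d)) * ?z m \<le> C_lpo d n p * ?z m"
      by (rule mult_right_mono[OF C_lpo_ge(2)[OF n p' d0 d(1)] z0])
    finally have "n * ?loss m' w \<le> C_lpo d n p * (n * ?loss m w)"
      unfolding loss_decomposition[OF L[OF mm(1)]] loss_decomposition[OF L[OF mm(2)]] .
    then have "n * ?loss m' w \<le> n * (C_lpo d n p * ?loss m w)"
      by (simp only: mult.left_commute)
    then show ?thesis using n_pos by simp
  qed
  show ?thesis
    using prob comparison Bad by (intro bexI[of _ "space P - Bad"] conjI ballI impI) auto
qed

end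

section \<open>Asymptotics in the sample size\<close>

lemma tendsto_real_neg_powr: "a < 0 \<Longrightarrow> (\<lambda>n. real n powr a) \<longlonglongrightarrow> 0"
  by (rule tendsto_neg_powr) (auto intro: filterlim_real_sequentially)

lemma regular_model_if_Linf_norm:
  assumes L: "finite L" "orthonormal_family \<phi> L" and D: "0 < card L" and \<Phi>: "0 < \<Phi>"
    and le: "Linf_norm (phi_model \<phi> L) / ereal (real (card L)) \<le> ereal \<Phi>"
  shows "regular_model \<phi> L (\<Phi> * card L)"
proof -
  have "Linf_norm (phi_model \<phi> L) \<le> ereal (real (card L)) * ereal \<Phi>"
    using le D by (subst (asm) ereal_divide_le_pos) auto
  then have norm: "Linf_norm (phi_model \<phi> L) \<le> ereal (\<Phi> * card L)"
    by (simp add: mult.commute)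
  have "AE t in unit_leb. ereal \<bar>phi_model \<phi> L t\<bar> \<le> Linf_norm (phi_model \<phi> L)"
    unfolding Linf_norm_def by (rule esssup_AE)
  then have "AE t in unit_leb. phi_model \<phi> L t \<le> \<Phi> * card L"
  proof eventually_elim
    case (elim t)
    then have "ereal \<bar>phi_model \<phi> L t\<bar> \<le> ereal (\<Phi> * card L)" using norm by (rule order_trans)
    then show ?case by simp
  qed
  then show ?thesis using L D \<Phi> by (simp add: regular_model_def)
qed

text \<open>If the bias is at least a power of the dimension, bias and variance cannot both be small: the risk
is at least of order \<open>n powr (\<eta> - 1)\<close>, polynomially larger than \<open>1 / n\<close>. The exponent \<open>\<eta>\<close> balances the two cases.\<close>

lemma dimension_tradeoff:
  fixes D l c n :: real
  assumes "1 \<le> D" "0 < l" "0 < c" "1 \<le> n"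
  defines "\<eta> \<equiv> 1 / (1 + l)"
  shows "min 1 c * n powr \<eta> \<le> n * (c * D powr (- l)) + D"
proof (cases "n powr \<eta> \<le> D")
  case True
  have "min 1 c * n powr \<eta> \<le> 1 * n powr \<eta>" by (intro mult_right_mono) auto
  moreover have "0 \<le> n * (c * D powr (- l))" using assms by simp
  ultimately show ?thesis using True by simp
next
  case False
  have \<eta>: "1 + \<eta> * (- l) = \<eta>" using assms(2) by (simp add: \<eta>_def field_simps)
  have "(n powr \<eta>) powr (- l) \<le> D powr (- l)"
    using assms False by (intro powr_mono2') auto
  then have "n * (n powr (\<eta> * (- l))) \<le> n * D powr (- l)"
    using assms by (intro mult_left_mono) (simp_all add: powr_powr)
  moreover have "n * (n powr (\<eta> * (- l))) = n powr \<eta>"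
    using assms(4) powr_add[of n 1 "\<eta> * (- l)"] unfolding \<eta> by simp
  ultimately have "n powr \<eta> \<le> n * D powr (- l)" by simp
  then have "c * n powr \<eta> \<le> c * (n * D powr (- l))" using assms by (intro mult_left_mono) auto
  moreover have "min 1 c * n powr \<eta> \<le> c * n powr \<eta>" by (intro mult_right_mono) auto
  moreover have "c * (n * D powr (- l)) = n * (c * D powr (- l))" by (rule mult.left_commute)
  ultimately show ?thesis using assms(1) by linarith
qed

text \<open>The bound \<open>x \<le> n powr a\<close> on the number of models is beaten by choosing the order of the moments large in terms
of \<open>a\<close> and \<open>\<eta>\<close>: then \<open>x\<^sup>2\<close> times the probability for a single pair is of order \<open>1 / n ^ 3\<close>, which leaves a factor
\<open>n\<close> to absorb all constants.\<close>

lemma polynomial_tail: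
  fixes K k c1 a \<eta> n x :: real
  assumes n: "1 \<le> n" and \<eta>: "0 < \<eta>" and c1: "0 < c1" and K: "0 \<le> K" and k: "0 \<le> k"
    and x: "0 \<le> x" "x \<le> n powr a" and r: "8 * (2 * a + 3) / \<eta> \<le> 2 * real (Suc r)"
    and large: "K * (k / sqrt c1) ^ Suc r \<le> 6 * n"
  shows "x\<^sup>2 * (K * (k / ((n powr (- \<eta> / 8))\<^sup>2 * sqrt (c1 * n powr \<eta>))) ^ Suc r) \<le> 6 / n\<^sup>2"
proof -
  let ?q = "real (Suc r)"
  have n0: "0 < n" using n by simp
  have "(n powr (- \<eta> / 8))\<^sup>2 * sqrt (n powr \<eta>) = n powr (\<eta> / 4)"
  proof -
    have "(n powr (- \<eta> / 8))\<^sup>2 = n powr (- \<eta> / 4)"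
      using n0 by (simp add: power2_eq_square powr_add[symmetric])
    moreover have "sqrt (n powr \<eta>) = n powr (\<eta> / 2)"
      using n0 by (simp add: powr_half_sqrt[symmetric] powr_powr)
    ultimately show ?thesis using n0 by (simp add: powr_add[symmetric])
  qed
  then have "k / ((n powr (- \<eta> / 8))\<^sup>2 * sqrt (c1 * n powr \<eta>)) = (k / sqrt c1) * n powr (- \<eta> / 4)"
    by (simp add: real_sqrt_mult powr_minus divide_simps mult_ac)
  then have eq: "(k / ((n powr (- \<eta> / 8))\<^sup>2 * sqrt (c1 * n powr \<eta>))) ^ Suc r
      = (k / sqrt c1) ^ Suc r * n powr (- \<eta> / 4 * ?q)"
    using n0 by (simp only: power_mult_distrib powr_power powr_realpow[symmetric] powr_powr powr_gt_zero)
  have "x\<^sup>2 \<le> (n powr a)\<^sup>2" using x by (intro power_mono)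
  also have "(n powr a)\<^sup>2 = n powr (2 * a)" using n0 by (simp add: power2_eq_square powr_add[symmetric])
  finally have x2: "x\<^sup>2 \<le> n powr (2 * a)" .
  have "2 * a + - \<eta> / 4 * ?q \<le> - 3"
    using r \<eta> by (simp add: field_simps)
  then have "n powr (2 * a + - \<eta> / 4 * ?q) \<le> n powr (- 3)" using n by (intro powr_mono) auto
  also have "n powr (- 3) = 1 / n ^ 3" using n0 by (simp add: powr_minus divide_simps powr_numeral)
  finally have small: "n powr (2 * a) * n powr (- \<eta> / 4 * ?q) \<le> 1 / n ^ 3" by (simp only: powr_add)
  have "x\<^sup>2 * (K * (k / ((n powr (- \<eta> / 8))\<^sup>2 * sqrt (c1 * n powr \<eta>))) ^ Suc r)
      \<le> n powr (2 * a) * (K * ((k / sqrt c1) ^ Suc r * n powr (- \<eta> / 4 * ?q)))"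
    unfolding eq using x2 K k c1 by (intro mult_right_mono mult_nonneg_nonneg) auto
  also have "\<dots> = (K * (k / sqrt c1) ^ Suc r) * (n powr (2 * a) * n powr (- \<eta> / 4 * ?q))"
    by (simp only: mult_ac)
  also have "\<dots> \<le> (6 * n) * (1 / n ^ 3)"
    by (rule mult_mono[OF large small]) (use n0 in simp_all)
  also have "\<dots> = 6 / n\<^sup>2" using n0 by (simp add: power2_eq_square power3_eq_cube)
  finally show ?thesis .
qed

theorem theorem3p1:
  fixes s :: "real \<Rightarrow> real"
    and P :: "nat \<Rightarrow> 'a measure"
    and X :: "nat \<Rightarrow> nat \<Rightarrow> 'a \<Rightarrow> real"
    and Mod :: "nat \<Rightarrow> 'm set"
    and \<Lambda> :: "'m \<Rightarrow> 'l set"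
    and \<phi> :: "'l \<Rightarrow> real \<Rightarrow> real"
    and mhat :: "nat \<Rightarrow> nat \<Rightarrow> 'a \<Rightarrow> 'm"
  assumes nonneg: "\<forall>t\<in>{0..1}. 0 \<le> s t"
    and sample: "\<forall>n. iid_sample (P n) (X n) n s"
    and models: "\<forall>n. countable (Mod n) \<and>
      (\<forall>m\<in>Mod n. finite (\<Lambda> m) \<and> orthonormal_family \<phi> (\<Lambda> m))"
    and SqI: "square_integrable s"
    and Pol: "assm_Pol Mod"
    and RegD: "assm_RegD \<phi> \<Lambda> Mod"
    and Dmax: "assm_Dmax \<phi> \<Lambda> Mod"
    and Rich: "assm_Rich \<phi> \<Lambda> Mod"
    and LoEx: "assm_LoEx P X s \<phi> \<Lambda> Mod"
    and Bias: "assm_Bias s \<phi> \<Lambda> Mod"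
    and OrSp: "assm_OrSp P X s \<phi> \<Lambda> Mod"
    and mhat: "\<forall>\<^sub>F n in sequentially. \<forall>p\<in>{1..n-1}. \<forall>w\<in>space (P n).
      is_arg_min (\<lambda>m. lpo_risk \<phi> (\<Lambda> m) n p (\<lambda>i. X n i w)) (\<lambda>m. m \<in> Mod n) (mhat n p w)"
  shows "\<exists>\<delta> :: nat \<Rightarrow> real.
    \<delta> \<longlonglongrightarrow> 0 \<and> filterlim (\<lambda>n. real n * \<delta> n) at_top sequentially \<and>
    (\<forall>\<^sub>F n in sequentially.
       \<exists>\<Omega>\<in>sets (P n). measure (P n) \<Omega> \<ge> 1 - 6 / (real n)\<^sup>2 \<and>
         (\<forall>p\<in>{1..n-1}. 1 \<le> C_lpo (\<delta> n) n p \<and>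
           (\<forall>w\<in>\<Omega>.
              loss s \<phi> (\<Lambda> (mhat n p w)) n (\<lambda>i. X n i w)
                \<le> C_lpo (\<delta> n) n p * (INF m\<in>Mod n. loss s \<phi> (\<Lambda> m) n (\<lambda>i. X n i w)))))"
proof -
  let ?crit = "\<lambda>n m p w. lpo_risk \<phi> (\<Lambda> m) n p (\<lambda>i. X n i w)"
  let ?loss = "\<lambda>n m w. loss s \<phi> (\<Lambda> m) n (\<lambda>i. X n i w)"
  let ?D = "\<lambda>m. real (card (\<Lambda> m))"
  have L: "finite (\<Lambda> m)" "orthonormal_family \<phi> (\<Lambda> m)" "model_dim \<phi> (\<Lambda> m) = card (\<Lambda> m)" if "m \<in> Mod n" for m n
    using models that model_dim_eq[of "\<Lambda> m" \<phi>] by auto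
  obtain a where Pol: "\<forall>\<^sub>F n in sequentially. finite (Mod n) \<and> real (card (Mod n)) \<le> real n powr a"
    using Pol unfolding assm_Pol_def by blast
  obtain \<Phi> where \<Phi>: "0 < \<Phi>" and RegD: "\<forall>\<^sub>F n in sequentially. \<forall>m\<in>Mod n.
        Linf_norm (phi_model \<phi> (\<Lambda> m)) / ereal (real (model_dim \<phi> (\<Lambda> m))) \<le> ereal \<Phi>"
    using RegD unfolding assm_RegD_def by blast
  obtain \<xi> where \<xi>: "0 < \<xi>" and LoEx: "\<forall>\<^sub>F n in sequentially. \<forall>m\<in>Mod n.
        sqrt \<xi> \<le> sqrt (real n) * (LINT w|P n. L2_norm (\<lambda>t. orth_proj (model_space \<phi> (\<Lambda> m)) s t
                                    - proj_est \<phi> (\<Lambda> m) {1..n} (\<lambda>i. X n i w) t))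
        / sqrt (real (model_dim \<phi> (\<Lambda> m)))"
    using LoEx unfolding assm_LoEx_def by blast
  obtain cl l where cl: "0 < cl" and l: "0 < l" and Bias: "\<forall>\<^sub>F n in sequentially. \<forall>m\<in>Mod n.
      cl * real (model_dim \<phi> (\<Lambda> m)) powr (- l) \<le> (L2_norm (\<lambda>t. s t - orth_proj (model_space \<phi> (\<Lambda> m)) s t))\<^sup>2"
  proof -
    obtain cl cu l u where *: "cl > 0" "cu > 0" "l > u" "u > 0"
      and **: "\<forall>\<^sub>F n in sequentially. \<forall>m\<in>Mod n.
           cl * real (model_dim \<phi> (\<Lambda> m)) powr (- l)
             \<le> (L2_norm (\<lambda>t. s t - orth_proj (model_space \<phi> (\<Lambda> m)) s t))\<^sup>2 \<and>
           (L2_norm (\<lambda>t. s t - orth_proj (model_space \<phi> (\<Lambda> m)) s t))\<^sup>2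
             \<le> cu * real (model_dim \<phi> (\<Lambda> m)) powr (- u)"
      using Bias unfolding assm_Bias_def by blast
    show ?thesis
      using * by (intro that[of cl l] eventually_mono[OF **]) auto
  qed
  define \<eta> where "\<eta> = 1 / (1 + l)"
  have \<eta>: "0 < \<eta>" "\<eta> \<le> 1" using l by (simp_all add: \<eta>_def)
  define c1 where "c1 = min 1 cl"
  have c1: "0 < c1" using cl by (simp add: c1_def)
  \<comment> \<open>\<open>\<delta>\<close> has to exceed a fixed multiple of \<open>\<epsilon>\<close> and to be larger than \<open>1 / n\<close>; the square root of \<open>\<epsilon>\<close> does both.\<close>
  define \<delta> where "\<delta> = (\<lambda>n. real n powr (- \<eta> / 16))"
  define \<epsilon> where "\<epsilon> = (\<lambda>n. real n powr (- \<eta> / 8))"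
  define c0 where "c0 = min 1 \<xi> / 2"
  have c0: "0 < c0" using \<xi> by (simp add: c0_def)
  obtain r where r: "8 * (2 * a + 3) / \<eta> \<le> 2 * real (Suc r)"
  proof -
    obtain r :: nat where "8 * (2 * a + 3) / \<eta> \<le> real r" using real_arch_simple by blast
    then show ?thesis by (intro that[of r]) simp
  qed
  define K where "K = (moment_const r)\<^sup>2 + 2 * moment_const r"
  define k where "k = deviation_const \<Phi> ((L2_norm s)\<^sup>2)"
  have K: "0 \<le> K" by (simp add: K_def moment_const_def)
  have k: "0 \<le> k" using deviation_const_ge(5)[OF \<Phi>, of "(L2_norm s)\<^sup>2"] by (simp add: k_def)
  have \<delta>_lim: "\<delta> \<longlonglongrightarrow> 0" unfolding \<delta>_def using \<eta> by (intro tendsto_real_neg_powr) simp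
  have n\<delta>: "filterlim (\<lambda>n. real n * \<delta> n) at_top sequentially"
  proof -
    have "filterlim (\<lambda>n. real n powr (1 - \<eta> / 16)) at_top sequentially"
      using \<eta> by (intro filterlim_compose[OF real_powr_at_top filterlim_real_sequentially]) simp
    moreover have "\<forall>\<^sub>F n in sequentially. real n powr (1 - \<eta> / 16) = real n * \<delta> n"
      using eventually_ge_at_top[of 1]
    proof eventually_elim
      case (elim n)
      then show ?case using powr_add[of "real n" 1 "- \<eta> / 16"] by (simp add: \<delta>_def)
    qed
    ultimately show ?thesis by (rule filterlim_cong[THEN iffD1, OF refl refl, rotated])
  qed
  have \<delta>_small: "\<forall>\<^sub>F n in sequentially. \<delta> n < min (1 / 40) (c0 / 28)"
    by (rule order_tendstoD(2)[OF \<delta>_lim]) (use c0 in simp)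
  have n_large: "\<forall>\<^sub>F n in sequentially. K * (k / sqrt c1) ^ Suc r \<le> 6 * real n"
  proof -
    obtain n0 :: nat where "K * (k / sqrt c1) ^ Suc r \<le> real n0" using real_arch_simple by blast
    then show ?thesis
      using eventually_ge_at_top[of n0] by (elim eventually_mono) linarith
  qed
  have main: "\<forall>\<^sub>F n in sequentially.
       \<exists>\<Omega>\<in>sets (P n). measure (P n) \<Omega> \<ge> 1 - 6 / (real n)\<^sup>2 \<and>
         (\<forall>p\<in>{1..n-1}. 1 \<le> C_lpo (\<delta> n) n p \<and>
           (\<forall>w\<in>\<Omega>.
              ?loss n (mhat n p w) w
                \<le> C_lpo (\<delta> n) n p * (INF m\<in>Mod n. ?loss n m w)))"
    using Pol RegD Dmax[unfolded assm_Dmax_def] LoEx Bias mhat \<delta>_small n_large eventually_ge_at_top[of 3]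
  proof eventually_elim
    case (elim n)
    note Pol_n = elim(1) and RegD_n = elim(2) and Dmax_n = elim(3) and LoEx_n = elim(4) and Bias_n = elim(5)
      and mhat_n = elim(6) and small_n = elim(7) and large_n = elim(8) and n3 = elim(9)
    interpret S: L2_sample s "P n" "X n" n
      using nonneg SqI sample n3 by unfold_locales auto
    have n1: "1 \<le> real n" using n3 by simp
    have \<delta>n: "0 < \<delta> n" using n3 by (simp add: \<delta>_def)
    have \<epsilon>n: "0 < \<epsilon> n" using n3 by (simp add: \<epsilon>_def)
    have \<epsilon>\<delta>: "\<epsilon> n = \<delta> n * \<delta> n" by (simp add: \<epsilon>_def \<delta>_def powr_add[symmetric])
    have "28 * \<epsilon> n \<le> c0 * \<delta> n"
      using small_n \<delta>n mult_right_mono[of "28 * \<delta> n" c0 "\<delta> n"] by (simp add: \<epsilon>\<delta> mult.assoc)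
    then have d2: "28 * \<epsilon> n \<le> min 1 \<xi> / 2 * \<delta> n" by (simp only: c0_def)
    have d1: "\<delta> n \<le> 1 / 40" using small_n by simp
    have dim_pos: "0 < card (\<Lambda> m)" if m: "m \<in> Mod n" for m
    proof (rule ccontr)
      assume "\<not> 0 < card (\<Lambda> m)"
      then have "model_dim \<phi> (\<Lambda> m) = 0" using L(3)[OF m] by simp
      then have "sqrt \<xi> \<le> 0" using LoEx_n m by fastforce
      then show False using \<xi> by simp
    qed
    have reg: "regular_model \<phi> (\<Lambda> m) (\<Phi> * ?D m)" if m: "m \<in> Mod n" for m
      using RegD_n m L[OF m] by (intro regular_model_if_Linf_norm dim_pos \<Phi>) auto
    have dim_le: "card (\<Lambda> m) \<le> n" if m: "m \<in> Mod n" for m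
    proof -
      have "exp 1 \<le> real n" using exp_le n3 by (simp add: order_trans[OF exp_le])
      then have "1 \<le> ln (real n)" using n3 by (subst ln_ge_iff) auto
      then have "1 \<le> (ln (real n))\<^sup>2" by simp
      then have "real n / (ln (real n))\<^sup>2 \<le> real n / 1" by (intro divide_left_mono) auto
      moreover have "?D m \<le> real n / (ln (real n))\<^sup>2" using Dmax_n m L(3)[OF m] by auto
      ultimately show ?thesis by simp
    qed
    have var: "\<xi> * ?D m \<le> S.model_variance \<phi> (\<Lambda> m) (\<Phi> * ?D m)" if m: "m \<in> Mod n" for m
      using LoEx_n m L(3)[OF m] by (intro S.variance_lower_bound reg dim_pos \<xi>) auto
    have size: "c1 * real n powr \<eta> \<le> n * S.sq_bias \<phi> (\<Lambda> m) + ?D m" if m: "m \<in> Mod n" for m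
    proof -
      have "cl * ?D m powr (- l) \<le> S.sq_bias \<phi> (\<Lambda> m)"
        using Bias_n m L(3)[OF m] bias_eq[OF SqI L(1,2)[OF m]] by (auto simp: S.sq_bias_def)
      then have "n * (cl * ?D m powr (- l)) \<le> n * S.sq_bias \<phi> (\<Lambda> m)" by (intro mult_left_mono) auto
      moreover have "1 \<le> ?D m" using dim_pos[OF m] by simp
      ultimately show ?thesis
        using dimension_tradeoff[of "?D m" l cl "real n"] l cl n1 unfolding c1_def \<eta>_def by linarith
    qed
    have N0: "0 < c1 * real n powr \<eta>" using c1 n3 by simp
    have card1: "1 \<le> card (\<Lambda> m)" if "m \<in> Mod n" for m using dim_pos[OF that] by simp
    have fin: "finite (Mod n)" using Pol_n by blast
    have "\<exists>\<Omega>\<in>sets (P n).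
      1 - (real (card (Mod n)))\<^sup>2 * (K * (k / ((\<epsilon> n)\<^sup>2 * sqrt (c1 * real n powr \<eta>))) ^ Suc r) \<le> measure (P n) \<Omega>
      \<and> (\<forall>w\<in>\<Omega>. \<forall>p\<in>{1..n-1}. \<forall>m\<in>Mod n. \<forall>m'\<in>Mod n.
        ?crit n m' p w \<le> ?crit n m p w \<longrightarrow>
        ?loss n m' w \<le> C_lpo (\<delta> n) n p * ?loss n m w)"
      unfolding K_def k_def
      by (rule S.finite_sample_oracle[OF fin \<Phi> \<xi> \<epsilon>n n3 N0 d1 d2 reg card1 dim_le var size])
    then obtain \<Omega> where \<Omega>: "\<Omega> \<in> sets (P n)"
      "1 - (real (card (Mod n)))\<^sup>2 * (K * (k / ((\<epsilon> n)\<^sup>2 * sqrt (c1 * real n powr \<eta>))) ^ Suc r) \<le> measure (P n) \<Omega>"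
      and oracle_ineq: "\<forall>w\<in>\<Omega>. \<forall>p\<in>{1..n-1}. \<forall>m\<in>Mod n. \<forall>m'\<in>Mod n.
        ?crit n m' p w \<le> ?crit n m p w \<longrightarrow>
        ?loss n m' w \<le> C_lpo (\<delta> n) n p * ?loss n m w"
      by (elim bexE conjE)
    have tail: "(real (card (Mod n)))\<^sup>2 * (K * (k / ((\<epsilon> n)\<^sup>2 * sqrt (c1 * real n powr \<eta>))) ^ Suc r) \<le> 6 / (real n)\<^sup>2"
      unfolding \<epsilon>_def using Pol_n
      by (intro polynomial_tail[OF n1 \<eta>(1) c1 K k _ _ r large_n]) auto
    show ?case
    proof (intro bexI[OF _ \<Omega>(1)] conjI ballI)
      show "1 - 6 / (real n)\<^sup>2 \<le> measure (P n) \<Omega>" using \<Omega>(2) tail by linarith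
    next
      fix p assume p: "p \<in> {1..n-1}"
      then have p': "1 \<le> p" "p < n" by auto
      show C: "1 \<le> C_lpo (\<delta> n) n p" by (rule C_lpo_ge(1)[OF n3 p' \<delta>n d1])
      fix w assume w: "w \<in> \<Omega>"
      then have "w \<in> space (P n)" using sets.sets_into_space[OF \<Omega>(1)] by blast
      then have "is_arg_min (\<lambda>m. ?crit n m p w) (\<lambda>m. m \<in> Mod n) (mhat n p w)"
        using mhat_n p by blast
      then have m: "mhat n p w \<in> Mod n"
        and min: "\<And>m. m \<in> Mod n \<Longrightarrow>
          ?crit n (mhat n p w) p w \<le> ?crit n m p w"
        unfolding is_arg_min_def not_ex by (simp_all add: not_less)
      have "?loss n (mhat n p w) w / C_lpo (\<delta> n) n p \<le> (INF m\<in>Mod n. ?loss n m w)"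
      proof (rule cINF_greatest)
        show "Mod n \<noteq> {}" using m by blast
        fix m assume "m \<in> Mod n"
        then have "?loss n (mhat n p w) w \<le> C_lpo (\<delta> n) n p * ?loss n m w"
          using oracle_ineq w p m min by blast
        then show "?loss n (mhat n p w) w / C_lpo (\<delta> n) n p \<le> ?loss n m w"
          using C by (simp add: field_simps)
      qed
      then show "?loss n (mhat n p w) w \<le> C_lpo (\<delta> n) n p * (INF m\<in>Mod n. ?loss n m w)"
        using C by (simp add: field_simps)
    qed
  qed
  show ?thesis
    by (intro exI[of _ \<delta>] conjI \<delta>_lim n\<delta> main)
qed

end
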